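(* Let $q$ be a prime power, $n\ge1$, and let $M$ be chosen uniformly at random from $\mathrm{GL}(n,\mathbb{F}_q)$. Then for every integer $0\le h<n-1$ and every monic $f\in\mathbb{F}_q[T]$ of degree $n$, $$\left|\mathbb{P}_{M\in\mathrm{GL}(n,\mathbb{F}_q)}\big(\det(T-M)\in I(f;h)\big)-\frac{q^{h+1}}{q^n}\right|\le q^{-\frac{n^2}{2(n-h-1)}}\Big(1+\frac1{q-1}\Big)^n\binom{2n-h-2}{n}.$$
   Context: For a monic polynomial $f\in\mathbb{F}_q[T]$ of degree $n$ and $0\le h\le n-1$, the short interval is $I(f;h)=\{g\in\mathbb{F}_q[T] \text{ monic}: \deg(f-g)\le h\}$ (with $\deg 0=-\infty$). $\det(T-M)$ is the characteristic polynomial of $M$. *)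

theory Defs
  imports "Jordan_Normal_Form.Char_Poly" "HOL-Computational_Algebra.Polynomial"
begin

text \<open>Short interval I(f;h): monic g with deg(f - g) \<le> h (deg 0 = -infinity, so g = f is included).\<close>
definition short_interval :: "'a::field poly \<Rightarrow> nat \<Rightarrow> 'a poly set" where
  "short_interval f h = {g. monic g \<and> (f - g = 0 \<or> degree (f - g) \<le> h)}"

definition GL_mat :: "nat \<Rightarrow> 'a::field mat set" where
  "GL_mat n = {M \<in> carrier_mat n n. det M \<noteq> 0}"

end

theory Submission
  imports
    "HOL-Algebra.Multiplicative_Group"
    "HOL-Algebra.Algebraic_Closure_Type"
    "HOL-Number_Theory.Residues"
    Defs
begin

text \<open>
  Put \<open>l = n - h - 1\<close>. Fourier analysis on the group of residues \<open>1 + z F[z]/(z\<^sup>l\<^sup>+\<^sup>1)\<close> reduces the claim to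
  bounds for the mean \<open>E n\<close> of \<open>\<chi> (det (T - M))\<close> for nontrivial characters \<open>\<chi>\<close>. Sorting the pairs of a matrix
  and a vector by the minimal annihilating polynomial of the vector yields
  \<open>q\<^sup>n * E n = (\<Sum>d\<le>n. lam d * E (n - d))\<close>, where \<open>lam d\<close> is the sum of \<open>\<chi>\<close> over the monic polynomials of
  degree \<open>d\<close> that do not vanish at 0. As \<open>lam d = 0\<close> for \<open>d > l\<close>, the generating function of \<open>lam\<close> is a
  product of factors \<open>1 - \<gamma>\<^sub>j u\<close> with \<open>j \<le> l\<close>, and \<open>E n\<close> is the sum over all \<open>k\<^sub>1 + \<dots> + k\<^sub>l = n\<close> of the
  products of the numbers \<open>(-\<gamma>\<^sub>j)\<^sup>k / ((q - 1) \<dots> (q\<^sup>k - 1))\<close> with \<open>k = k\<^sub>j\<close>. If all \<open>\<gamma>\<^sub>j\<close> have absolute value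
  at most \<open>sqrt q\<close>, then convexity gives the bound.

  By Newton's identities the power sums of the \<open>\<gamma>\<^sub>j\<close> are, up to sign, sums of \<open>\<chi>\<close> over the norms of \<open>1 - x z\<close>,
  where \<open>x\<close> runs over an extension field. The equidistribution of these norms amounts to counting points
  that a twisted Frobenius fixes on the curve \<open>Y\<^sup>(\<^sup>q\<^sup>) = Y (1 - x z)\<close>. Reduced monomials in its coordinates have
  distinct pole orders at infinity, so that Bombieri's version of Stepanov's method applies without the
  Riemann-Roch theorem.
\<close>

text \<open>With reversed coefficients a monic g of degree n becomes a series with constant term 1,
  whose class modulo z^(l+1) records exactly the coefficients in degrees h+1, ..., n. So the
  interval is a fibre of a multiplicative map to a group of order q^l, the trivial character
  contributes exactly q^(-l) = q^(h+1)/q^n, and each of the q^l - 1 others at most |E n| / q^l. The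
  obstacle is the bound sqrt q, the Riemann hypothesis for these L-functions. Three observations
  make it accessible. There are finitely many gamma_j, so their power sums of large even index,
  bounded up to a constant factor, suffice. The sizes of the q^l norm classes have a known total, so
  upper bounds for all classes control the deviations on both sides. And any bound uniform in the
  extension degree will do, so the number of gaps in the semigroup of pole orders can stand in for
  the genus. At the end |gamma|^k / ((q-1)...(q^k-1)) is about q^(k/2 - k(k+1)/2) = q^(-k^2/2), the
  sum of the k_j^2 is at least n^2/l, and the binomial coefficient counts the tuples (k_1, ...,
  k_l).\<close>

no_notation fps_nth (infixl "$" 75)

section \<open>Matrices and their cyclic subspaces\<close>

lemma char_poly_four_block_lower_left_zero:
  fixes A :: "'a::field mat"
  assumes A: "A \<in> carrier_mat m m" and B: "B \<in> carrier_mat m n" and D: "D \<in> carrier_mat n n"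
  shows "char_poly (four_block_mat A B (0\<^sub>m n m) D) = char_poly A * char_poly D"
proof -
  let ?cm = "\<lambda>A :: 'a mat. [:0, 1:] \<cdot>\<^sub>m 1\<^sub>m (dim_row A) + map_mat (\<lambda>a. [:- a:]) A"
  have "char_poly (four_block_mat A B (0\<^sub>m n m) D) = det (?cm (four_block_mat A B (0\<^sub>m n m) D))"
    unfolding char_poly_defs using A D by simp
  also have "?cm (four_block_mat A B (0\<^sub>m n m) D)
      = four_block_mat (?cm A) (map_mat (\<lambda>a. [:- a:]) B) (0\<^sub>m n m) (?cm D)"
    by (rule eq_matI, insert A B D, auto simp: one_poly_def)
  also have "det \<dots> = det (?cm A) * det (?cm D)"
    by (rule det_four_block_mat_lower_left_zero, insert A B D, auto)
  finally show ?thesis unfolding char_poly_defs .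
qed

text \<open>Multiplication by T on the basis 1, T, ..., T^(d-1) modulo g. In
  \<open>A * companion g\<close> the columns of \<open>A\<close> move one step to the left, and the
  last column becomes a combination of all of them.\<close>

definition companion :: "'a::field poly \<Rightarrow> 'a mat" where
  "companion g = mat (degree g) (degree g)
     (\<lambda>(i, j). if Suc j = degree g then - coeff g i else if i = Suc j then 1 else 0)"

lemma companion_carrier [simp]: "companion g \<in> carrier_mat (degree g) (degree g)"
  by (simp add: companion_def)

text \<open>Only the two outer entries of row 0 matter. Deleting row 0 and column 0 leaves the same
  shape, a Horner step; deleting row 0 and the last column leaves a triangular matrix with diagonal
  -1, whose determinant cancels the cofactor sign.\<close>

lemma det_bordered_shift:
  fixes p :: "nat \<Rightarrow> 'a::comm_ring_1"
  shows "det (mat (Suc d) (Suc d) (\<lambda>(i, j). if j = d then p i else if i = j then x else if i = Suc j then -1 else 0))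
    = (\<Sum>i\<le>d. p i * x ^ i)"
proof (induction d arbitrary: p)
  case 0
  show ?case by (subst det_single) simp_all
next
  case (Suc d)
  define A where "A = mat (Suc (Suc d)) (Suc (Suc d))
    (\<lambda>(i, j). if j = Suc d then p i else if i = j then x else if i = Suc j then -1 else 0)"
  have A: "A \<in> carrier_mat (Suc (Suc d)) (Suc (Suc d))" by (simp add: A_def)
  have "det A = (\<Sum>j<Suc (Suc d). A $$ (0, j) * cofactor A 0 j)"
    by (rule laplace_expansion_row[OF A]) simp
  also have "\<dots> = (\<Sum>j\<in>{0, Suc d}. A $$ (0, j) * cofactor A 0 j)"
    by (rule sum.mono_neutral_right) (auto simp: A_def)
  also have "\<dots> = x * cofactor A 0 0 + p 0 * cofactor A 0 (Suc d)"
    by (simp add: A_def)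
  also have "mat_delete A 0 0 = mat (Suc d) (Suc d) (\<lambda>(i, j). if j = d then p (Suc i) else if i = j then x else if i = Suc j then -1 else 0)"
    by (rule eq_matI) (auto simp: A_def mat_delete_def)
  then have "cofactor A 0 0 = (\<Sum>i\<le>d. p (Suc i) * x ^ i)"
    unfolding cofactor_def by (simp add: Suc)
  also have "cofactor A 0 (Suc d) = 1"
  proof -
    define U where "U = mat_delete A 0 (Suc d)"
    have U: "U = mat (Suc d) (Suc d) (\<lambda>(i, j). if Suc i = j then x else if i = j then -1 else 0)"
      unfolding U_def by (rule eq_matI) (auto simp: A_def mat_delete_def)
    have "upper_triangular U" by (auto simp: U)
    then have "det U = prod_list (diag_mat U)" by (rule det_upper_triangular[where n = "Suc d"]) (simp add: U)
    also have "\<dots> = (-1) ^ Suc d"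
    proof -
      have "diag_mat U = map (\<lambda>_. -1) [0..<Suc d]" unfolding diag_mat_def by (rule map_cong) (auto simp: U)
      then show ?thesis by (simp only: map_replicate_const length_upt prod_list_replicate diff_zero)
    qed
    finally show ?thesis by (simp add: cofactor_def U_def[symmetric] flip: power_mult_distrib)
  qed
  also have "x * (\<Sum>i\<le>d. p (Suc i) * x ^ i) + p 0 * 1 = (\<Sum>i\<le>Suc d. p i * x ^ i)"
    unfolding sum.atMost_Suc_shift by (simp add: sum_distrib_left algebra_simps)
  finally show ?case by (simp add: A_def)
qed

lemma char_poly_companion:
  assumes "monic (g :: 'a::field poly)"
  shows "char_poly (companion g) = g"
proof (cases "degree g")
  case 0
  then obtain a where "g = [:a:]" by (rule degree_eq_zeroE)
  then have "g = 1" using assms by (simp add: one_pCons)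
  moreover have "char_poly (companion (1 :: 'a poly)) = 1"
    unfolding char_poly_def by (rule det_dim_zero) (simp add: char_poly_matrix_def companion_def)
  ultimately show ?thesis by simp
next
  case (Suc d)
  \<comment> \<open>The bottom right diagonal entry lies in the last column, so \<open>p d\<close>
    absorbs the indeterminate.\<close>
  define p where "p i = (if i = d then [:coeff g i, 1:] else [:coeff g i:])" for i
  have "char_poly_matrix (companion g) = mat (Suc d) (Suc d)
     (\<lambda>(i, j). if j = d then p i else if i = j then [:0, 1:] else if i = Suc j then -1 else 0)"
    by (rule eq_matI) (auto simp: char_poly_matrix_def companion_def Suc p_def one_pCons)
  then have "char_poly (companion g) = (\<Sum>i\<le>d. p i * [:0, 1:] ^ i)"
    unfolding char_poly_def by (simp only: det_bordered_shift)
  also have "\<dots> = (\<Sum>i\<le>d. monom (coeff g i) i + (if i = d then monom 1 (Suc d) else 0))"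
  proof (rule sum.cong[OF refl])
    fix i
    have "[:0, 1:] ^ i = monom (1 :: 'a) i" by (simp add: monom_altdef)
    moreover have "[:a, 1:] * monom 1 i = monom a i + monom (1 :: 'a) (Suc i)" for a
      by (simp add: monom_Suc smult_monom)
    ultimately show "p i * [:0, 1:] ^ i = monom (coeff g i) i + (if i = d then monom 1 (Suc d) else 0)"
      by (auto simp: p_def smult_monom)
  qed
  also have "\<dots> = (\<Sum>i\<le>d. monom (coeff g i) i) + monom 1 (Suc d)"
    by (simp add: sum.distrib)
  also have "\<dots> = (\<Sum>i\<le>degree g. monom (coeff g i) i)" using assms by (simp add: Suc)
  also have "\<dots> = g" by (rule poly_as_sum_of_monoms)
  finally show ?thesis .
qed

section \<open>Counting matrices and vectors\<close>

lemma finite_carrier_mat: "finite (carrier_mat nr nc :: 'a::finite mat set)"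
  and card_carrier_mat: "card (carrier_mat nr nc :: 'a::finite mat set) = card (UNIV :: 'a set) ^ (nr * nc)"
proof -
  define I where "I = {0..<nr} \<times> {0..<nc}"
  define F where "F = (\<lambda>f :: nat \<times> nat \<Rightarrow> 'a. mat nr nc f)"
  define G where "G = (\<lambda>A :: 'a mat. restrict (\<lambda>p. A $$ p) I)"
  have bij: "bij_betw F (I \<rightarrow>\<^sub>E UNIV) (carrier_mat nr nc)"
  proof (rule bij_betwI[where g = G])
    show "F \<in> (I \<rightarrow>\<^sub>E UNIV) \<rightarrow> carrier_mat nr nc" by (simp add: F_def)
    show "G \<in> carrier_mat nr nc \<rightarrow> (I \<rightarrow>\<^sub>E UNIV)" by (simp add: G_def)
    show "G (F f) = f" if f: "f \<in> I \<rightarrow>\<^sub>E UNIV" for f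
    proof
      fix p
      show "G (F f) p = f p"
      proof (cases "p \<in> I")
        case True
        then show ?thesis by (cases p) (simp add: F_def G_def I_def)
      next
        case False
        then show ?thesis by (simp add: G_def PiE_arb[OF f])
      qed
    qed
    show "F (G A) = A" if "A \<in> carrier_mat nr nc" for A
      using that by (intro eq_matI) (simp_all add: F_def G_def I_def)
  qed
  have fin: "finite I" by (simp add: I_def)
  have finE: "finite (I \<rightarrow>\<^sub>E (UNIV :: 'a set))" by (rule finite_PiE[OF fin]) simp
  show "finite (carrier_mat nr nc :: 'a::finite mat set)"
    using bij_betw_finite[OF bij] finE by simp
  have "card (I \<rightarrow>\<^sub>E (UNIV :: 'a set)) = card (UNIV :: 'a set) ^ (nr * nc)"
    by (simp add: card_PiE[OF fin]) (simp add: I_def)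
  then show "card (carrier_mat nr nc :: 'a::finite mat set) = card (UNIV :: 'a set) ^ (nr * nc)"
    using bij_betw_same_card[OF bij] by simp
qed

lemma finite_carrier_vec: "finite (carrier_vec n :: 'a::finite vec set)"
  and card_carrier_vec: "card (carrier_vec n :: 'a::finite vec set) = card (UNIV :: 'a set) ^ n"
proof -
  define F where "F = (\<lambda>f :: nat \<Rightarrow> 'a. vec n f)"
  define G where "G = (\<lambda>v :: 'a vec. restrict (\<lambda>i. v $ i) {0..<n})"
  have bij: "bij_betw F ({0..<n} \<rightarrow>\<^sub>E UNIV) (carrier_vec n)"
  proof (rule bij_betwI[where g = G])
    show "F \<in> ({0..<n} \<rightarrow>\<^sub>E UNIV) \<rightarrow> carrier_vec n" by (simp add: F_def)
    show "G \<in> carrier_vec n \<rightarrow> ({0..<n} \<rightarrow>\<^sub>E UNIV)" by (simp add: G_def)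
    show "G (F f) = f" if f: "f \<in> {0..<n} \<rightarrow>\<^sub>E UNIV" for f
    proof
      fix p
      show "G (F f) p = f p"
      proof (cases "p < n")
        case True
        then show ?thesis by (simp add: F_def G_def)
      next
        case False
        then show ?thesis using PiE_arb[OF f, of p] by (simp add: G_def)
      qed
    qed
    show "F (G v) = v" if "v \<in> carrier_vec n" for v
      using that by (intro eq_vecI) (simp_all add: F_def G_def)
  qed
  have finE: "finite ({0..<n} \<rightarrow>\<^sub>E (UNIV :: 'a set))" by (rule finite_PiE) simp_all
  show "finite (carrier_vec n :: 'a::finite vec set)"
    using bij_betw_finite[OF bij] finE by simp
  have "card ({0..<n} \<rightarrow>\<^sub>E (UNIV :: 'a set)) = card (UNIV :: 'a set) ^ n"
    by (simp add: card_PiE)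
  then show "card (carrier_vec n :: 'a::finite vec set) = card (UNIV :: 'a set) ^ n"
    using bij_betw_same_card[OF bij] by simp
qed

section \<open>Injective matrices, their completions, and prescribed invariant subspaces\<close>

definition inj_mats :: "nat \<Rightarrow> nat \<Rightarrow> 'a::field mat set" where
  "inj_mats n d = {A \<in> carrier_mat n d. \<forall>c\<in>carrier_vec d. A *\<^sub>v c = 0\<^sub>v n \<longrightarrow> c = 0\<^sub>v d}"

text \<open>The inclusion of the first d coordinates. \<open>P * left_id n d\<close> consists of the
  first d columns of \<open>P\<close>, so \<open>P * left_id n d = A\<close> says that
  \<open>P\<close> completes \<open>A\<close>.\<close>

definition left_id :: "nat \<Rightarrow> nat \<Rightarrow> 'a::field mat" where
  "left_id n d = mat n d (\<lambda>(i, j). if i = j then 1 else 0)"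

lemma left_id_carrier [simp]: "left_id n d \<in> carrier_mat n d"
  by (simp add: left_id_def)

lemma mult_left_id:
  assumes "P \<in> carrier_mat m n" "d \<le> n"
  shows "P * left_id n d = mat m d (\<lambda>(i, j). P $$ (i, j))"
proof (rule eq_matI)
  fix i j assume ij: "i < dim_row (mat m d (\<lambda>(i, j). P $$ (i, j)))" "j < dim_col (mat m d (\<lambda>(i, j). P $$ (i, j)))"
  then have "(P * left_id n d) $$ (i, j) = (\<Sum>k = 0..<n. P $$ (i, k) * (if k = j then 1 else 0))"
    using assms by (auto simp: left_id_def scalar_prod_def intro!: sum.cong)
  also have "\<dots> = P $$ (i, j)" using ij assms by (simp add: if_distrib[of "\<lambda>x. _ * x"] sum.delta cong: if_cong)
  finally show "(P * left_id n d) $$ (i, j) = mat m d (\<lambda>(i, j). P $$ (i, j)) $$ (i, j)" using ij by simp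
qed (use assms in \<open>auto simp: left_id_def\<close>)

lemma left_id_mult:
  assumes "C \<in> carrier_mat d m" "d \<le> n"
  shows "left_id n d * C = mat n m (\<lambda>(i, j). if i < d then C $$ (i, j) else 0)"
proof (rule eq_matI)
  fix i j assume ij: "i < dim_row (mat n m (\<lambda>(i, j). if i < d then C $$ (i, j) else 0))" "j < dim_col (mat n m (\<lambda>(i, j). if i < d then C $$ (i, j) else 0))"
  then have "(left_id n d * C) $$ (i, j) = (\<Sum>k = 0..<d. (if k = i then 1 else 0) * C $$ (k, j))"
    using assms by (auto simp: left_id_def scalar_prod_def intro!: sum.cong)
  also have "\<dots> = (if i < d then C $$ (i, j) else 0)" by (simp add: if_distrib[of "\<lambda>x. x * _"] sum.delta cong: if_cong)
  finally show "(left_id n d * C) $$ (i, j) = mat n m (\<lambda>(i, j). if i < d then C $$ (i, j) else 0) $$ (i, j)" using ij by simp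
qed (use assms in \<open>auto simp: left_id_def\<close>)

text \<open>These are the matrices of the endomorphisms that preserve the span of the first \<open>d\<close> basis
  vectors and act on it by \<open>C\<close>.\<close>
lemma intertwining_blocks:
  fixes C :: "'a::field mat"
  assumes C: "C \<in> carrier_mat d d" and d: "d \<le> n"
  shows "bij_betw (\<lambda>(B, D). four_block_mat C B (0\<^sub>m (n - d) d) D)
    (carrier_mat d (n - d) \<times> carrier_mat (n - d) (n - d))
    {N \<in> carrier_mat n n. N * left_id n d = left_id n d * C}"
proof -
  define F where "F = (\<lambda>(B :: 'a mat, D). four_block_mat C B (0\<^sub>m (n - d) d) D)"
  define G where "G = (\<lambda>N :: 'a mat. (mat d (n - d) (\<lambda>(i, j). N $$ (i, j + d)), mat (n - d) (n - d) (\<lambda>(i, j). N $$ (i + d, j + d))))"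
  have iff: "N * left_id n d = left_id n d * C \<longleftrightarrow> (\<forall>i<n. \<forall>j<d. N $$ (i, j) = (if i < d then C $$ (i, j) else 0))"
    if "N \<in> carrier_mat n n" for N
    unfolding mult_left_id[OF that d] left_id_mult[OF C d] by (auto simp: mat_eq_iff)
  have "bij_betw F (carrier_mat d (n - d) \<times> carrier_mat (n - d) (n - d)) {N \<in> carrier_mat n n. N * left_id n d = left_id n d * C}"
  proof (rule bij_betwI[where g = G])
    show "F \<in> carrier_mat d (n - d) \<times> carrier_mat (n - d) (n - d) \<rightarrow> {N \<in> carrier_mat n n. N * left_id n d = left_id n d * C}"
    proof
      fix p :: "'a mat \<times> 'a mat" assume "p \<in> carrier_mat d (n - d) \<times> carrier_mat (n - d) (n - d)"
      then obtain B D where p: "p = (B, D)" "B \<in> carrier_mat d (n - d)" "D \<in> carrier_mat (n - d) (n - d)" by auto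
      have N: "F p \<in> carrier_mat n n"
        using four_block_carrier_mat[OF C p(3)] d by (simp add: F_def p)
      have "\<forall>i<n. \<forall>j<d. F p $$ (i, j) = (if i < d then C $$ (i, j) else 0)"
        using p C d by (auto simp: F_def)
      then show "F p \<in> {N \<in> carrier_mat n n. N * left_id n d = left_id n d * C}" using N iff[OF N] by blast
    qed
    show "G \<in> {N \<in> carrier_mat n n. N * left_id n d = left_id n d * C} \<rightarrow> carrier_mat d (n - d) \<times> carrier_mat (n - d) (n - d)"
      by (auto simp: G_def)
    show "F (G N) = N" if "N \<in> {N \<in> carrier_mat n n. N * left_id n d = left_id n d * C}" for N
      using that iff[of N] C d by (intro eq_matI) (auto simp: F_def G_def)
    show "G (F p) = p" if "p \<in> carrier_mat d (n - d) \<times> carrier_mat (n - d) (n - d)" for p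
      using that C d by (cases p) (auto simp: F_def G_def intro!: eq_matI)
  qed
  then show ?thesis by (simp only: F_def)
qed

lemma card_field_ge_2: "card (UNIV :: 'a::{field,finite} set) \<ge> 2"
proof -
  have "card {0, 1 :: 'a} \<le> card (UNIV :: 'a set)" by (intro card_mono) auto
  then show ?thesis by simp
qed

lemma mult_mat_vec_index:
  assumes "A \<in> carrier_mat n d" "c \<in> carrier_vec d" "i < n"
  shows "(A *\<^sub>v c) $ i = (\<Sum>j<d. A $$ (i, j) * c $ j)"
  using assms by (auto simp: mult_mat_vec_def scalar_prod_def atLeast0LessThan)

lemma mult_mat_index:
  assumes "A \<in> carrier_mat n d" "B \<in> carrier_mat d m" "i < n" "j < m"
  shows "(A * B) $$ (i, j) = (\<Sum>k<d. A $$ (i, k) * B $$ (k, j))"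
  using assms by (auto simp: scalar_prod_def atLeast0LessThan)

lemma inj_matsD:
  assumes "A \<in> inj_mats n d" "c \<in> carrier_vec d" "\<And>i. i < n \<Longrightarrow> (\<Sum>j<d. A $$ (i, j) * c $ j) = 0"
  shows "c = 0\<^sub>v d"
proof -
  have A: "A \<in> carrier_mat n d" using assms(1) by (simp add: inj_mats_def)
  have "A *\<^sub>v c = 0\<^sub>v n"
    using assms A by (intro eq_vecI) (simp_all add: mult_mat_vec_index[OF A] del: index_mult_mat_vec)
  then show ?thesis using assms by (simp add: inj_mats_def)
qed

lemma inj_matsI:
  assumes A: "A \<in> carrier_mat n d" and "\<And>c. c \<in> carrier_vec d \<Longrightarrow> (\<And>i. i < n \<Longrightarrow> (\<Sum>j<d. A $$ (i, j) * c $ j) = 0) \<Longrightarrow> c = 0\<^sub>v d"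
  shows "A \<in> inj_mats n d"
proof -
  have "c = 0\<^sub>v d" if c: "c \<in> carrier_vec d" and z: "A *\<^sub>v c = 0\<^sub>v n" for c
  proof (rule assms(2)[OF c])
    fix i assume "i < n"
    then show "(\<Sum>j<d. A $$ (i, j) * c $ j) = 0"
      using z mult_mat_vec_index[OF A c, of i] by simp
  qed
  then show ?thesis using A by (simp add: inj_mats_def)
qed

text \<open>Dimension by counting: injectivity embeds q^d vectors into q^n vectors.\<close>

lemma inj_mats_le:
  assumes A: "(A :: 'a::{field,finite} mat) \<in> inj_mats n d"
  shows "d \<le> n"
proof -
  have cA: "A \<in> carrier_mat n d" using A by (simp add: inj_mats_def)
  have "inj_on (\<lambda>c. A *\<^sub>v c) (carrier_vec d)"
  proof (rule inj_onI)
    fix c c' assume c: "c \<in> carrier_vec d" "c' \<in> carrier_vec d" and eq: "A *\<^sub>v c = A *\<^sub>v c'"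
    have "A *\<^sub>v (c - c') = 0\<^sub>v n" using mult_minus_distrib_mat_vec[OF cA c] eq cA c by simp
    then have "c - c' = 0\<^sub>v d" using A c by (simp add: inj_mats_def)
    then have "(c - c') $ i = 0" if "i < d" for i using that by simp
    then show "c = c'" using c by (intro eq_vecI) auto
  qed
  then have "card (carrier_vec d :: 'a vec set) \<le> card (carrier_vec n :: 'a vec set)"
    using cA finite_carrier_vec by (intro card_inj_on_le) auto
  then show ?thesis unfolding card_carrier_vec using card_field_ge_2[where 'a='a]
    by (simp add: power_increasing_iff)
qed

text \<open>While d < n, the image has at most q^d < q^n elements, so a column outside it can be
  appended.\<close>

lemma inj_mats_extend:
  fixes A :: "'a::{field,finite} mat"
  assumes "A \<in> inj_mats n d"
  shows "\<exists>P\<in>GL_mat n. P * left_id n d = A"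
  using assms
proof (induction "n - d" arbitrary: d A)
  case 0
  then have d: "d = n" using inj_mats_le[of A n d] by simp
  have A: "A \<in> carrier_mat n n" using 0 by (simp add: d inj_mats_def)
  have "det A \<noteq> 0"
    using 0(2) unfolding det_0_iff_vec_prod_zero_field[OF A] by (auto simp: inj_mats_def d)
  moreover have "A * left_id n n = A" using A by (subst mult_left_id[OF A]) (auto intro!: eq_matI)
  ultimately show ?case using A by (auto simp: GL_mat_def d)
next
  case (Suc k)
  have dn: "d < n" using Suc(2) by simp
  have A: "A \<in> carrier_mat n d" using Suc by (simp add: inj_mats_def)
  have "card ((\<lambda>c. A *\<^sub>v c) ` carrier_vec d) \<le> card (carrier_vec d :: 'a vec set)"
    using finite_carrier_vec by (rule card_image_le)
  also have "\<dots> < card (carrier_vec n :: 'a vec set)"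
    unfolding card_carrier_vec using card_field_ge_2[where 'a='a] dn by (intro power_strict_increasing) auto
  finally have "\<not> carrier_vec n \<subseteq> (\<lambda>c. A *\<^sub>v c) ` carrier_vec d"
    using card_mono[OF finite_imageI[OF finite_carrier_vec]] by (metis not_less)
  then obtain w where w: "w \<in> carrier_vec n" "w \<notin> (\<lambda>c. A *\<^sub>v c) ` carrier_vec d" by blast
  define A' where "A' = mat n (Suc d) (\<lambda>(i, j). if j < d then A $$ (i, j) else w $ i)"
  have A': "A' \<in> carrier_mat n (Suc d)" by (simp add: A'_def)
  have "A' \<in> inj_mats n (Suc d)"
  proof (rule inj_matsI[OF A'])
    fix c assume c: "c \<in> carrier_vec (Suc d)" and z: "\<And>i. i < n \<Longrightarrow> (\<Sum>j<Suc d. A' $$ (i, j) * c $ j) = 0"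
    have z': "(\<Sum>j<d. A $$ (i, j) * c $ j) + w $ i * c $ d = 0" if "i < n" for i
      using z[OF that] that by (simp add: A'_def)
    \<comment> \<open>Otherwise dividing by the last coordinate would express \<open>w\<close>
      through the columns of \<open>A\<close>.\<close>
    have cd: "c $ d = 0"
    proof (rule ccontr)
      assume nz: "c $ d \<noteq> 0"
      define b where "b = vec d (\<lambda>j. - c $ j / c $ d)"
      have "w = A *\<^sub>v b"
      proof (rule eq_vecI)
        fix i assume "i < dim_vec (A *\<^sub>v b)"
        then have i: "i < n" using A by simp
        have "(A *\<^sub>v b) $ i = (\<Sum>j<d. A $$ (i, j) * (- c $ j / c $ d))"
          using mult_mat_vec_index[OF A, of b i] i by (simp add: b_def)
        also have "\<dots> = - (\<Sum>j<d. A $$ (i, j) * c $ j) / c $ d"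
          by (simp add: sum_divide_distrib sum_negf)
        also have "(\<Sum>j<d. A $$ (i, j) * c $ j) = - w $ i * c $ d" using z'[OF i] by (simp add: eq_neg_iff_add_eq_0)
        finally show "w $ i = (A *\<^sub>v b) $ i" using nz by simp
      qed (use w A in auto)
      then show False using w by (auto simp: b_def)
    qed
    have "vec d (\<lambda>j. c $ j) = 0\<^sub>v d"
      using z' cd by (intro inj_matsD[OF Suc(3)]) auto
    then have "c $ j = 0" if "j < d" for j using that by (metis index_vec index_zero_vec(1))
    then show "c = 0\<^sub>v (Suc d)" using c cd by (intro eq_vecI) (auto simp: less_Suc_eq)
  qed
  moreover have "k = n - Suc d" using Suc(2) by simp
  ultimately obtain P where P: "P \<in> GL_mat n" "P * left_id n (Suc d) = A'" using Suc(1) by blast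
  have cP: "P \<in> carrier_mat n n" using P by (simp add: GL_mat_def)
  have "P * left_id n d = A"
  proof (rule eq_matI)
    fix i j assume ij: "i < dim_row A" "j < dim_col A"
    have "P $$ (i, j) = (P * left_id n (Suc d)) $$ (i, j)"
      using ij A dn by (subst mult_left_id[OF cP]) auto
    then have "P $$ (i, j) = A $$ (i, j)" using ij A by (simp add: P(2) A'_def)
    then show "(P * left_id n d) $$ (i, j) = A $$ (i, j)"
      using ij A dn by (subst mult_left_id[OF cP]) auto
  qed (use A cP in \<open>auto simp: left_id_def\<close>)
  then show ?case using P by blast
qed

lemma GL_mat_inverse:
  assumes "P \<in> GL_mat n"
  shows "\<exists>Q\<in>carrier_mat n n. P * Q = 1\<^sub>m n \<and> Q * P = 1\<^sub>m n"
proof -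
  have P: "P \<in> carrier_mat n n" "det P \<noteq> 0" using assms by (auto simp: GL_mat_def)
  from det_non_zero_imp_unit[OF this, of "()"] show ?thesis
    unfolding Units_def ring_mat_def by auto
qed

lemma GL_mat_inj:
  assumes "P \<in> GL_mat n" "A \<in> carrier_mat n m" "B \<in> carrier_mat n m" "P * A = P * B"
  shows "A = B"
proof -
  have P: "P \<in> carrier_mat n n" using assms by (simp add: GL_mat_def)
  obtain Q where Q: "Q \<in> carrier_mat n n" "Q * P = 1\<^sub>m n" using GL_mat_inverse[OF assms(1)] by blast
  have "A = Q * P * A" by (simp only: Q(2) left_mult_one_mat[OF assms(2)])
  also have "\<dots> = Q * (P * A)" by (rule assoc_mult_mat[OF Q(1) P assms(2)])
  also have "\<dots> = Q * P * B" unfolding assms(4) by (rule assoc_mult_mat[OF Q(1) P assms(3), symmetric])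
  also have "\<dots> = B" by (simp only: Q(2) left_mult_one_mat[OF assms(3)])
  finally show ?thesis .
qed

lemma finite_GL_mat: "finite (GL_mat n :: 'a::{field,finite} mat set)"
  using finite_carrier_mat by (rule finite_subset[rotated]) (auto simp: GL_mat_def)

lemma finite_inj_mats: "finite (inj_mats n d :: 'a::{field,finite} mat set)"
  using finite_carrier_mat by (rule finite_subset[rotated]) (auto simp: inj_mats_def)

text \<open>Determinant and characteristic polynomial depend on the diagonal blocks only, so the
  upper right block is free and contributes the power of q.\<close>

lemma sum_intertwining:
  fixes C :: "'a::{field,finite} mat" and \<phi> :: "'a poly \<Rightarrow> complex"
  assumes C: "C \<in> carrier_mat d d" and d: "d \<le> n"
  shows "(\<Sum>N | N \<in> GL_mat n \<and> N * left_id n d = left_id n d * C. \<phi> (char_poly N))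
    = (if det C = 0 then 0 else of_nat (card (UNIV :: 'a set) ^ (d * (n - d))) * (\<Sum>D\<in>GL_mat (n - d). \<phi> (char_poly C * char_poly D)))"
proof -
  define F where "F = (\<lambda>(B, D). four_block_mat C B (0\<^sub>m (n - d) d) D)"
  define S where "S = {N \<in> carrier_mat n n. N * left_id n d = left_id n d * C}"
  have finS: "finite S" using finite_carrier_mat by (rule finite_subset[rotated]) (auto simp: S_def)
  have bij: "bij_betw F (carrier_mat d (n - d) \<times> carrier_mat (n - d) (n - d)) S"
    unfolding F_def S_def by (rule intertwining_blocks[OF C d])
  have "(\<Sum>N | N \<in> GL_mat n \<and> N * left_id n d = left_id n d * C. \<phi> (char_poly N))
     = (\<Sum>N\<in>S. if det N \<noteq> 0 then \<phi> (char_poly N) else 0)"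
    by (rule sum.mono_neutral_cong_left[OF finS]) (auto simp: S_def GL_mat_def)
  also have "\<dots> = (\<Sum>p\<in>carrier_mat d (n - d) \<times> carrier_mat (n - d) (n - d). if det (F p) \<noteq> 0 then \<phi> (char_poly (F p)) else 0)"
    by (rule sum.reindex_bij_betw[OF bij, symmetric])
  also have "\<dots> = (\<Sum>p\<in>(carrier_mat d (n - d) :: 'a mat set) \<times> carrier_mat (n - d) (n - d).
     if det C \<noteq> 0 \<and> det (snd p) \<noteq> 0 then \<phi> (char_poly C * char_poly (snd p)) else 0)"
  proof (rule sum.cong[OF refl])
    fix p :: "'a mat \<times> 'a mat" assume p: "p \<in> carrier_mat d (n - d) \<times> carrier_mat (n - d) (n - d)"
    obtain B D where BD: "p = (B, D)" "B \<in> carrier_mat d (n - d)" "D \<in> carrier_mat (n - d) (n - d)" using p by auto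
    have "det (F p) = det C * det D" using BD C by (simp add: F_def det_four_block_mat_lower_left_zero)
    moreover have "char_poly (F p) = char_poly C * char_poly D"
      using char_poly_four_block_lower_left_zero[OF C BD(2,3)] by (simp add: F_def BD)
    ultimately show "(if det (F p) \<noteq> 0 then \<phi> (char_poly (F p)) else 0)
      = (if det C \<noteq> 0 \<and> det (snd p) \<noteq> 0 then \<phi> (char_poly C * char_poly (snd p)) else 0)" by (simp add: BD)
  qed
  also have "\<dots> = (\<Sum>B\<in>(carrier_mat d (n - d) :: 'a mat set). \<Sum>D\<in>carrier_mat (n - d) (n - d).
     if det C \<noteq> 0 \<and> det D \<noteq> 0 then \<phi> (char_poly C * char_poly D) else 0)"
    by (subst sum.cartesian_product) (simp add: case_prod_unfold)
  also have "\<dots> = (if det C = 0 then 0 else of_nat (card (UNIV :: 'a set) ^ (d * (n - d))) * (\<Sum>D\<in>GL_mat (n - d). \<phi> (char_poly C * char_poly D)))"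
  proof -
    have "(\<Sum>D\<in>carrier_mat (n - d) (n - d). if det C \<noteq> 0 \<and> det D \<noteq> 0 then \<phi> (char_poly C * char_poly D) else 0)
      = (if det C = 0 then 0 else \<Sum>D\<in>GL_mat (n - d). \<phi> (char_poly C * char_poly D))"
      by (auto intro!: sum.mono_neutral_cong_right finite_carrier_mat simp: GL_mat_def)
    then show ?thesis by (simp add: card_carrier_mat)
  qed
  finally show ?thesis .
qed

text \<open>Multiplying by the inverse of one completion carries all of them to the invertible
  matrices that fix the first d basis vectors. These are counted by \<open>sum_intertwining\<close>
  for the identity block and the constant function 1.\<close>

lemma card_completions:
  fixes A :: "'a::{field,finite} mat"
  assumes A: "A \<in> inj_mats n d"
  shows "card {P \<in> GL_mat n. P * left_id n d = A} = card (UNIV :: 'a set) ^ (d * (n - d)) * card (GL_mat (n - d) :: 'a mat set)"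
proof -
  have d: "d \<le> n" using inj_mats_le[OF A] .
  obtain P0 where P0: "P0 \<in> GL_mat n" "P0 * left_id n d = A" using inj_mats_extend[OF A] by blast
  have cP0: "P0 \<in> carrier_mat n n" "det P0 \<noteq> 0" using P0 by (auto simp: GL_mat_def)
  obtain Q where Q: "Q \<in> carrier_mat n n" "P0 * Q = 1\<^sub>m n" "Q * P0 = 1\<^sub>m n" using GL_mat_inverse[OF P0(1)] by blast
  define S where "S = {N \<in> GL_mat n. N * left_id n d = (left_id n d * 1\<^sub>m d :: 'a mat)}"
  have Jone: "left_id n d * 1\<^sub>m d = (left_id n d :: 'a mat)" by (rule right_mult_one_mat[OF left_id_carrier])
  have J: "left_id n d \<in> carrier_mat n d" by simp
  have "bij_betw (\<lambda>N. P0 * N) S {P \<in> GL_mat n. P * left_id n d = A}"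
  proof (rule bij_betwI[where g = "\<lambda>P. Q * P"])
    show "(\<lambda>N. P0 * N) \<in> S \<rightarrow> {P \<in> GL_mat n. P * left_id n d = A}"
    proof
      fix N assume N: "N \<in> S"
      then have cN: "N \<in> carrier_mat n n" "det N \<noteq> 0" by (auto simp: S_def GL_mat_def)
      have "P0 * N * left_id n d = P0 * (N * left_id n d)" by (rule assoc_mult_mat[OF cP0(1) cN(1) J])
      also have "\<dots> = A" using N P0(2) by (simp add: S_def Jone)
      finally show "P0 * N \<in> {P \<in> GL_mat n. P * left_id n d = A}"
        using cP0 cN by (simp add: GL_mat_def det_mult)
    qed
    show "(\<lambda>P. Q * P) \<in> {P \<in> GL_mat n. P * left_id n d = A} \<rightarrow> S"
    proof
      fix P assume P: "P \<in> {P \<in> GL_mat n. P * left_id n d = A}"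
      then have cP: "P \<in> carrier_mat n n" "det P \<noteq> 0" by (auto simp: GL_mat_def)
      have "Q * P * left_id n d = Q * (P0 * left_id n d)" using P P0(2) assoc_mult_mat[OF Q(1) cP(1) J] by simp
      also have "\<dots> = left_id n d"
        by (simp only: assoc_mult_mat[OF Q(1) cP0(1) J, symmetric] Q(3) left_mult_one_mat[OF J])
      finally have "Q * P * left_id n d = left_id n d" .
      moreover have "det Q \<noteq> 0" using det_mult[OF Q(1) cP0(1)] Q(3) by auto
      ultimately show "Q * P \<in> S" using Q(1) cP by (simp add: S_def GL_mat_def det_mult Jone)
    qed
    show "Q * (P0 * N) = N" if "N \<in> S" for N
    proof -
      have cN: "N \<in> carrier_mat n n" using that by (simp add: S_def GL_mat_def)
      show ?thesis using assoc_mult_mat[OF Q(1) cP0(1) cN] Q(3) cN by simp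
    qed
    show "P0 * (Q * P) = P" if "P \<in> {P \<in> GL_mat n. P * left_id n d = A}" for P
    proof -
      have cP: "P \<in> carrier_mat n n" using that by (simp add: GL_mat_def)
      show ?thesis using assoc_mult_mat[OF cP0(1) Q(1) cP] Q(2) cP by simp
    qed
  qed
  then have "card {P \<in> GL_mat n. P * left_id n d = A} = card S" by (rule bij_betw_same_card[symmetric])
  moreover have "complex_of_nat (card S) = of_nat (card (UNIV :: 'a set) ^ (d * (n - d)) * card (GL_mat (n - d) :: 'a mat set))"
    using sum_intertwining[of "1\<^sub>m d :: 'a mat" d n "\<lambda>_. 1"] d by (simp add: S_def)
  then have "card S = card (UNIV :: 'a set) ^ (d * (n - d)) * card (GL_mat (n - d) :: 'a mat set)"
    by (simp only: of_nat_eq_iff)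
  ultimately show ?thesis by simp
qed

text \<open>The first d columns of an invertible matrix form an injective matrix, and all fibres of
  this map have the size found in \<open>card_completions\<close>. This is what removes the group
  orders from \<open>GL_mean_recursion\<close>.\<close>

lemma card_GL_mat_factor:
  assumes d: "d \<le> n"
  shows "card (GL_mat n :: 'a::{field,finite} mat set)
    = card (inj_mats n d :: 'a mat set) * (card (UNIV :: 'a set) ^ (d * (n - d)) * card (GL_mat (n - d) :: 'a mat set))"
proof -
  have im: "P * left_id n d \<in> inj_mats n d" if P: "P \<in> GL_mat n" for P :: "'a mat"
  proof -
    have cP: "P \<in> carrier_mat n n" using P by (simp add: GL_mat_def)
    have J: "left_id n d \<in> carrier_mat n d" by simp
    obtain Q where Q: "Q \<in> carrier_mat n n" "Q * P = 1\<^sub>m n" using GL_mat_inverse[OF P] by blast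
    have "c = 0\<^sub>v d" if c: "c \<in> carrier_vec d" and z: "P * left_id n d *\<^sub>v c = 0\<^sub>v n" for c
    proof -
      have Jc: "left_id n d *\<^sub>v c \<in> carrier_vec n" by (rule mult_mat_vec_carrier[OF J c])
      have "P *\<^sub>v (left_id n d *\<^sub>v c) = 0\<^sub>v n" using z assoc_mult_mat_vec[OF cP J c] by simp
      moreover have "Q *\<^sub>v 0\<^sub>v n = 0\<^sub>v n" using Q(1) by (intro eq_vecI) auto
      ultimately have "Q *\<^sub>v (P *\<^sub>v (left_id n d *\<^sub>v c)) = 0\<^sub>v n" by (simp only:)
      then have z0: "left_id n d *\<^sub>v c = 0\<^sub>v n"
        using assoc_mult_mat_vec[OF Q(1) cP Jc] Q(2) Jc by simp
      have "c $ i = 0" if i: "i < d" for i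
      proof -
        have "0 = (left_id n d *\<^sub>v c) $ i" using z0 i d by simp
        also have "\<dots> = (\<Sum>j<d. left_id n d $$ (i, j) * c $ j)" using i d c by (intro mult_mat_vec_index[OF J]) auto
        also have "\<dots> = (\<Sum>j<d. (if i = j then 1 else 0) * c $ j)" using i d by (intro sum.cong) (auto simp: left_id_def)
        also have "\<dots> = c $ i" using i by (simp add: if_distrib[of "\<lambda>x. x * _"] sum.delta' cong: if_cong)
        finally show ?thesis ..
      qed
      then show ?thesis using c by (intro eq_vecI) auto
    qed
    then show ?thesis using cP J by (simp add: inj_mats_def)
  qed
  have "card (GL_mat n :: 'a mat set) = (\<Sum>A\<in>inj_mats n d. \<Sum>P | P \<in> GL_mat n \<and> P * left_id n d = (A :: 'a mat). 1)"
    by (subst sum.group[OF finite_GL_mat finite_inj_mats]) (use im in auto)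
  also have "\<dots> = (\<Sum>A\<in>(inj_mats n d :: 'a mat set). card {P \<in> GL_mat n. P * left_id n d = A})" by simp
  also have "\<dots> = (\<Sum>A\<in>(inj_mats n d :: 'a mat set). card (UNIV :: 'a set) ^ (d * (n - d)) * card (GL_mat (n - d) :: 'a mat set))"
    by (intro sum.cong refl card_completions)
  finally show ?thesis by simp
qed

lemma conj_cancel:
  fixes N P Q :: "'a::field mat"
  assumes Q: "Q \<in> carrier_mat n n" and P: "P \<in> carrier_mat n n" and N: "N \<in> carrier_mat n n" and QP: "Q * P = 1\<^sub>m n"
  shows "Q * (P * N * Q) * P = N"
proof -
  have NQ: "N * Q \<in> carrier_mat n n" using N Q by simp
  have "Q * (P * N * Q) = Q * (P * (N * Q))" by (simp only: assoc_mult_mat[OF P N Q])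
  also have "\<dots> = Q * P * (N * Q)" by (rule assoc_mult_mat[OF Q P NQ, symmetric])
  also have "\<dots> = N * Q" by (simp only: QP left_mult_one_mat[OF NQ])
  finally have "Q * (P * N * Q) * P = N * Q * P" by (simp only:)
  also have "\<dots> = N * (Q * P)" by (rule assoc_mult_mat[OF N Q P])
  also have "\<dots> = N" by (simp only: QP right_mult_one_mat[OF N])
  finally show ?thesis .
qed

text \<open>Conjugation by a completion of \<open>A\<close> moves the span of its columns to that of
  the first d basis vectors and preserves determinant and characteristic polynomial. The value no
  longer depends on \<open>A\<close>.\<close>

lemma sum_conjugate_intertwining:
  fixes C A :: "'a::{field,finite} mat" and \<phi> :: "'a poly \<Rightarrow> complex"
  assumes C: "C \<in> carrier_mat d d" and A: "A \<in> inj_mats n d"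
  shows "(\<Sum>M | M \<in> GL_mat n \<and> M * A = A * C. \<phi> (char_poly M))
    = (if det C = 0 then 0 else of_nat (card (UNIV :: 'a set) ^ (d * (n - d))) * (\<Sum>D\<in>GL_mat (n - d). \<phi> (char_poly C * char_poly D)))"
proof -
  have d: "d \<le> n" using inj_mats_le[OF A] .
  obtain P where P: "P \<in> GL_mat n" "P * left_id n d = A" using inj_mats_extend[OF A] by blast
  have cP: "P \<in> carrier_mat n n" "det P \<noteq> 0" using P by (auto simp: GL_mat_def)
  obtain Q where Q: "Q \<in> carrier_mat n n" "P * Q = 1\<^sub>m n" "Q * P = 1\<^sub>m n" using GL_mat_inverse[OF P(1)] by blast
  have QG: "Q \<in> GL_mat n" using det_mult[OF Q(1) cP(1)] Q by (auto simp: GL_mat_def)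
  have J: "left_id n d \<in> carrier_mat n d" by simp
  have "Q * A = Q * P * left_id n d" unfolding P(2)[symmetric] by (rule assoc_mult_mat[OF Q(1) cP(1) J, symmetric])
  then have QA: "Q * A = left_id n d" by (simp only: Q(3) left_mult_one_mat[OF J])
  have canc: "Q * (P * N * Q) * P = N" "P * (Q * N * P) * Q = N" if N: "N \<in> carrier_mat n n" for N
    using conj_cancel[OF Q(1) cP(1) N Q(3)] conj_cancel[OF cP(1) Q(1) N Q(2)] by (simp_all only:)
  have sim: "char_poly (P * N * Q) = char_poly N" if N: "N \<in> carrier_mat n n" for N
    by (rule char_poly_similar, rule similar_matI[of _ _ P Q n]) (use N Q cP in auto)
  have iff: "N * left_id n d = left_id n d * C \<longleftrightarrow> (P * N * Q) * A = A * C" if N: "N \<in> carrier_mat n n" for N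
  proof -
    have NJ: "N * left_id n d \<in> carrier_mat n d" "left_id n d * C \<in> carrier_mat n d" using N C J by (auto simp: left_id_def)
    have cA: "A \<in> carrier_mat n d" using A by (simp add: inj_mats_def)
    have "(P * N * Q) * A = (P * N) * (Q * A)" using assoc_mult_mat[OF mult_carrier_mat[OF cP(1) N] Q(1) cA] .
    also have "\<dots> = P * (N * left_id n d)" unfolding QA by (rule assoc_mult_mat[OF cP(1) N J])
    finally have 1: "(P * N * Q) * A = P * (N * left_id n d)" .
    have 2: "A * C = P * (left_id n d * C)" using assoc_mult_mat[OF cP(1) J C] P(2) by simp
    show ?thesis unfolding 1 2 using GL_mat_inj[OF P(1) NJ] by auto
  qed
  have detc: "det (P * N * Q) \<noteq> 0 \<longleftrightarrow> det N \<noteq> 0" if "N \<in> carrier_mat n n" for N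
    using that cP Q(1) QG by (simp add: det_mult[of _ n] GL_mat_def)
  have "bij_betw (\<lambda>N. P * N * Q) {N \<in> GL_mat n. N * left_id n d = left_id n d * C} {M \<in> GL_mat n. M * A = A * C}"
  proof (rule bij_betwI[where g = "\<lambda>M. Q * M * P"])
    show "(\<lambda>N. P * N * Q) \<in> {N \<in> GL_mat n. N * left_id n d = left_id n d * C} \<rightarrow> {M \<in> GL_mat n. M * A = A * C}"
    proof
      fix N assume "N \<in> {N \<in> GL_mat n. N * left_id n d = left_id n d * C}"
      then have N: "N \<in> carrier_mat n n" "det N \<noteq> 0" "N * left_id n d = left_id n d * C" by (auto simp: GL_mat_def)
      have "P * N * Q \<in> carrier_mat n n" using Q(1) cP(1) N(1) by simp
      moreover have "det (P * N * Q) \<noteq> 0" using detc[OF N(1)] N(2) by blast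
      moreover have "P * N * Q * A = A * C" using iff[OF N(1)] N(3) by blast
      ultimately show "P * N * Q \<in> {M \<in> GL_mat n. M * A = A * C}" unfolding GL_mat_def by blast
    qed
    show "(\<lambda>M. Q * M * P) \<in> {M \<in> GL_mat n. M * A = A * C} \<rightarrow> {N \<in> GL_mat n. N * left_id n d = left_id n d * C}"
    proof
      fix M assume M: "M \<in> {M \<in> GL_mat n. M * A = A * C}"
      then have cM: "M \<in> carrier_mat n n" "det M \<noteq> 0" "M * A = A * C" by (auto simp: GL_mat_def)
      have N: "Q * M * P \<in> carrier_mat n n" using Q(1) cP(1) cM(1) by simp
      have "det (Q * M * P) \<noteq> 0" using detc[OF N] cM(2) unfolding canc(2)[OF cM(1)] by blast
      moreover have "Q * M * P * left_id n d = left_id n d * C" using iff[OF N] cM(3) unfolding canc(2)[OF cM(1)] by blast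
      ultimately show "Q * M * P \<in> {N \<in> GL_mat n. N * left_id n d = left_id n d * C}"
        using N unfolding GL_mat_def by blast
    qed
    show "Q * (P * N * Q) * P = N" if "N \<in> {N \<in> GL_mat n. N * left_id n d = left_id n d * C}" for N
      using that by (intro canc(1)) (simp add: GL_mat_def)
    show "P * (Q * M * P) * Q = M" if "M \<in> {M \<in> GL_mat n. M * A = A * C}" for M
      using that by (intro canc(2)) (simp add: GL_mat_def)
  qed
  from sum.reindex_bij_betw[OF this, of "\<lambda>M. \<phi> (char_poly M)"]
  have "(\<Sum>M | M \<in> GL_mat n \<and> M * A = A * C. \<phi> (char_poly M))
     = (\<Sum>N | N \<in> GL_mat n \<and> N * left_id n d = left_id n d * C. \<phi> (char_poly (P * N * Q)))" by simp
  also have "\<dots> = (\<Sum>N | N \<in> GL_mat n \<and> N * left_id n d = left_id n d * C. \<phi> (char_poly N))"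
    by (intro sum.cong refl arg_cong[of _ _ \<phi>] sim) (simp add: GL_mat_def)
  finally show ?thesis unfolding sum_intertwining[OF C d] .
qed

section \<open>Krylov bases and minimal annihilating polynomials of vectors\<close>

primrec krylov :: "'a::field mat \<Rightarrow> 'a vec \<Rightarrow> nat \<Rightarrow> 'a vec" where
  "krylov M v 0 = v"
| "krylov M v (Suc j) = M *\<^sub>v krylov M v j"

definition krylov_mat :: "nat \<Rightarrow> 'a::field mat \<Rightarrow> 'a vec \<Rightarrow> nat \<Rightarrow> 'a mat" where
  "krylov_mat n M v d = mat n d (\<lambda>(i, j). krylov M v j $ i)"

text \<open>This is g(M) v = 0 with the leading coefficient of g read as 1. In degree 0 it says v =
  0.\<close>

definition annihilates :: "nat \<Rightarrow> 'a::field mat \<Rightarrow> 'a vec \<Rightarrow> 'a poly \<Rightarrow> bool" where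
  "annihilates n M v g \<longleftrightarrow> (\<forall>i<n. krylov M v (degree g) $ i + (\<Sum>j<degree g. coeff g j * krylov M v j $ i) = 0)"

text \<open>Recovers the vector from its Krylov basis. That basis is empty exactly for the zero
  vector, hence the default value.\<close>

definition start :: "nat \<Rightarrow> 'a::field mat \<Rightarrow> 'a vec" where
  "start n A = (if dim_col A = 0 then 0\<^sub>v n else col A 0)"

lemma krylov_carrier: "M \<in> carrier_mat n n \<Longrightarrow> v \<in> carrier_vec n \<Longrightarrow> krylov M v j \<in> carrier_vec n"
  by (induction j) auto

lemma krylov_mat_carrier [simp]: "krylov_mat n M v d \<in> carrier_mat n d"
  by (simp add: krylov_mat_def)

lemma mult_companion_index:
  assumes A: "A \<in> carrier_mat n (degree g)" and "i < n" "j < degree g"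
  shows "(A * companion g) $$ (i, j)
    = (if Suc j = degree g then - (\<Sum>k<degree g. coeff g k * A $$ (i, k)) else A $$ (i, Suc j))"
proof (cases "Suc j = degree g")
  case True
  have "(A * companion g) $$ (i, j) = (\<Sum>k<degree g. A $$ (i, k) * (- coeff g k))"
    unfolding mult_mat_index[OF A companion_carrier assms(2,3)]
    using assms True by (intro sum.cong) (auto simp: companion_def)
  then show ?thesis using True by (simp add: sum_negf mult.commute)
next
  case False
  have "(A * companion g) $$ (i, j) = (\<Sum>k<degree g. A $$ (i, k) * (if k = Suc j then 1 else 0))"
    unfolding mult_mat_index[OF A companion_carrier assms(2,3)]
    using assms False by (intro sum.cong) (auto simp: companion_def)
  also have "\<dots> = A $$ (i, Suc j)"
    using False assms(3) by (simp add: if_distrib[of "\<lambda>x. _ * x"] sum.delta cong: if_cong)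
  finally show ?thesis using False by simp
qed

lemma mult_krylov_index:
  assumes M: "M \<in> carrier_mat n n" and v: "v \<in> carrier_vec n" and A: "A \<in> carrier_mat n d"
    and "i < n" "j < d" and col: "\<And>k. k < n \<Longrightarrow> A $$ (k, j) = krylov M v j $ k"
  shows "(M * A) $$ (i, j) = krylov M v (Suc j) $ i"
proof -
  have "(M * A) $$ (i, j) = (\<Sum>k<n. M $$ (i, k) * krylov M v j $ k)"
    unfolding mult_mat_index[OF M A assms(4,5)] using col by (intro sum.cong) auto
  also have "\<dots> = (M *\<^sub>v krylov M v j) $ i"
    by (rule mult_mat_vec_index[OF M krylov_carrier[OF M v] assms(4), symmetric])
  finally show ?thesis by simp
qed

text \<open>By the shape of the companion matrix, all columns of the equation but the last express
  the Krylov recurrence, and the last says that g annihilates v. In degree 0 the equation is empty,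
  and the condition on \<open>start\<close> forces v = 0 instead.\<close>

lemma intertwine_companion_iff:
  assumes M: "M \<in> carrier_mat n n" and v: "v \<in> carrier_vec n" and A: "A \<in> carrier_mat n (degree g)"
  shows "M * A = A * companion g \<and> start n A = v \<longleftrightarrow> A = krylov_mat n M v (degree g) \<and> annihilates n M v g"
proof
  define d where "d = degree g"
  assume L: "M * A = A * companion g \<and> start n A = v"
  have col: "A $$ (i, j) = krylov M v j $ i" if "j < d" "i < n" for i j
    using that
  proof (induction j arbitrary: i)
    case 0
    then show ?case using L A by (auto simp: start_def d_def)
  next
    case (Suc j)
    have "krylov M v (Suc j) $ i = (M * A) $$ (i, j)"
      using Suc by (intro mult_krylov_index[OF M v A, symmetric]) (auto simp: d_def)
    also have "\<dots> = A $$ (i, Suc j)"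
      using L mult_companion_index[OF A, of i j] Suc.prems by (simp add: d_def)
    finally show ?case ..
  qed
  have eqA: "A = krylov_mat n M v (degree g)"
    using A col by (intro eq_matI) (auto simp: krylov_mat_def d_def)
  have "krylov M v d $ i + (\<Sum>j<d. coeff g j * krylov M v j $ i) = 0" if i: "i < n" for i
  proof (cases d)
    case 0
    then have "v = 0\<^sub>v n" using L A by (auto simp: start_def d_def)
    then show ?thesis using 0 i by simp
  next
    case (Suc e)
    have "krylov M v d $ i = (M * A) $$ (i, e)" unfolding Suc
      using i Suc col by (intro mult_krylov_index[OF M v A, symmetric]) (auto simp: d_def)
    also have "\<dots> = - (\<Sum>j<d. coeff g j * A $$ (i, j))"
      using L mult_companion_index[OF A i, of e] Suc by (simp add: d_def)
    also have "(\<Sum>j<d. coeff g j * A $$ (i, j)) = (\<Sum>j<d. coeff g j * krylov M v j $ i)"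
      using i col by (intro sum.cong) auto
    finally show ?thesis by simp
  qed
  then show "A = krylov_mat n M v (degree g) \<and> annihilates n M v g"
    using eqA by (simp add: annihilates_def d_def)
next
  define d where "d = degree g"
  assume R: "A = krylov_mat n M v (degree g) \<and> annihilates n M v g"
  have col: "A $$ (i, j) = krylov M v j $ i" if "j < d" "i < n" for i j
    using R that by (simp add: krylov_mat_def d_def)
  have ann: "krylov M v d $ i + (\<Sum>j<d. coeff g j * krylov M v j $ i) = 0" if "i < n" for i
    using R that by (simp add: annihilates_def d_def)
  have "M * A = A * companion g"
  proof (rule eq_matI)
    fix i j assume "i < dim_row (A * companion g)" "j < dim_col (A * companion g)"
    then have ij: "i < n" "j < d" using A by (auto simp: d_def companion_def)
    have MA: "(M * A) $$ (i, j) = krylov M v (Suc j) $ i"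
      using ij col by (intro mult_krylov_index[OF M v A]) (auto simp: d_def)
    show "(M * A) $$ (i, j) = (A * companion g) $$ (i, j)"
    proof (cases "Suc j = d")
      case True
      have "(A * companion g) $$ (i, j) = - (\<Sum>k<d. coeff g k * krylov M v k $ i)"
        using mult_companion_index[OF A ij(1), of j] True ij col by (simp add: d_def)
      also have "\<dots> = krylov M v (Suc j) $ i" using ann[OF ij(1)] True by (simp add: eq_neg_iff_add_eq_0 neg_eq_iff_add_eq_0 add.commute)
      finally show ?thesis using MA by simp
    next
      case False
      then have "Suc j < d" using ij by simp
      then show ?thesis using mult_companion_index[OF A ij(1), of j] ij MA col[of "Suc j" i] by (simp add: d_def)
    qed
  qed (use M A in \<open>auto simp: companion_def\<close>)
  moreover have "start n A = v"
  proof (cases "d = 0")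
    case True
    then have "v $ i = 0" if "i < n" for i using ann[OF that] by simp
    then have "v = 0\<^sub>v n" using v by (intro eq_vecI) auto
    then show ?thesis using True A by (simp add: start_def d_def)
  next
    case False
    then show ?thesis using A v col[of 0] by (intro eq_vecI) (auto simp: start_def d_def)
  qed
  ultimately show "M * A = A * companion g \<and> start n A = v" ..
qed

lemma krylov_mat_inj_iff:
  "krylov_mat n M v d \<in> inj_mats n d \<longleftrightarrow>
    (\<forall>c. (\<forall>i<n. (\<Sum>j<d. krylov M v j $ i * c j) = 0) \<longrightarrow> (\<forall>j<d. c j = 0))"
proof
  assume K: "krylov_mat n M v d \<in> inj_mats n d"
  show "\<forall>c. (\<forall>i<n. (\<Sum>j<d. krylov M v j $ i * c j) = 0) \<longrightarrow> (\<forall>j<d. c j = 0)"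
  proof (intro allI impI)
    fix c j assume c: "\<forall>i<n. (\<Sum>j<d. krylov M v j $ i * c j) = 0" and j: "j < d"
    have "vec d c = 0\<^sub>v d" by (rule inj_matsD[OF K]) (use c in \<open>auto simp: krylov_mat_def\<close>)
    then show "c j = 0" using j by (metis index_vec index_zero_vec(1))
  qed
next
  assume R: "\<forall>c. (\<forall>i<n. (\<Sum>j<d. krylov M v j $ i * c j) = 0) \<longrightarrow> (\<forall>j<d. c j = 0)"
  show "krylov_mat n M v d \<in> inj_mats n d"
  proof (rule inj_matsI[OF krylov_mat_carrier])
    fix c :: "'a vec" assume c: "c \<in> carrier_vec d" and z: "\<And>i. i < n \<Longrightarrow> (\<Sum>j<d. krylov_mat n M v d $$ (i, j) * c $ j) = 0"
    have "\<forall>i<n. (\<Sum>j<d. krylov M v j $ i * c $ j) = 0" using z by (simp add: krylov_mat_def)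
    then have "\<forall>j<d. c $ j = 0" using R[rule_format, of "\<lambda>j. c $ j"] by blast
    then show "c = 0\<^sub>v d" using c by (intro eq_vecI) auto
  qed
qed

lemma krylov_mat_inj_mono:
  assumes "krylov_mat n M v d \<in> inj_mats n d" "d' \<le> d"
  shows "krylov_mat n M v d' \<in> inj_mats n d'"
  unfolding krylov_mat_inj_iff
proof (intro allI impI)
  fix c :: "nat \<Rightarrow> 'a" and j assume c: "\<forall>i<n. (\<Sum>j<d'. krylov M v j $ i * c j) = 0" and j: "j < d'"
  define b where "b j = (if j < d' then c j else 0)" for j
  have "(\<Sum>j<d. krylov M v j $ i * b j) = (\<Sum>j<d'. krylov M v j $ i * c j)" for i
    using assms(2) by (intro sum.mono_neutral_cong_right) (auto simp: b_def)
  then have "\<forall>j<d. b j = 0" using assms(1)[unfolded krylov_mat_inj_iff] c by simp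
  then have "b j = 0" using j assms(2) by simp
  then show "c j = 0" using j by (simp add: b_def)
qed

text \<open>Take the largest d for which the first d Krylov vectors are independent. A dependency
  among d + 1 of them must involve the last one, so it can be normalised to a monic
  polynomial.\<close>

lemma exists_annihilator:
  fixes M :: "'a::{field,finite} mat"
  assumes M: "M \<in> carrier_mat n n" and v: "v \<in> carrier_vec n"
  shows "\<exists>g. monic g \<and> krylov_mat n M v (degree g) \<in> inj_mats n (degree g) \<and> annihilates n M v g"
proof -
  define D where "D = {d. krylov_mat n M v d \<in> inj_mats n d}"
  have fin: "finite D" using inj_mats_le by (intro finite_subset[of D "{..n}"]) (auto simp: D_def)
  have "0 \<in> D" by (simp add: D_def krylov_mat_inj_iff)
  define d where "d = Max D"
  have d: "d \<in> D" "Suc d \<notin> D"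
    using Max_in[OF fin] \<open>0 \<in> D\<close> Max_ge[OF fin, of "Suc d"] by (auto simp: d_def)
  have "krylov_mat n M v (Suc d) \<notin> inj_mats n (Suc d)" using d(2) by (simp add: D_def)
  then obtain c j0 where c: "\<forall>i<n. (\<Sum>j<Suc d. krylov M v j $ i * c j) = 0" and j0: "j0 < Suc d" "c j0 \<noteq> 0"
    unfolding krylov_mat_inj_iff by blast
  have cd: "c d \<noteq> 0"
  proof
    assume "c d = 0"
    then have "\<forall>i<n. (\<Sum>j<d. krylov M v j $ i * c j) = 0" using c by simp
    then have "\<forall>j<d. c j = 0" using d(1) unfolding D_def mem_Collect_eq krylov_mat_inj_iff by blast
    then show False using j0 \<open>c d = 0\<close> by (auto simp: less_Suc_eq)
  qed
  define g where "g = (\<Sum>j\<le>d. monom (c j / c d) j)"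
  have co: "coeff g i = (if i \<le> d then c i / c d else 0)" for i
    by (simp add: g_def coeff_sum)
  have deg: "degree g = d"
    by (rule antisym[OF degree_le le_degree]) (use cd in \<open>auto simp: co\<close>)
  have "monic g" using cd by (simp add: deg co)
  moreover have "annihilates n M v g"
    unfolding annihilates_def deg
  proof (intro allI impI)
    fix i assume i: "i < n"
    have "0 = (\<Sum>j<Suc d. krylov M v j $ i * c j) / c d" using c i by simp
    also have "\<dots> = (\<Sum>j<d. coeff g j * krylov M v j $ i) + krylov M v d $ i"
      using cd by (simp add: add_divide_distrib sum_divide_distrib co mult.commute)
    finally show "krylov M v d $ i + (\<Sum>j<d. coeff g j * krylov M v j $ i) = 0" by (simp add: add.commute)
  qed
  ultimately show ?thesis using d(1) deg by (auto simp: D_def)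
qed

lemma annihilator_not_inj:
  assumes "annihilates n M v g" "degree g < d"
  shows "krylov_mat n M v d \<notin> inj_mats n d"
proof
  assume "krylov_mat n M v d \<in> inj_mats n d"
  then have K: "krylov_mat n M v (Suc (degree g)) \<in> inj_mats n (Suc (degree g))"
    by (rule krylov_mat_inj_mono) (use assms(2) in simp)
  define c where "c j = (if j = degree g then 1 else coeff g j)" for j
  have "(\<Sum>j<Suc (degree g). krylov M v j $ i * c j) = 0" if "i < n" for i
  proof -
    have "(\<Sum>j<Suc (degree g). krylov M v j $ i * c j) = (\<Sum>j<degree g. coeff g j * krylov M v j $ i) + krylov M v (degree g) $ i"
      by (simp add: c_def mult.commute)
    then show ?thesis using assms(1) that by (simp add: annihilates_def add.commute)
  qed
  then have "c (degree g) = 0" using K unfolding krylov_mat_inj_iff by blast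
  then show False by (simp add: c_def)
qed

text \<open>The degree is the largest number of independent Krylov vectors; the lower coefficients
  are coordinates with respect to independent vectors.\<close>

lemma annihilator_unique:
  assumes "monic g" "krylov_mat n M v (degree g) \<in> inj_mats n (degree g)" "annihilates n M v g"
    and "monic g'" "krylov_mat n M v (degree g') \<in> inj_mats n (degree g')" "annihilates n M v g'"
  shows "g = g'"
proof -
  have deg: "degree g = degree g'"
    using annihilator_not_inj[OF assms(3), of "degree g'"] annihilator_not_inj[OF assms(6), of "degree g"] assms(2,5)
    by (meson linorder_neqE_nat)
  have "(\<Sum>j<degree g. krylov M v j $ i * (coeff g j - coeff g' j)) = 0" if "i < n" for i
  proof -
    have "(\<Sum>j<degree g. krylov M v j $ i * (coeff g j - coeff g' j))
      = (\<Sum>j<degree g. coeff g j * krylov M v j $ i) - (\<Sum>j<degree g. coeff g' j * krylov M v j $ i)"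
      by (simp add: algebra_simps sum_subtractf)
    moreover have "krylov M v (degree g) $ i + (\<Sum>j<degree g. coeff g j * krylov M v j $ i)
      = krylov M v (degree g) $ i + (\<Sum>j<degree g. coeff g' j * krylov M v j $ i)"
      using assms(3,6) that by (simp add: annihilates_def deg)
    then have "(\<Sum>j<degree g. coeff g j * krylov M v j $ i) = (\<Sum>j<degree g. coeff g' j * krylov M v j $ i)"
      by (rule add_left_imp_eq)
    ultimately show ?thesis by simp
  qed
  then have eq: "\<forall>j<degree g. coeff g j - coeff g' j = 0"
    using assms(2)[unfolded krylov_mat_inj_iff, THEN spec, of "\<lambda>j. coeff g j - coeff g' j"] by blast
  show ?thesis
  proof (rule poly_eqI)
    fix i show "coeff g i = coeff g' i"
      using eq assms(1,4) deg coeff_eq_0[of g i] coeff_eq_0[of g' i] by (cases i "degree g" rule: linorder_cases) auto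
  qed
qed

definition monic_le :: "nat \<Rightarrow> 'a::field poly set" where
  "monic_le n = {g. monic g \<and> degree g \<le> n}"

lemma finite_monic_le: "finite (monic_le n :: 'a::{field,finite} poly set)"
proof -
  have "monic_le n \<subseteq> Poly ` {xs :: 'a list. set xs \<subseteq> UNIV \<and> length xs \<le> Suc n}"
  proof
    fix g :: "'a poly" assume g: "g \<in> monic_le n"
    then have "g \<noteq> 0" by (auto simp: monic_le_def)
    then have "length (coeffs g) \<le> Suc n" using g by (simp add: length_coeffs_degree monic_le_def)
    moreover have "g = Poly (coeffs g)" by simp
    ultimately show "g \<in> Poly ` {xs. set xs \<subseteq> UNIV \<and> length xs \<le> Suc n}" by blast
  qed
  then show ?thesis by (rule finite_subset) (intro finite_imageI finite_lists_length_le finite)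
qed

lemma coeff_char_poly_eq_0_iff:
  assumes A: "(A :: 'a::field mat) \<in> carrier_mat n n"
  shows "coeff (char_poly A) 0 = 0 \<longleftrightarrow> det A = 0"
proof -
  have "char_matrix A 0 = A" using A by (intro eq_matI) (auto simp: char_matrix_def)
  then have "poly (char_poly A) 0 = det (- A)" using char_poly_matrix[OF A, of 0] by simp
  then show ?thesis using det_0_negate[OF A] by (simp add: poly_0_coeff_0)
qed

lemma det_companion_eq_0_iff:
  assumes "monic (g :: 'a::field poly)"
  shows "det (companion g) = 0 \<longleftrightarrow> coeff g 0 = 0"
  using coeff_char_poly_eq_0_iff[OF companion_carrier, of g] char_poly_companion[OF assms] by simp

text \<open>A pair of a matrix and a vector is determined by the minimal annihilating polynomial of the
  vector together with the Krylov basis of the cyclic subspace that it generates.\<close>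
lemma sum_GL_mat_vec:
  fixes \<phi> :: "'a::{field,finite} poly \<Rightarrow> complex"
  shows "of_nat (card (UNIV :: 'a set) ^ n) * (\<Sum>M\<in>GL_mat n. \<phi> (char_poly M))
    = (\<Sum>g\<in>monic_le n. \<Sum>A\<in>inj_mats n (degree g). \<Sum>M | M \<in> GL_mat n \<and> M * A = A * companion g. \<phi> (char_poly M))"
proof -
  define T where "T g A = {M :: 'a mat. M \<in> GL_mat n \<and> M * A = A * companion g}" for g A
  define S where "S = Sigma (monic_le n) (\<lambda>g. Sigma (inj_mats n (degree g)) (T g))"
  define V where "V = (GL_mat n :: 'a mat set) \<times> (carrier_vec n :: 'a vec set)"
  have finT: "finite (T g A)" for g A using finite_GL_mat by (rule finite_subset[rotated]) (auto simp: T_def)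
  define F where "F = (\<lambda>(g :: 'a poly, A :: 'a mat, M :: 'a mat). (M, start n A))"
  have bij: "bij_betw F S V"
  proof (rule bij_betwI')
    fix s t assume "s \<in> S" "t \<in> S"
    then obtain g A M g' A' M' where st: "s = (g, A, M)" "t = (g', A', M')"
      "monic g" "monic g'" "A \<in> inj_mats n (degree g)" "A' \<in> inj_mats n (degree g')"
      "M \<in> GL_mat n" "M' \<in> GL_mat n" "M * A = A * companion g" "M' * A' = A' * companion g'"
      by (auto simp: S_def T_def monic_le_def)
    show "F s = F t \<longleftrightarrow> s = t"
    proof
      assume eq: "F s = F t"
      define v where "v = start n A"
      have MM: "M' = M" "start n A' = v" using eq by (auto simp: F_def st v_def)
      have cA: "A \<in> carrier_mat n (degree g)" "A' \<in> carrier_mat n (degree g')" using st by (auto simp: inj_mats_def)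
      have v: "v \<in> carrier_vec n" using cA by (auto simp: v_def start_def)
      have M: "M \<in> carrier_mat n n" using st by (simp add: GL_mat_def)
      have 1: "A = krylov_mat n M v (degree g) \<and> annihilates n M v g"
        using intertwine_companion_iff[OF M v cA(1)] st v_def by blast
      have 2: "A' = krylov_mat n M v (degree g') \<and> annihilates n M v g'"
        using intertwine_companion_iff[OF M v cA(2)] st MM by blast
      have "g = g'" by (rule annihilator_unique[of g n M v g']) (use 1 2 st in auto)
      then show "s = t" using 1 2 MM st by simp
    qed simp
  next
    fix s assume "s \<in> S"
    then show "F s \<in> V" by (auto simp: S_def T_def F_def V_def inj_mats_def start_def)
  next
    fix p assume "p \<in> V"
    then obtain M v where p: "p = (M, v)" "M \<in> GL_mat n" "v \<in> carrier_vec n" by (auto simp: V_def)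
    have M: "M \<in> carrier_mat n n" using p by (simp add: GL_mat_def)
    obtain g where g: "monic g" "krylov_mat n M v (degree g) \<in> inj_mats n (degree g)" "annihilates n M v g"
      using exists_annihilator[OF M p(3)] by blast
    define A where "A = krylov_mat n M v (degree g)"
    have "A \<in> carrier_mat n (degree g)" by (simp add: A_def)
    then have "M * A = A * companion g \<and> start n A = v"
      using intertwine_companion_iff[OF M p(3), of A g] g by (simp add: A_def)
    moreover have "degree g \<le> n" using inj_mats_le[OF g(2)] .
    ultimately have "(g, A, M) \<in> S" "F (g, A, M) = p"
      using g p by (auto simp: S_def T_def F_def monic_le_def A_def)
    then show "\<exists>s\<in>S. p = F s" by metis
  qed
  have "of_nat (card (UNIV :: 'a set) ^ n) * (\<Sum>M\<in>GL_mat n. \<phi> (char_poly M))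
     = (\<Sum>M\<in>GL_mat n. \<Sum>v\<in>(carrier_vec n :: 'a vec set). \<phi> (char_poly M))"
    by (simp add: sum_distrib_left card_carrier_vec)
  also have "\<dots> = (\<Sum>p\<in>V. \<phi> (char_poly (fst p)))"
    unfolding V_def by (subst sum.cartesian_product) (simp add: case_prod_unfold)
  also have "\<dots> = (\<Sum>s\<in>S. \<phi> (char_poly (fst (F s))))"
    by (rule sum.reindex_bij_betw[OF bij, symmetric])
  also have "\<dots> = (\<Sum>(g, A, M)\<in>S. \<phi> (char_poly M))"
    by (rule sum.cong) (auto simp: F_def)
  also have "\<dots> = (\<Sum>g\<in>monic_le n. \<Sum>A\<in>inj_mats n (degree g). \<Sum>M\<in>T g A. \<phi> (char_poly M))"
    unfolding S_def using finite_monic_le finite_inj_mats finT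
    by (subst sum.Sigma[symmetric], blast, blast, subst sum.Sigma[symmetric]) auto
  finally show ?thesis by (simp add: T_def)
qed

section \<open>The recursion for means over the general linear group\<close>

definition GL_mean :: "('a::{field,finite} poly \<Rightarrow> complex) \<Rightarrow> nat \<Rightarrow> complex" where
  "GL_mean \<phi> n = (\<Sum>M\<in>GL_mat n. \<phi> (char_poly M)) / of_nat (card (GL_mat n :: 'a mat set))"

lemma card_GL_mat_pos: "card (GL_mat n :: 'a::{field,finite} mat set) > 0"
proof -
  have "1\<^sub>m n \<in> (GL_mat n :: 'a mat set)" by (simp add: GL_mat_def)
  then show ?thesis using finite_GL_mat card_gt_0_iff by blast
qed

lemma monic_char_poly: "M \<in> carrier_mat n n \<Longrightarrow> monic (char_poly M) \<and> degree (char_poly M) = n"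
  using degree_monic_char_poly[of M n] by auto

lemma coeff_char_poly_0: "M \<in> GL_mat n \<Longrightarrow> coeff (char_poly M) 0 \<noteq> 0"
  using coeff_char_poly_eq_0_iff[of M n] by (simp add: GL_mat_def)

text \<open>For g of degree d every \<open>A\<close> contributes the same amount. The number of
  these \<open>A\<close>, times q^(d(n-d)), times the order of GL(n-d), is the order of GL(n), so
  only means remain. If g vanishes at 0, its companion matrix is singular and the contribution is
  0.\<close>

theorem GL_mean_recursion:
  fixes \<phi> :: "'a::{field,finite} poly \<Rightarrow> complex"
  assumes mult: "\<And>g h. monic g \<Longrightarrow> coeff g 0 \<noteq> 0 \<Longrightarrow> monic h \<Longrightarrow> coeff h 0 \<noteq> 0 \<Longrightarrow> \<phi> (g * h) = \<phi> g * \<phi> h"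
  shows "of_nat (card (UNIV :: 'a set) ^ n) * GL_mean \<phi> n
    = (\<Sum>d\<le>n. (\<Sum>g | monic g \<and> degree g = d \<and> coeff g 0 \<noteq> 0. \<phi> g) * GL_mean \<phi> (n - d))"
proof -
  define G where "G n = (of_nat (card (GL_mat n :: 'a mat set)) :: complex)" for n
  have G: "G n \<noteq> 0" for n using card_GL_mat_pos[where 'a='a, of n] by (simp add: G_def)
  have inner: "(\<Sum>A\<in>inj_mats n (degree g). \<Sum>M | M \<in> GL_mat n \<and> M * A = A * companion g. \<phi> (char_poly M))
      = (if coeff g 0 = 0 then 0 else \<phi> g * (G n * GL_mean \<phi> (n - degree g)))" if g: "g \<in> monic_le n" for g
  proof -
    have mg: "monic g" "degree g \<le> n" using g by (auto simp: monic_le_def)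
    have "(\<Sum>A\<in>inj_mats n (degree g). \<Sum>M | M \<in> GL_mat n \<and> M * A = A * companion g. \<phi> (char_poly M))
      = (\<Sum>A\<in>(inj_mats n (degree g) :: 'a mat set). if coeff g 0 = 0 then 0 else of_nat (card (UNIV :: 'a set) ^ (degree g * (n - degree g))) *
          (\<Sum>D\<in>GL_mat (n - degree g). \<phi> (g * char_poly D)))"
    proof (rule sum.cong[OF refl])
      fix A assume "A \<in> (inj_mats n (degree g) :: 'a mat set)"
      from sum_conjugate_intertwining[OF companion_carrier this, of \<phi>]
      show "(\<Sum>M | M \<in> GL_mat n \<and> M * A = A * companion g. \<phi> (char_poly M))
        = (if coeff g 0 = 0 then 0 else of_nat (card (UNIV :: 'a set) ^ (degree g * (n - degree g))) *
          (\<Sum>D\<in>GL_mat (n - degree g). \<phi> (g * char_poly D)))"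
        by (simp only: char_poly_companion[OF mg(1)] det_companion_eq_0_iff[OF mg(1)])
    qed
    also have "\<dots> = (if coeff g 0 = 0 then 0 else \<phi> g * (G n * GL_mean \<phi> (n - degree g)))"
    proof (cases "coeff g 0 = 0")
      case False
      have "(\<Sum>D\<in>GL_mat (n - degree g). \<phi> (g * char_poly D)) = \<phi> g * (\<Sum>D\<in>GL_mat (n - degree g). \<phi> (char_poly D))"
        unfolding sum_distrib_left
      proof (rule sum.cong[OF refl])
        fix D assume D: "D \<in> (GL_mat (n - degree g) :: 'a mat set)"
        then have "D \<in> carrier_mat (n - degree g) (n - degree g)" by (simp add: GL_mat_def)
        then show "\<phi> (g * char_poly D) = \<phi> g * \<phi> (char_poly D)"
          using mult[OF mg(1) False] monic_char_poly coeff_char_poly_0[OF D] by blast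
      qed
      also have "\<dots> = \<phi> g * (G (n - degree g) * GL_mean \<phi> (n - degree g))"
        using G[of "n - degree g"] by (simp add: GL_mean_def G_def)
      finally have s: "(\<Sum>D\<in>GL_mat (n - degree g). \<phi> (g * char_poly D)) = \<phi> g * (G (n - degree g) * GL_mean \<phi> (n - degree g))" .
      have "G n = of_nat (card (inj_mats n (degree g) :: 'a mat set)) * (of_nat (card (UNIV :: 'a set) ^ (degree g * (n - degree g))) * G (n - degree g))"
        unfolding G_def by (subst card_GL_mat_factor[OF mg(2)]) simp
      then show ?thesis using False by (simp add: s mult_ac)
    qed simp
    finally show ?thesis .
  qed
  have "G n * (of_nat (card (UNIV :: 'a set) ^ n) * GL_mean \<phi> n) = of_nat (card (UNIV :: 'a set) ^ n) * (\<Sum>M\<in>GL_mat n. \<phi> (char_poly M))"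
    using G[of n] by (simp add: GL_mean_def G_def)
  also have "\<dots> = (\<Sum>g\<in>monic_le n. if coeff g 0 = 0 then 0 else \<phi> g * (G n * GL_mean \<phi> (n - degree g)))"
    unfolding sum_GL_mat_vec using inner by (rule sum.cong[OF refl])
  also have "\<dots> = (\<Sum>g | g \<in> monic_le n \<and> coeff g 0 \<noteq> 0. \<phi> g * (G n * GL_mean \<phi> (n - degree g)))"
    using finite_monic_le by (intro sum.mono_neutral_cong_right) auto
  also have "\<dots> = (\<Sum>d\<le>n. \<Sum>g | g \<in> {g \<in> monic_le n. coeff g 0 \<noteq> 0} \<and> degree g = d. \<phi> g * (G n * GL_mean \<phi> (n - degree g)))"
  proof (rule sum.group[symmetric])
    show "finite {g \<in> monic_le n. coeff g 0 \<noteq> (0 :: 'a)}" by (rule finite_subset[OF _ finite_monic_le]) auto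
  qed (auto simp: monic_le_def)
  also have "\<dots> = (\<Sum>d\<le>n. G n * ((\<Sum>g | monic g \<and> degree g = d \<and> coeff g 0 \<noteq> 0. \<phi> g) * GL_mean \<phi> (n - d)))"
  proof (rule sum.cong[OF refl])
    fix d assume "d \<in> {..n}"
    then have "{g :: 'a poly. g \<in> {g \<in> monic_le n. coeff g 0 \<noteq> 0} \<and> degree g = d} = {g. monic g \<and> degree g = d \<and> coeff g 0 \<noteq> 0}"
      by (auto simp: monic_le_def)
    then show "(\<Sum>g | g \<in> {g \<in> monic_le n. coeff g 0 \<noteq> 0} \<and> degree g = d. \<phi> g * (G n * GL_mean \<phi> (n - degree g)))
      = G n * ((\<Sum>g | monic g \<and> degree g = d \<and> coeff g 0 \<noteq> 0. \<phi> g) * GL_mean \<phi> (n - d))"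
      by (simp add: sum_distrib_left sum_distrib_right mult_ac)
  qed
  also have "\<dots> = G n * (\<Sum>d\<le>n. (\<Sum>g | monic g \<and> degree g = d \<and> coeff g 0 \<noteq> 0. \<phi> g) * GL_mean \<phi> (n - d))"
    by (simp add: sum_distrib_left)
  finally show ?thesis using G[of n] by simp
qed

no_notation vec_index (infixl "$" 100)
notation fps_nth (infixl "$" 75)

section \<open>Characters of finite abelian groups\<close>

definition character_on :: "('a, 'b) monoid_scheme \<Rightarrow> 'a set \<Rightarrow> ('a \<Rightarrow> complex) \<Rightarrow> bool" where
  "character_on G H \<phi> \<longleftrightarrow> (\<forall>x\<in>H. \<forall>y\<in>H. \<phi> (x \<otimes>\<^bsub>G\<^esub> y) = \<phi> x * \<phi> y) \<and> (\<forall>x\<in>H. \<phi> x \<noteq> 0)"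

text \<open>Characters are set to 0 off the group, so that equality of functions is equality of
  characters and a finite group has a finite dual.\<close>

definition dual :: "('a, 'b) monoid_scheme \<Rightarrow> ('a \<Rightarrow> complex) set" where
  "dual G = {\<phi>. character_on G (carrier G) \<phi> \<and> (\<forall>x. x \<notin> carrier G \<longrightarrow> \<phi> x = 0)}"

locale finite_comm_group = comm_group G for G (structure) +
  assumes fin: "finite (carrier G)"
begin

lemma character_on_one:
  assumes "character_on G H \<phi>" "\<one> \<in> H"
  shows "\<phi> \<one> = 1"
proof -
  have "\<phi> (\<one> \<otimes> \<one>) = \<phi> \<one> * \<phi> \<one>" "\<phi> \<one> \<noteq> 0" using assms unfolding character_on_def by blast+
  then show ?thesis by simp
qed

lemma subgroup_nat_pow: "subgroup H G \<Longrightarrow> x \<in> H \<Longrightarrow> x [^] (n::nat) \<in> H"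
  by (induction n) (auto simp: subgroup.one_closed subgroup.m_closed)

lemma character_on_pow:
  assumes "character_on G H \<phi>" "subgroup H G" "x \<in> H"
  shows "\<phi> (x [^] (n::nat)) = \<phi> x ^ n"
proof (induction n)
  case 0
  then show ?case using character_on_one[OF assms(1) subgroup.one_closed[OF assms(2)]] by simp
next
  case (Suc n)
  have "\<phi> (x [^] n \<otimes> x) = \<phi> (x [^] n) * \<phi> x"
    using assms subgroup_nat_pow[OF assms(2,3)] unfolding character_on_def by blast
  then show ?case using Suc by simp
qed

lemma nat_pow_diff:
  assumes "a \<in> carrier G" "i \<le> j"
  shows "a [^] (j::nat) = a [^] i \<otimes> a [^] (j - i)"
  using nat_pow_mult[OF assms(1), of i "j - i"] assms(2) by simp

lemma adjoin_subgroup: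
  assumes H: "subgroup H G" and a: "a \<in> carrier G"
  shows "subgroup {h \<otimes> a [^] k | h k. h \<in> H \<and> k \<in> (UNIV :: nat set)} G" (is "subgroup ?H G")
proof (rule subgroupI)
  have Hc: "h \<in> carrier G" if "h \<in> H" for h using subgroup.mem_carrier[OF H that] .
  show "?H \<subseteq> carrier G"
    using Hc a by auto
  show "?H \<noteq> {}"
    using subgroup.one_closed[OF H] by auto
  fix x assume "x \<in> ?H"
  then obtain h k where x: "x = h \<otimes> a [^] (k::nat)" "h \<in> H" by auto
  \<comment> \<open>Exponents are natural numbers; the group order turns inverses into
    powers.\<close>
  define n where "n = Coset.order G"
  have n: "n > 0" using fin by (simp add: n_def order_gt_0_iff_finite)
  have "a [^] (k * (n - 1)) \<otimes> a [^] k = a [^] (n * k)"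
    using n by (simp add: nat_pow_mult a algebra_simps)
  also have "\<dots> = \<one>" using pow_order_eq_1[OF a] a by (simp add: n_def flip: nat_pow_pow)
  finally have "inv (a [^] k) = a [^] (k * (n - 1))" using a by (intro inv_equality) auto
  then have "inv x = inv h \<otimes> a [^] (k * (n - 1))" using x Hc a by (simp add: inv_mult)
  then show "inv x \<in> ?H"
    using subgroup.m_inv_closed[OF H x(2)] by blast
  fix y assume "y \<in> ?H"
  then obtain h' k' where y: "y = h' \<otimes> a [^] (k'::nat)" "h' \<in> H" by auto
  have "x \<otimes> y = (h \<otimes> h') \<otimes> a [^] (k + k')"
    using x y Hc a by (simp add: nat_pow_mult[symmetric] m_ac)
  then show "x \<otimes> y \<in> ?H"
    using subgroup.m_closed[OF H x(2) y(2)] by blast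
qed

text \<open>The value at \<open>a\<close> may be any m-th root of \<open>\<phi> (a [^] m)\<close>.
  The exponents j with \<open>a [^] j\<close> in \<open>H\<close> are the multiples of m, where
  \<open>\<phi>\<close> takes the value \<open>\<zeta> ^ j\<close>; hence
  \<open>\<phi> h * \<zeta> ^ k\<close> does not depend on how the element is written.\<close>

lemma character_adjoin:
  assumes H: "subgroup H G" and \<phi>: "character_on G H \<phi>" and a: "a \<in> carrier G"
    and m: "m > 0" "a [^] m \<in> H" "\<And>r. 0 < r \<Longrightarrow> r < m \<Longrightarrow> a [^] (r::nat) \<notin> H"
    and \<zeta>: "\<zeta> ^ m = \<phi> (a [^] m)"
  shows "\<exists>H' \<psi>. subgroup H' G \<and> H \<subseteq> H' \<and> a \<in> H' \<and> character_on G H' \<psi> \<and> (\<forall>x\<in>H. \<psi> x = \<phi> x) \<and> \<psi> a = \<zeta>"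
proof -
  define H' where "H' = {h \<otimes> a [^] k | h k. h \<in> H \<and> k \<in> (UNIV :: nat set)}"
  have sub: "subgroup H' G" unfolding H'_def by (rule adjoin_subgroup[OF H a])
  have Hc: "h \<in> carrier G" if "h \<in> H" for h using subgroup.mem_carrier[OF H that] .
  have one: "\<one> \<in> H" using subgroup.one_closed[OF H] .
  have mult: "\<phi> (x \<otimes> y) = \<phi> x * \<phi> y" "\<phi> x \<noteq> 0" if "x \<in> H" "y \<in> H" for x y
    using \<phi> that unfolding character_on_def by blast+
  have pow: "\<phi> (a [^] j) = \<zeta> ^ j" if j: "a [^] j \<in> H" for j :: nat
  proof -
    have e: "a [^] j = (a [^] m) [^] (j div m) \<otimes> a [^] (j mod m)"
      using a by (simp add: nat_pow_pow nat_pow_mult)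
    have p: "(a [^] m) [^] (j div m) \<in> H" using subgroup_nat_pow[OF H m(2)] .
    have "a [^] (j mod m) = inv ((a [^] m) [^] (j div m)) \<otimes> a [^] j"
      unfolding e using a by (simp add: inv_solve_left)
    also have "\<dots> \<in> H" using subgroup.m_closed[OF H subgroup.m_inv_closed[OF H p] j] .
    finally have "j mod m = 0" using m(1) m(3)[of "j mod m"] by fastforce
    then have "a [^] j = (a [^] m) [^] (j div m)" using e a by simp
    then have "\<phi> (a [^] j) = \<zeta> ^ (m * (j div m))"
      using character_on_pow[OF \<phi> H m(2)] by (simp add: \<zeta> power_mult)
    then show ?thesis using \<open>j mod m = 0\<close> by auto
  qed
  have wd: "\<phi> h * \<zeta> ^ k = \<phi> h' * \<zeta> ^ k'"
    if hk: "h \<in> H" "h' \<in> H" "h \<otimes> a [^] k = h' \<otimes> a [^] k'" "k \<le> k'" for h h' and k k' :: nat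
  proof -
    have "h \<otimes> a [^] k = (h' \<otimes> a [^] (k' - k)) \<otimes> a [^] k"
      using hk(3) nat_pow_diff[OF a hk(4)] Hc[OF hk(1)] Hc[OF hk(2)] a by (simp add: m_ac)
    then have h: "h = h' \<otimes> a [^] (k' - k)" using Hc[OF hk(1)] Hc[OF hk(2)] a by simp
    then have "a [^] (k' - k) = inv h' \<otimes> h" using Hc[OF hk(2)] a by (simp add: inv_solve_left)
    then have aH: "a [^] (k' - k) \<in> H"
      using subgroup.m_closed[OF H subgroup.m_inv_closed[OF H hk(2)] hk(1)] by simp
    have "\<phi> h = \<phi> h' * \<zeta> ^ (k' - k)" unfolding h using mult(1)[OF hk(2) aH] pow[OF aH] by simp
    then show ?thesis using hk(4) by (simp add: mult.assoc flip: power_add)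
  qed
  define \<psi> where "\<psi> x = (let p = SOME p. fst p \<in> H \<and> x = fst p \<otimes> a [^] (snd p :: nat) in \<phi> (fst p) * \<zeta> ^ snd p)" for x
  have \<psi>: "\<psi> (h \<otimes> a [^] k) = \<phi> h * \<zeta> ^ k" if h: "h \<in> H" for h and k :: nat
  proof -
    define p where "p = (SOME p. fst p \<in> H \<and> h \<otimes> a [^] k = fst p \<otimes> a [^] (snd p :: nat))"
    have p: "fst p \<in> H" "h \<otimes> a [^] k = fst p \<otimes> a [^] snd p"
      using someI[of "\<lambda>p. fst p \<in> H \<and> h \<otimes> a [^] k = fst p \<otimes> a [^] (snd p :: nat)" "(h, k)"] h
      unfolding p_def[symmetric] by auto
    have "\<phi> (fst p) * \<zeta> ^ snd p = \<phi> h * \<zeta> ^ k"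
      using wd[OF h p(1,2)] wd[OF p(1) h p(2)[symmetric]] by (cases "k \<le> snd p") auto
    then show ?thesis unfolding \<psi>_def p_def[symmetric] Let_def .
  qed
  have \<zeta>0: "\<zeta> \<noteq> 0"
  proof
    assume "\<zeta> = 0"
    then have "\<phi> (a [^] m) = 0" using \<zeta> m(1) by (simp add: power_0_left)
    then show False using mult(2)[OF m(2) one] by simp
  qed
  have "character_on G H' \<psi>"
    unfolding character_on_def
  proof (intro conjI ballI)
    fix x assume "x \<in> H'"
    then obtain h k where x: "x = h \<otimes> a [^] (k::nat)" "h \<in> H" unfolding H'_def by auto
    show "\<psi> x \<noteq> 0" using x \<psi> mult(2)[OF x(2) one] \<zeta>0 by simp
    fix y assume "y \<in> H'"
    then obtain h' k' where y: "y = h' \<otimes> a [^] (k'::nat)" "h' \<in> H" unfolding H'_def by auto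
    have "x \<otimes> y = (h \<otimes> h') \<otimes> a [^] (k + k')"
      using x y Hc a by (simp add: nat_pow_mult[symmetric] m_ac)
    then show "\<psi> (x \<otimes> y) = \<psi> x * \<psi> y"
      using \<psi>[OF subgroup.m_closed[OF H x(2) y(2)]] \<psi>[OF x(2)] \<psi>[OF y(2)] mult(1)[OF x(2) y(2)] x(1) y(1)
      by (simp add: power_add)
  qed
  moreover have "H \<subseteq> H'"
  proof
    fix h assume "h \<in> H"
    then have "h = h \<otimes> a [^] (0::nat)" using Hc by simp
    then show "h \<in> H'" using \<open>h \<in> H\<close> unfolding H'_def by blast
  qed
  moreover have a1: "a = \<one> \<otimes> a [^] (1::nat)" using a by simp
  then have "a \<in> H'" using one unfolding H'_def by blast
  moreover have "\<forall>x\<in>H. \<psi> x = \<phi> x"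
    using \<psi>[of _ 0] Hc by auto
  moreover have "\<psi> a = \<zeta>"
    using \<psi>[OF one, of 1] character_on_one[OF \<phi> one] a by simp
  ultimately show ?thesis using sub by blast
qed

lemma exists_min_power:
  assumes H: "subgroup H G" and a: "a \<in> carrier G"
  shows "\<exists>m>0. a [^] (m::nat) \<in> H \<and> (\<forall>r. 0 < r \<longrightarrow> r < m \<longrightarrow> a [^] (r::nat) \<notin> H)"
proof -
  have "Coset.order G > 0" "a [^] Coset.order G \<in> H"
    using fin pow_order_eq_1[OF a] subgroup.one_closed[OF H] by (auto simp: order_gt_0_iff_finite)
  then have ex: "\<exists>m::nat. m > 0 \<and> a [^] m \<in> H" by blast
  define m where "m = (LEAST m::nat. m > 0 \<and> a [^] m \<in> H)"
  have "m > 0 \<and> a [^] m \<in> H" unfolding m_def using ex by (rule LeastI_ex)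
  moreover have "a [^] r \<notin> H" if "0 < r" "r < m" for r :: nat
    using not_less_Least[of r "\<lambda>m::nat. m > 0 \<and> a [^] m \<in> H"] that unfolding m_def by blast
  ultimately show ?thesis by blast
qed

text \<open>Adjoin one element at a time; each step needs only an m-th root in the complex
  numbers.\<close>

lemma character_extend:
  assumes "subgroup H G" "character_on G H \<phi>"
  shows "\<exists>\<psi>. character_on G (carrier G) \<psi> \<and> (\<forall>x\<in>H. \<psi> x = \<phi> x)"
  using assms
proof (induction "card (carrier G) - card H" arbitrary: H \<phi> rule: less_induct)
  case less
  have HG: "H \<subseteq> carrier G" using subgroup.subset[OF less(2)] .
  show ?case
  proof (cases "H = carrier G")
    case True
    then show ?thesis using less by blast
  next
    case False
    then obtain a where a: "a \<in> carrier G" "a \<notin> H" using HG by blast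
    obtain m where m: "m > 0" "a [^] m \<in> H" "\<And>r. 0 < r \<Longrightarrow> r < m \<Longrightarrow> a [^] (r::nat) \<notin> H"
      using exists_min_power[OF less(2) a(1)] by blast
    obtain \<zeta> where \<zeta>: "\<zeta> ^ m = \<phi> (a [^] m)" using nth_root_exists[OF m(1)] by blast
    obtain H' \<psi> where H': "subgroup H' G" "H \<subseteq> H'" "a \<in> H'" "character_on G H' \<psi>" "\<forall>x\<in>H. \<psi> x = \<phi> x"
      using character_adjoin[OF less(2,3) a(1) m \<zeta>] by blast
    have H'G: "H' \<subseteq> carrier G" using subgroup.subset[OF H'(1)] .
    have "card H < card H'" using H' a finite_subset[OF H'G fin] by (intro psubset_card_mono) auto
    moreover have "card H' \<le> card (carrier G)" using H'G fin by (intro card_mono)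
    ultimately have "card (carrier G) - card H' < card (carrier G) - card H" by simp
    from less(1)[OF this H'(1,4)] show ?thesis using H' by (metis subsetD)
  qed
qed

text \<open>Start from the trivial subgroup. There m is the order of \<open>x\<close>, and m > 1
  makes a root of unity other than 1 available as the value at \<open>x\<close>.\<close>

lemma exists_separating_character:
  assumes "x \<in> carrier G" "x \<noteq> \<one>"
  shows "\<exists>\<psi>. character_on G (carrier G) \<psi> \<and> \<psi> x \<noteq> 1"
proof -
  have H: "subgroup {\<one>} G" by (rule triv_subgroup)
  have \<phi>: "character_on G {\<one>} (\<lambda>_. 1)" by (simp add: character_on_def)
  obtain m where m: "m > 0" "x [^] m \<in> {\<one>}" "\<And>r. 0 < r \<Longrightarrow> r < m \<Longrightarrow> x [^] (r::nat) \<notin> {\<one>}"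
    using exists_min_power[OF H assms(1)] by blast
  have "m \<noteq> 1" using m(2) assms by auto
  then have "m > 1" using m(1) by simp
  then have "card {z::complex. z ^ m = 1} > 1" using card_nth_roots[of 1 m] by simp
  then have "\<not> {z::complex. z ^ m = 1} \<subseteq> {1}" using card_mono[of "{1::complex}" "{z. z ^ m = 1}"] by auto
  then obtain \<zeta> :: complex where \<zeta>: "\<zeta> ^ m = 1" "\<zeta> \<noteq> 1" by auto
  obtain H' \<psi> where H': "subgroup H' G" "x \<in> H'" "character_on G H' \<psi>" "\<psi> x = \<zeta>"
    using character_adjoin[OF H \<phi> assms(1) m \<zeta>(1)] by blast
  from character_extend[OF H'(1,3)] show ?thesis using H'(2,4) \<zeta>(2) by metis
qed

lemma dualD:
  assumes "\<phi> \<in> dual G"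
  shows "x \<in> carrier G \<Longrightarrow> y \<in> carrier G \<Longrightarrow> \<phi> (x \<otimes> y) = \<phi> x * \<phi> y" "x \<in> carrier G \<Longrightarrow> \<phi> x ^ Coset.order G = 1"
    "x \<notin> carrier G \<Longrightarrow> \<phi> x = 0" "\<phi> \<one> = 1"
proof -
  have c: "character_on G (carrier G) \<phi>" using assms by (simp add: dual_def)
  show one: "\<phi> \<one> = 1" using character_on_one[OF c] by simp
  show "x \<in> carrier G \<Longrightarrow> y \<in> carrier G \<Longrightarrow> \<phi> (x \<otimes> y) = \<phi> x * \<phi> y"
    using c by (simp add: character_on_def)
  show "x \<notin> carrier G \<Longrightarrow> \<phi> x = 0" using assms by (simp add: dual_def)
  show "\<phi> x ^ Coset.order G = 1" if "x \<in> carrier G"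
    using character_on_pow[OF c subgroup_self that, of "Coset.order G"] pow_order_eq_1[OF that] one by simp
qed

lemma dual_norm: "\<phi> \<in> dual G \<Longrightarrow> x \<in> carrier G \<Longrightarrow> norm (\<phi> x) = 1"
proof -
  assume "\<phi> \<in> dual G" "x \<in> carrier G"
  then have "\<phi> x ^ Coset.order G = 1" by (rule dualD(2))
  moreover have "Coset.order G > 0" using fin by (simp add: order_gt_0_iff_finite)
  ultimately show ?thesis using power_eq_1_iff[of "\<phi> x" "Coset.order G"] by simp
qed

lemma finite_dual: "finite (dual G)"
proof -
  have "Coset.order G > 0" using fin by (simp add: order_gt_0_iff_finite)
  then have "finite {z::complex. z ^ Coset.order G = 1}" using finite_nth_roots[of "Coset.order G" 1] by simp
  from finite_set_of_finite_funs[OF fin this, of 0] show ?thesis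
    by (rule finite_subset[rotated]) (auto dest: dualD)
qed

definition triv :: "'a \<Rightarrow> complex" where "triv x = (if x \<in> carrier G then 1 else 0)"

lemma triv_dual: "triv \<in> dual G" by (auto simp: dual_def character_on_def triv_def)

lemma sum_character:
  assumes "\<phi> \<in> dual G" "\<phi> \<noteq> triv"
  shows "(\<Sum>x\<in>carrier G. \<phi> x) = 0"
proof -
  obtain y where y: "y \<in> carrier G" "\<phi> y \<noteq> 1"
    using assms dualD(3)[OF assms(1)] by (metis ext triv_def)
  have "(\<Sum>x\<in>carrier G. \<phi> x) = (\<Sum>x\<in>carrier G. \<phi> (y \<otimes> x))"
    by (rule sum.reindex_bij_witness[of _ "\<lambda>x. y \<otimes> x" "\<lambda>x. inv y \<otimes> x"]) (use y in \<open>auto simp: m_assoc[symmetric]\<close>)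
  also have "\<dots> = \<phi> y * (\<Sum>x\<in>carrier G. \<phi> x)"
    using dualD(1)[OF assms(1) y(1)] by (simp add: sum_distrib_left)
  finally show ?thesis using y by simp
qed

lemma sum_dual:
  assumes "x \<in> carrier G" "x \<noteq> \<one>"
  shows "(\<Sum>\<phi>\<in>dual G. \<phi> x) = 0"
proof -
  obtain \<psi>0 where \<psi>0: "character_on G (carrier G) \<psi>0" "\<psi>0 x \<noteq> 1" using exists_separating_character[OF assms] by blast
  define \<psi> where "\<psi> = (\<lambda>y. if y \<in> carrier G then \<psi>0 y else 0)"
  have \<psi>: "\<psi> \<in> dual G" using \<psi>0 by (auto simp: dual_def \<psi>_def character_on_def)
  have nz: "\<psi> y \<noteq> 0" if "y \<in> carrier G" for y using dual_norm[OF \<psi> that] by auto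
  have "(\<Sum>\<phi>\<in>dual G. \<phi> x) = (\<Sum>\<phi>\<in>dual G. \<psi> x * \<phi> x)"
  proof (rule sum.reindex_bij_witness[of _ "\<lambda>\<phi> y. \<psi> y * \<phi> y" "\<lambda>\<phi> y. \<phi> y / \<psi> y"])
    fix \<phi> assume \<phi>: "\<phi> \<in> dual G"
    show "(\<lambda>y. \<psi> y * (\<phi> y / \<psi> y)) = \<phi>"
    proof
      fix y show "\<psi> y * (\<phi> y / \<psi> y) = \<phi> y"
        using nz[of y] dualD(3)[OF \<phi>, of y] by (cases "y \<in> carrier G") auto
    qed
    show "(\<lambda>y. \<psi> y * \<phi> y / \<psi> y) = \<phi>"
    proof
      fix y show "\<psi> y * \<phi> y / \<psi> y = \<phi> y"
        using nz[of y] dualD(3)[OF \<phi>, of y] by (cases "y \<in> carrier G") auto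
    qed
    show "(\<lambda>y. \<phi> y / \<psi> y) \<in> dual G" "(\<lambda>y. \<psi> y * \<phi> y) \<in> dual G"
      using \<phi> \<psi> nz by (auto simp: dual_def character_on_def)
    show "\<psi> x * (\<phi> x / \<psi> x) = \<phi> x" using nz[OF assms(1)] by simp
  qed
  also have "\<dots> = \<psi> x * (\<Sum>\<phi>\<in>dual G. \<phi> x)" by (simp add: sum_distrib_left)
  finally show ?thesis using \<psi>0(2) assms by (simp add: \<psi>_def)
qed

text \<open>The two orthogonality relations evaluate the sum of all character values in two
  ways.\<close>

lemma card_dual: "card (dual G) = card (carrier G)"
proof -
  have "(\<Sum>x\<in>carrier G. \<Sum>\<phi>\<in>dual G. \<phi> x) = (\<Sum>x\<in>carrier G. if x = \<one> then of_nat (card (dual G)) else 0)"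
    by (intro sum.cong refl) (simp add: sum_dual dualD(4))
  also have "\<dots> = of_nat (card (dual G))" using fin by (simp add: sum.delta)
  finally have 1: "(\<Sum>x\<in>carrier G. \<Sum>\<phi>\<in>dual G. \<phi> x) = of_nat (card (dual G))" .
  have "(\<Sum>\<phi>\<in>dual G. \<Sum>x\<in>carrier G. \<phi> x) = (\<Sum>\<phi>\<in>dual G. if \<phi> = triv then of_nat (card (carrier G)) else 0)"
    by (intro sum.cong refl) (simp add: sum_character, simp add: triv_def)
  also have "\<dots> = of_nat (card (carrier G))" using finite_dual triv_dual by (simp add: sum.delta)
  finally have "of_nat (card (dual G)) = (of_nat (card (carrier G)) :: complex)"
    using 1 sum.swap[of "\<lambda>x \<phi>. \<phi> x" "dual G" "carrier G"] by simp
  then show ?thesis by (simp only: of_nat_eq_iff)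
qed

end

section \<open>Power sums and the coefficient recursion\<close>

text \<open>Combining consecutive power sums with the coefficients of a polynomial that vanishes at all the
  other roots isolates the powers of \<open>b1\<close>.\<close>
lemma power_sums_bounded_imp_roots_bounded:
  fixes bs :: "complex list"
  assumes bound: "\<And>k. k \<ge> k0 \<Longrightarrow> norm (\<Sum>b\<leftarrow>bs. b ^ k) \<le> C" and b: "b1 \<in> set bs"
  shows "norm b1 \<le> 1"
proof (rule ccontr)
  assume big: "\<not> norm b1 \<le> 1"
  define p where "p = (\<Prod>b\<in>set bs - {b1}. [:- b, 1:])"
  have p0: "poly p b = 0 \<longleftrightarrow> b \<noteq> b1" if "b \<in> set bs" for b
    using that by (auto simp: p_def poly_prod prod_zero_iff)
  \<comment> \<open>The list may contain \<open>b1\<close> repeatedly; equal terms add up without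
    cancellation.\<close>
  define m where "m = length (filter ((=) b1) bs)"
  have m: "m > 0" using b by (auto simp: m_def filter_empty_conv)
  have key: "(\<Sum>t\<le>degree p. coeff p t * (\<Sum>b\<leftarrow>bs. b ^ (k + t))) = of_nat m * (poly p b1 * b1 ^ k)" for k
  proof -
    have "(\<Sum>t\<le>degree p. coeff p t * (\<Sum>b\<leftarrow>bs. b ^ (k + t))) = (\<Sum>b\<leftarrow>bs. poly p b * b ^ k)"
      unfolding poly_altdef
      by (induction bs) (simp_all add: algebra_simps sum.distrib sum_distrib_left sum_distrib_right power_add)
    also have "\<dots> = (\<Sum>b\<leftarrow>filter ((=) b1) bs. poly p b * b ^ k)"
      using p0 by (intro sum_list_map_filter[symmetric]) auto
    also have "\<dots> = of_nat m * (poly p b1 * b1 ^ k)"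
      unfolding m_def by (induction bs) (auto simp: algebra_simps)
    finally show ?thesis .
  qed
  define D where "D = (\<Sum>t\<le>degree p. norm (coeff p t) * C)"
  define c where "c = real m * norm (poly p b1)"
  have c: "c > 0" using m p0[OF b] by (simp add: c_def)
  have le: "c * norm b1 ^ k \<le> D" if "k \<ge> k0" for k
  proof -
    have "c * norm b1 ^ k = norm (\<Sum>t\<le>degree p. coeff p t * (\<Sum>b\<leftarrow>bs. b ^ (k + t)))"
      unfolding key by (simp add: norm_mult norm_power c_def)
    also have "\<dots> \<le> (\<Sum>t\<le>degree p. norm (coeff p t) * norm (\<Sum>b\<leftarrow>bs. b ^ (k + t)))"
      by (rule order_trans[OF norm_sum]) (simp add: norm_mult)
    also have "\<dots> \<le> D" unfolding D_def using bound that by (intro sum_mono mult_left_mono) auto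
    finally show ?thesis .
  qed
  obtain k where k: "D / c < norm b1 ^ k" using real_arch_pow[of "norm b1" "D / c"] big by auto
  have "norm b1 ^ k \<le> norm b1 ^ max k k0" using big by (intro power_increasing) auto
  then have "D / c < norm b1 ^ max k k0" using k by simp
  then have "D < c * norm b1 ^ max k k0" using c by (simp add: pos_divide_less_eq mult.commute)
  then show False using le[of "max k k0"] by simp
qed

text \<open>Squaring and dividing by \<open>Q\<close> reduces to the unit disc. Even indices are the
  ones available, since the point count works over fields of q^(2k) elements.\<close>

lemma even_power_sums_bound:
  fixes gs :: "complex list" and Q C :: real
  assumes Q: "Q > 0" and bound: "\<And>k. k \<ge> k0 \<Longrightarrow> norm (\<Sum>g\<leftarrow>gs. g ^ (2 * k)) \<le> C * Q ^ k"
    and g: "g \<in> set gs"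
  shows "norm g \<le> sqrt Q"
proof -
  define bs where "bs = map (\<lambda>g. g ^ 2 / of_real Q) gs"
  have "norm (g ^ 2 / of_real Q) \<le> 1"
  proof (rule power_sums_bounded_imp_roots_bounded)
    show "g ^ 2 / of_real Q \<in> set bs" using g by (auto simp: bs_def)
    fix k assume k: "k \<ge> k0"
    have "(\<Sum>b\<leftarrow>bs. b ^ k) = (\<Sum>g\<leftarrow>gs. g ^ (2 * k)) / of_real (Q ^ k)"
      unfolding bs_def by (induction gs) (simp_all add: power_divide power_mult add_divide_distrib)
    then have "norm (\<Sum>b\<leftarrow>bs. b ^ k) = norm (\<Sum>g\<leftarrow>gs. g ^ (2 * k)) / Q ^ k"
      using Q by (simp add: norm_divide norm_power)
    also have "\<dots> \<le> C" using bound[OF k] Q by (simp add: pos_divide_le_eq)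
    finally show "norm (\<Sum>b\<leftarrow>bs. b ^ k) \<le> C" .
  qed
  then have "(norm g)\<^sup>2 \<le> Q" using Q by (simp add: norm_divide norm_power)
  then show ?thesis by (rule real_le_rsqrt)
qed

section \<open>Newton's identities and the solution of the recursion\<close>

lemma fps_reflect_linear: "fps_of_poly (reflect_poly [:- a, 1:]) = 1 - fps_const (a::'a::field) * fps_X"
proof -
  have "reflect_poly [:- a, 1:] = [:1, - a:]"
    by (rule poly_eqI) (auto simp: coeff_reflect_poly coeff_pCons split: nat.splits)
  then show ?thesis
    by (simp add: fps_of_poly_linear' del: fps_const_neg add: fps_const_neg[symmetric])
qed

text \<open>The reversed polynomial is monic of degree exactly l because \<open>lam 0 = 1\<close>,
  so it has l roots. Roots at 0 fill up the list if \<open>lam\<close> already vanishes at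
  l.\<close>

lemma factor_lambda:
  fixes lam :: "nat \<Rightarrow> complex"
  assumes "lam 0 = 1" "\<And>d. d > l \<Longrightarrow> lam d = 0"
  shows "\<exists>gs. length gs = l \<and> Abs_fps lam = (\<Prod>g\<leftarrow>gs. 1 - fps_const g * fps_X)"
proof -
  define R where "R = (\<Sum>i\<le>l. monom (lam (l - i)) i)"
  have co: "coeff R i = (if i \<le> l then lam (l - i) else 0)" for i
    by (simp add: R_def coeff_sum coeff_monom)
  have "degree R \<le> l" by (rule degree_le) (simp add: co)
  moreover have "degree R \<ge> l" by (rule le_degree) (simp add: co assms)
  ultimately have deg: "degree R = l" by simp
  have lead: "lead_coeff R = 1" by (simp add: deg co assms)
  then have "R \<noteq> 0" by auto
  from alg_closed_imp_factorization[OF this] obtain A where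
    A: "size A = l" "R = (\<Prod>x\<in>#A. [:- x, 1:])" using deg lead by auto
  obtain gs where gs: "A = mset gs" by (metis ex_mset)
  have R: "R = (\<Prod>g\<leftarrow>gs. [:- g, 1:])" unfolding A(2) gs by (simp flip: prod_mset_prod_list mset_map)
  have "Abs_fps lam = fps_of_poly (reflect_poly R)"
    using assms(2) by (intro fps_ext) (auto simp: coeff_reflect_poly deg co)
  also have "\<dots> = (\<Prod>g\<leftarrow>gs. 1 - fps_const g * fps_X)"
    unfolding R reflect_poly_prod_list fps_of_poly_prod_list map_map o_def fps_reflect_linear ..
  finally show ?thesis using A gs by auto
qed

text \<open>The logarithmic derivative of the product, freed of denominators.\<close>

lemma fps_newton:
  fixes gs :: "complex list"
  defines "L \<equiv> (\<Prod>g\<leftarrow>gs. 1 - fps_const g * fps_X)"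
  shows "fps_X * fps_deriv L = - (Abs_fps (\<lambda>k. if k = 0 then 0 else (\<Sum>g\<leftarrow>gs. g ^ k)) * L)"
  unfolding L_def
proof (induction gs)
  case Nil
  have "Abs_fps (\<lambda>k. if k = 0 then 0 else (\<Sum>g\<leftarrow>[]. g ^ k)) = (0 :: complex fps)" by (rule fps_ext) simp
  then show ?case by (simp only:) simp
next
  case (Cons g gs)
  define L where "L = (\<Prod>g\<leftarrow>gs. 1 - fps_const g * fps_X)"
  define P where "P = Abs_fps (\<lambda>k. if k = 0 then 0 else (\<Sum>g\<leftarrow>gs. g ^ k))"
  \<comment> \<open>The geometric series g X / (1 - g X).\<close>
  define T where "T = Abs_fps (\<lambda>k. if k = 0 then 0 else g ^ k)"
  have T: "T * (1 - fps_const g * fps_X) = fps_const g * fps_X"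
  proof (rule fps_ext)
    fix n
    have "T * (1 - fps_const g * fps_X) = T - fps_const g * (fps_X * T)" by (simp add: algebra_simps)
    then show "(T * (1 - fps_const g * fps_X)) $ n = (fps_const g * fps_X) $ n"
      by (cases n; cases "n - 1") (auto simp: T_def fps_mult_left_const_nth)
  qed
  have PT: "Abs_fps (\<lambda>k. if k = 0 then 0 else (\<Sum>g\<leftarrow>g # gs. g ^ k)) = T + P"
    by (rule fps_ext) (simp add: T_def P_def)
  have IH: "fps_X * fps_deriv L = - (P * L)" using Cons by (simp add: L_def P_def)
  have "fps_X * fps_deriv ((1 - fps_const g * fps_X) * L)
      = (1 - fps_const g * fps_X) * (fps_X * fps_deriv L) - (fps_const g * fps_X) * L"
    by (simp add: algebra_simps)
  also have "\<dots> = - ((T + P) * ((1 - fps_const g * fps_X) * L))"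
  proof -
    have "(fps_const g * fps_X) * L = T * (1 - fps_const g * fps_X) * L" by (simp only: T)
    moreover have "a * (- (P * L)) - T * a * L = - ((T + P) * (a * L))" for a by (simp add: algebra_simps)
    ultimately show ?thesis by (simp only: IH)
  qed
  finally show ?case unfolding PT by (simp add: L_def)
qed

text \<open>The hypothesis and \<open>fps_newton\<close> describe the same derivative; the nonzero
  series \<open>Abs_fps lam\<close> cancels.\<close>

lemma newton_power_sums:
  fixes lam s :: "nat \<Rightarrow> complex"
  assumes L: "Abs_fps lam = (\<Prod>g\<leftarrow>gs. 1 - fps_const g * fps_X)"
    and newton: "\<And>n. of_nat n * lam n = (\<Sum>k=1..n. s k * lam (n - k))" and k: "k \<ge> 1"
    and lam_0: "lam 0 = 1"
  shows "s k = - (\<Sum>g\<leftarrow>gs. g ^ k)"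
proof -
  define S where "S = Abs_fps (\<lambda>k. if k = 0 then 0 else s k)"
  define P where "P = Abs_fps (\<lambda>k. if k = 0 then 0 else (\<Sum>g\<leftarrow>gs. g ^ k))"
  have "fps_X * fps_deriv (Abs_fps lam) = S * Abs_fps lam"
  proof (rule fps_ext)
    fix n
    have "(S * Abs_fps lam) $ n = (\<Sum>k=0..n. (if k = 0 then 0 else s k) * lam (n - k))"
      by (simp add: fps_mult_nth S_def)
    also have "\<dots> = (\<Sum>k=1..n. s k * lam (n - k))"
      by (intro sum.mono_neutral_cong_right) auto
    also have "\<dots> = (fps_X * fps_deriv (Abs_fps lam)) $ n"
      unfolding newton[symmetric] by (cases n) auto
    finally show "(fps_X * fps_deriv (Abs_fps lam)) $ n = (S * Abs_fps lam) $ n" ..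
  qed
  moreover have "fps_X * fps_deriv (Abs_fps lam) = - P * Abs_fps lam"
    unfolding L P_def fps_newton by simp
  moreover have "Abs_fps lam \<noteq> 0" using lam_0 by (metis Abs_fps_inverse fps_nonzero_nth fps_nth_Abs_fps zero_neq_one)
  ultimately have "S = - P" by (metis mult_right_cancel)
  then have "S $ k = (- P) $ k" by simp
  then show ?thesis using k by (simp add: S_def P_def)
qed

text \<open>The solution of the recursion for the single factor \<open>1 - g X\<close>.\<close>
definition ecoef :: "real \<Rightarrow> complex \<Rightarrow> nat \<Rightarrow> complex" where
  "ecoef q g k = (\<Prod>i=1..k. - g / of_real (q ^ i - 1))"

text \<open>Passing from k to k + 1 costs at most the factor sqrt q * c / q^(k+1) with c = q/(q -
  1), and 1/2 - (k + 1) is the difference of -(k + 1)^2/2 and -k^2/2.\<close>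

lemma ecoef_bound:
  assumes q: "q > 1" and g: "norm g \<le> sqrt q"
  shows "norm (ecoef q g k) \<le> q powr (- (real k ^ 2 / 2)) * (1 + 1 / (q - 1)) ^ k"
proof (induction k)
  case 0
  then show ?case using q by (simp add: ecoef_def)
next
  case (Suc k)
  define c where "c = 1 + 1 / (q - 1)"
  have c: "c > 0" "c = q / (q - 1)" using q by (auto simp: c_def field_simps)
  have qk: "q ^ Suc k > 1" using q by (intro one_less_power) auto
  have "q ^ Suc k * (1 / c) \<le> q ^ Suc k - 1"
  proof -
    have "q ^ Suc k * (1 / c) = q ^ Suc k - q ^ k" using q by (simp add: c(2) field_simps)
    then show ?thesis using q by simp
  qed
  moreover have "1 / (y - 1) \<le> c / y" if "y > 1" "y * (1 / c) \<le> y - 1" for y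
    using that c(1) by (simp add: field_simps)
  ultimately have inv: "1 / (q ^ Suc k - 1) \<le> c / q ^ Suc k" using qk by blast
  have "norm (ecoef q g (Suc k)) = norm (ecoef q g k) * (norm g * (1 / (q ^ Suc k - 1)))"
  proof -
    have "ecoef q g (Suc k) = ecoef q g k * (- g / of_real (q ^ Suc k - 1))" by (simp add: ecoef_def)
    moreover have "norm (of_real (q ^ Suc k - 1) :: complex) = q ^ Suc k - 1" using qk by (simp only: norm_of_real)
    ultimately show ?thesis by (simp only: norm_mult norm_divide norm_minus_cancel) simp
  qed
  also have "\<dots> \<le> (q powr (- (real k ^ 2 / 2)) * c ^ k) * (sqrt q * (c / q ^ Suc k))"
    using Suc g inv q qk c by (intro mult_mono) (auto simp: c_def)
  also have "\<dots> = (q powr (- (real k ^ 2 / 2)) * q powr (1 / 2) * q powr (- real (Suc k))) * c ^ Suc k"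
  proof -
    have "sqrt q = q powr (1 / 2)" using q by (simp add: powr_half_sqrt)
    moreover have "c / q ^ Suc k = q powr (- real (Suc k)) * c"
      using q powr_realpow[of q "Suc k"] by (simp only: powr_minus_divide) simp
    moreover have "a * c ^ k * (b * (d * c)) = a * b * d * c ^ Suc k" for a b d by simp
    ultimately show ?thesis by (simp only:)
  qed
  also have "q powr (- (real k ^ 2 / 2)) * q powr (1 / 2) * q powr (- real (Suc k)) = q powr (- (real (Suc k) ^ 2 / 2))"
    unfolding powr_add[symmetric] by (rule arg_cong[where f = "(powr) q"]) (simp add: field_simps power2_eq_square)
  finally show ?case by (simp add: c_def)
qed

lemma sum_choose_hockey: "(\<Sum>k\<le>n. (n - k + l) choose (n - k)) = (n + Suc l) choose n"
proof -
  have "(\<Sum>k\<le>n. (n - k + l) choose (n - k)) = (\<Sum>k\<le>n. (k + l) choose k)"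
    by (rule sum.reindex_bij_witness[of _ "\<lambda>k. n - k" "\<lambda>k. n - k"]) auto
  also have "\<dots> = (n + Suc l) choose n"
    using sum_choose_lower[of l n] by (simp add: add.commute)
  finally show ?thesis .
qed

text \<open>Induction on the number of factors. All terms of the Cauchy product obey a bound with
  the same power of q, and the binomial coefficients add up by the hockey stick identity.\<close>

lemma prod_ecoef_bound:
  assumes q: "q > 1" and gs: "\<And>g. g \<in> set gs \<Longrightarrow> norm g \<le> sqrt q" "gs \<noteq> []"
  shows "norm ((\<Prod>g\<leftarrow>gs. Abs_fps (ecoef q g)) $ n)
    \<le> q powr (- (real n ^ 2 / (2 * real (length gs)))) * (1 + 1 / (q - 1)) ^ n * real ((n + length gs - 1) choose n)"
  using gs(2,1)
proof (induction gs arbitrary: n rule: list_nonempty_induct)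
  case (single g)
  then show ?case using ecoef_bound[OF q, of g n] by simp
next
  case (cons g gs)
  define c where "c = 1 + 1 / (q - 1)"
  have c: "c > 0" using q by (simp add: c_def add_pos_pos)
  define l where "l = length gs - 1"
  have l: "length gs = Suc l" using cons(1) by (simp add: l_def)
  define F where "F = (\<Prod>g\<leftarrow>gs. Abs_fps (ecoef q g))"
  define B where "B = q powr (- (real n ^ 2 / (2 * real (Suc (Suc l))))) * c ^ n"
  have trm: "norm (ecoef q g k * F $ (n - k)) \<le> B * real ((n - k + l) choose (n - k))" if "k \<le> n" for k
  proof -
    have "norm (ecoef q g k * F $ (n - k)) \<le> (q powr (- (real k ^ 2 / 2)) * c ^ k)
       * (q powr (- (real (n - k) ^ 2 / (2 * real (Suc l)))) * c ^ (n - k) * real ((n - k + l) choose (n - k)))"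
      unfolding norm_mult using cons ecoef_bound[OF q, of g k] c
      by (intro mult_mono) (auto simp: F_def c_def l)
    also have "\<dots> = (q powr (- (real k ^ 2 / 2)) * q powr (- (real (n - k) ^ 2 / (2 * real (Suc l))))) * c ^ n
        * real ((n - k + l) choose (n - k))"
    proof -
      have "c ^ n = c ^ k * c ^ (n - k)" using that by (simp flip: power_add)
      then show ?thesis by (simp only: mult_ac)
    qed
    also have "\<dots> \<le> B * real ((n - k + l) choose (n - k))"
    proof -
      \<comment> \<open>Convexity in the form a^2/2 + b^2/(2m) \<ge> (a + b)^2/(2(m + 1)); cleared
        of denominators, the difference of the two sides is the square of a m - b.\<close>
      define a b m where "a = real k" and "b = real (n - k)" and "m = real (Suc l)"
      have m: "m > 0" by (simp add: m_def)
      have n: "real n = a + b" using that by (simp add: a_def b_def of_nat_diff)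
      have "(a + b)\<^sup>2 * m \<le> (a\<^sup>2 * m + b\<^sup>2) * (m + 1)"
        using zero_le_power2[of "a * m - b"] by (simp add: power2_eq_square algebra_simps)
      also have "a\<^sup>2 * m + b\<^sup>2 = (a\<^sup>2 + b\<^sup>2 / m) * m" using m by (simp add: distrib_right)
      finally have "(a + b)\<^sup>2 * m \<le> (a\<^sup>2 + b\<^sup>2 / m) * (m + 1) * m" by (simp only: mult_ac)
      then have "(a + b)\<^sup>2 \<le> (a\<^sup>2 + b\<^sup>2 / m) * (m + 1)" using m by (rule mult_right_le_imp_le)
      moreover have "m + 1 > 0" using m by simp
      ultimately have "(a + b)\<^sup>2 / (m + 1) \<le> a\<^sup>2 + b\<^sup>2 / m" by (simp only: pos_divide_le_eq)
      then have "(a + b)\<^sup>2 / (m + 1) / 2 \<le> (a\<^sup>2 + b\<^sup>2 / m) / 2" by (rule divide_right_mono) simp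
      then have "(a + b)\<^sup>2 / (2 * (m + 1)) \<le> a\<^sup>2 / 2 + b\<^sup>2 / (2 * m)"
        by (simp only: add_divide_distrib divide_divide_eq_left mult.commute[of 2])
      moreover have "real (Suc (Suc l)) = m + 1" by (simp add: m_def)
      ultimately have "q powr (- (a\<^sup>2 / 2)) * q powr (- (b\<^sup>2 / (2 * m))) \<le> q powr (- (real n ^ 2 / (2 * real (Suc (Suc l)))))"
        unfolding powr_add[symmetric] n using q by (intro powr_mono) auto
      then show ?thesis unfolding B_def a_def b_def m_def using c by (intro mult_right_mono) auto
    qed
    finally show ?thesis .
  qed
  have "norm ((\<Prod>g\<leftarrow>g # gs. Abs_fps (ecoef q g)) $ n) = norm (\<Sum>k=0..n. ecoef q g k * F $ (n - k))"
    by (simp add: F_def fps_mult_nth)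
  also have "\<dots> \<le> (\<Sum>k=0..n. B * real ((n - k + l) choose (n - k)))"
    by (rule order_trans[OF norm_sum sum_mono]) (use trm in simp)
  also have "\<dots> = B * real (\<Sum>k\<le>n. (n - k + l) choose (n - k))"
    by (simp add: sum_distrib_left atLeast0AtMost)
  also have "\<dots> = B * real ((n + Suc l) choose n)" unfolding sum_choose_hockey ..
  finally show ?case by (simp add: B_def l c_def)
qed

text \<open>This is F(qX) = (1 - g X) F(X), the functional equation of a q-exponential
  series.\<close>

lemma scale_ecoef:
  assumes "q > 1"
  shows "Abs_fps (\<lambda>k. of_real (q ^ k) * ecoef q g k) = (1 - fps_const g * fps_X) * Abs_fps (ecoef q g)"
proof (rule fps_ext)
  fix n
  have eq: "(1 - fps_const g * fps_X) * Abs_fps (ecoef q g) = Abs_fps (ecoef q g) - fps_const g * (fps_X * Abs_fps (ecoef q g))"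
    by (simp add: algebra_simps)
  show "Abs_fps (\<lambda>k. of_real (q ^ k) * ecoef q g k) $ n = ((1 - fps_const g * fps_X) * Abs_fps (ecoef q g)) $ n"
  proof (cases n)
    case 0
    then show ?thesis by (simp add: eq ecoef_def)
  next
    case (Suc m)
    have "q ^ Suc m > 1" using assms by (intro one_less_power) auto
    then have nz: "(of_real (q ^ Suc m - 1) :: complex) \<noteq> 0" by (simp only: of_real_eq_0_iff)
    have "ecoef q g (Suc m) * of_real (q ^ Suc m - 1) = - g * ecoef q g m"
      using nz by (simp add: ecoef_def del: power_Suc of_real_diff)
    then have "of_real (q ^ Suc m) * ecoef q g (Suc m) = ecoef q g (Suc m) - g * ecoef q g m"
      by (simp add: algebra_simps del: power_Suc)
    then show ?thesis by (simp add: eq Suc fps_mult_left_const_nth del: power_Suc)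
  qed
qed

text \<open>Substituting qX for X is multiplicative, so the functional equations of the factors
  multiply.\<close>

lemma scale_prod_ecoef:
  assumes q: "q > 1"
  defines "F \<equiv> (\<lambda>gs. \<Prod>g\<leftarrow>gs. Abs_fps (ecoef q g))"
  shows "Abs_fps (\<lambda>k. of_real (q ^ k) * F gs $ k) = (\<Prod>g\<leftarrow>gs. 1 - fps_const g * fps_X) * F gs"
proof (induction gs)
  case Nil
  show ?case by (rule fps_ext) (simp add: F_def)
next
  case (Cons g gs)
  have "Abs_fps (\<lambda>k. of_real (q ^ k) * F (g # gs) $ k)
     = Abs_fps (\<lambda>k. of_real (q ^ k) * ecoef q g k) * Abs_fps (\<lambda>k. of_real (q ^ k) * F gs $ k)"
  proof (rule fps_ext)
    fix n
    have "of_real (q ^ n) * (\<Sum>i=0..n. ecoef q g i * F gs $ (n - i))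
      = (\<Sum>i=0..n. (of_real (q ^ i) * ecoef q g i) * (of_real (q ^ (n - i)) * F gs $ (n - i)))"
      unfolding sum_distrib_left
    proof (rule sum.cong[OF refl])
      fix i assume "i \<in> {0..n}"
      then have "(of_real (q ^ n) :: complex) = of_real (q ^ i) * of_real (q ^ (n - i))"
        by (simp flip: power_add)
      then show "of_real (q ^ n) * (ecoef q g i * F gs $ (n - i))
        = (of_real (q ^ i) * ecoef q g i) * (of_real (q ^ (n - i)) * F gs $ (n - i))"
        by (simp only: mult_ac)
    qed
    then show "Abs_fps (\<lambda>k. of_real (q ^ k) * F (g # gs) $ k) $ n
     = (Abs_fps (\<lambda>k. of_real (q ^ k) * ecoef q g k) * Abs_fps (\<lambda>k. of_real (q ^ k) * F gs $ k)) $ n"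
      by (simp add: F_def fps_mult_nth)
  qed
  also have "\<dots> = (\<Prod>g\<leftarrow>g # gs. 1 - fps_const g * fps_X) * F (g # gs)"
    unfolding Cons scale_ecoef[OF q] by (simp add: F_def mult_ac)
  finally show ?case .
qed

text \<open>By \<open>scale_prod_ecoef\<close> the product series satisfies the same recursion.
  Moving the term d = 0 to the left leaves the factor q^n - 1, nonzero for n \<ge> 1, so the
  solution is unique.\<close>

lemma recursion_bound:
  fixes E lam :: "nat \<Rightarrow> complex" and q :: real
  assumes q: "q > 1" and L: "Abs_fps lam = (\<Prod>g\<leftarrow>gs. 1 - fps_const g * fps_X)" and lam_0: "lam 0 = 1"
    and gs: "gs \<noteq> []" "\<And>g. g \<in> set gs \<Longrightarrow> norm g \<le> sqrt q"
    and E_0: "E 0 = 1" and rec: "\<And>n. of_real (q ^ n) * E n = (\<Sum>d\<le>n. lam d * E (n - d))"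
  shows "norm (E n) \<le> q powr (- (real n ^ 2 / (2 * real (length gs)))) * (1 + 1 / (q - 1)) ^ n * real ((n + length gs - 1) choose n)"
proof -
  define F where "F = (\<Prod>g\<leftarrow>gs. Abs_fps (ecoef q g))"
  have recF: "of_real (q ^ n) * F $ n = (\<Sum>d\<le>n. lam d * F $ (n - d))" for n
    using arg_cong[OF scale_prod_ecoef[OF q, of gs], of "\<lambda>A. A $ n"]
    by (simp add: F_def L[symmetric] fps_mult_nth atLeast0AtMost)
  have "F $ 0 = 1" unfolding F_def by (induction gs) (simp_all add: ecoef_def)
  have "E n = F $ n" for n
  proof (induction n rule: less_induct)
    case (less n)
    show ?case
    proof (cases n)
      case 0
      then show ?thesis using E_0 \<open>F $ 0 = 1\<close> by simp
    next
      case (Suc m)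
      have split: "(\<Sum>d\<le>n. lam d * G (n - d)) = G n + (\<Sum>d\<le>m. lam (Suc d) * G (m - d))" for G :: "nat \<Rightarrow> complex"
        unfolding Suc sum.atMost_Suc_shift by (simp add: lam_0)
      have "(\<Sum>d\<le>m. lam (Suc d) * E (m - d)) = (\<Sum>d\<le>m. lam (Suc d) * F $ (m - d))"
        using less Suc by (intro sum.cong) auto
      then have "of_real (q ^ n) * E n - E n = of_real (q ^ n) * F $ n - F $ n"
        unfolding rec recF split by simp
      then have "of_real (q ^ n - 1) * E n = of_real (q ^ n - 1) * F $ n" by (simp add: algebra_simps)
      moreover have "q ^ n > 1" using q Suc by (intro one_less_power) auto
      then have "(of_real (q ^ n - 1) :: complex) \<noteq> 0" by (simp only: of_real_eq_0_iff)
      ultimately show ?thesis by (simp del: of_real_diff)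
    qed
  qed
  then show ?thesis using prod_ecoef_bound[OF q gs(2,1)] by (simp add: F_def)
qed

section \<open>The Artin-Schreier-Witt curve and its fixed points\<close>

text \<open>Gaussian elimination: one equation is solved for an unknown with nonzero coefficient and
  substituted into the others.\<close>

lemma homogeneous_system_nontrivial:
  fixes A :: "'i \<Rightarrow> 'j \<Rightarrow> 'a::field"
  assumes "finite I" "finite J" "card J < card I"
  shows "\<exists>t. (\<exists>i\<in>I. t i \<noteq> 0) \<and> (\<forall>j\<in>J. (\<Sum>i\<in>I. A i j * t i) = 0)"
  using assms(2,1,3)
proof (induction J arbitrary: I A rule: finite_induct)
  case empty
  then have "I \<noteq> {}" by auto
  then show ?case by (intro exI[of _ "\<lambda>_. 1"]) auto
next
  case (insert j J)
  show ?case
  proof (cases "\<forall>i\<in>I. A i j = 0")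
    case True
    from insert have "card J < card I" by auto
    from insert.IH[OF insert.prems(1) this, of A] True show ?thesis by auto
  next
    case False
    then obtain k where k: "k \<in> I" "A k j \<noteq> 0" by auto
    define I' where "I' = I - {k}"
    define B where "B = (\<lambda>i m. A i m - A i j / A k j * A k m)"
    have fin: "finite I'" "card J < card I'"
      using insert k by (auto simp: I'_def)
    from insert.IH[OF this, of B] obtain t where
      t: "\<exists>i\<in>I'. t i \<noteq> 0" "\<forall>m\<in>J. (\<Sum>i\<in>I'. B i m * t i) = 0" by auto
    define s where "s = - (\<Sum>i\<in>I'. A i j * t i) / A k j"
    define u where "u = t(k := s)"
    have I: "I = insert k I'" "k \<notin> I'" using k by (auto simp: I'_def)
    have sum: "(\<Sum>i\<in>I. A i m * u i) = (\<Sum>i\<in>I'. A i m * t i) + A k m * s" for m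
    proof -
      have "(\<Sum>i\<in>I'. A i m * u i) = (\<Sum>i\<in>I'. A i m * t i)"
        using I by (intro sum.cong) (auto simp: u_def)
      then show ?thesis using I fin by (simp add: u_def)
    qed
    have "(\<Sum>i\<in>I. A i j * u i) = 0"
      unfolding sum using k by (simp add: s_def)
    moreover have "(\<Sum>i\<in>I. A i m * u i) = 0" if "m \<in> J" for m
    proof -
      have "0 = (\<Sum>i\<in>I'. B i m * t i)" using t that by auto
      also have "\<dots> = (\<Sum>i\<in>I'. A i m * t i) + A k m * s"
        by (simp add: B_def s_def algebra_simps sum_subtractf sum_distrib_left sum_divide_distrib)
      finally show ?thesis by (simp add: sum)
    qed
    moreover have "\<exists>i\<in>I. u i \<noteq> 0"
      using t I by (auto simp: u_def)
    ultimately show ?thesis by (intro exI[of _ u]) auto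
  qed
qed

text \<open>Additivity of the q-th power together with q = 0 in the field express that q is a
  positive power of the characteristic.\<close>

locale frobenius =
  fixes q :: nat and fr :: "'b::alg_closed_field \<Rightarrow> 'b"
  assumes q_gt_1: "q > 1"
    and fr_def: "fr = (\<lambda>x. x ^ q)"
    and fr_add: "fr (x + y) = fr x + fr y"
    and of_nat_q: "of_nat q = (0::'b)"
begin

lemma power_q_add: "((x::'b) + y) ^ q = x ^ q + y ^ q"
  using fr_add[of x y] by (simp add: fr_def)

lemma power_qk_add: "((x::'b) + y) ^ (q ^ k) = x ^ (q ^ k) + y ^ (q ^ k)"
  by (induction k) (simp_all add: power_mult power_q_add mult.commute[of q])

lemma power_qk_sum: "(\<Sum>i\<in>A. f i :: 'b) ^ (q ^ k) = (\<Sum>i\<in>A. f i ^ (q ^ k))"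
  using q_gt_1 by (induction A rule: infinite_finite_induct) (simp_all add: power_qk_add)

lemma power_qk_minus: "(- (x::'b)) ^ (q ^ k) = - (x ^ (q ^ k))"
proof -
  have "0 = (x + - x) ^ (q ^ k)" using q_gt_1 by simp
  also have "\<dots> = x ^ (q ^ k) + (- x) ^ (q ^ k)" by (rule power_qk_add)
  finally show ?thesis by (simp add: eq_neg_iff_add_eq_0 add.commute)
qed

lemma power_qk_diff: "((x::'b) - y) ^ (q ^ k) = x ^ (q ^ k) - y ^ (q ^ k)"
  using power_qk_add[of x "-y" k] by (simp add: power_qk_minus)

lemma power_qk_inj: "(x::'b) ^ (q ^ k) = y ^ (q ^ k) \<longleftrightarrow> x = y"
proof
  assume "x ^ (q ^ k) = y ^ (q ^ k)"
  then have "(x - y) ^ (q ^ k) = 0" by (simp add: power_qk_diff)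
  then show "x = y" by simp
qed auto

end

section \<open>Weights, reduced exponents and the semigroup of pole orders\<close>

locale frobenius_curve = frobenius q fr for q :: nat and fr :: "'b::alg_closed_field \<Rightarrow> 'b" +
  fixes l :: nat
  assumes l_ge_1: "l \<ge> 1"
begin

text \<open>The orders of the poles of the coordinates at the unique point at infinity of the curve below.\<close>
definition weight :: "nat \<Rightarrow> nat" where
  "weight i = (\<Sum>j<i. q ^ (l - 1 - j))"

definition wt :: "(nat \<Rightarrow> nat) \<Rightarrow> nat" where
  "wt b = (\<Sum>i=1..l. b i * weight i)"

definition mon :: "(nat \<Rightarrow> nat) \<Rightarrow> 'b fps \<Rightarrow> 'b" where
  "mon b Y = (\<Prod>i=1..l. (Y $ i) ^ b i)"

text \<open>The Lang torsor \<open>Y\<^sup>(\<^sup>q\<^sup>) = Y (1 - x z)\<close> in \<open>1 + z K[z]/(z\<^sup>l\<^sup>+\<^sup>1)\<close>: the equation for \<open>i = 1\<close> gives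
  \<open>x = Y\<^sub>1 - Y\<^sub>1\<^sup>q\<close>.\<close>
definition curve :: "'b fps set" where
  "curve = {Y. Y $ 0 = 1 \<and> (\<forall>i>l. Y $ i = 0) \<and>
     (\<forall>i\<in>{1..l}. (Y $ i) ^ q = Y $ i - (Y $ 1 - (Y $ 1) ^ q) * Y $ (i - 1))}"

text \<open>The semigroup generated by the weights. Its number of gaps,
  \<open>card (- semi)\<close>, takes the place of the genus in the estimates.\<close>

definition semi :: "nat set" where "semi = range wt"

text \<open>Reduced exponents are the normal forms modulo the relations of the curve; their weights are
  pairwise distinct.\<close>
definition reduced :: "(nat \<Rightarrow> nat) \<Rightarrow> bool" where
  "reduced b \<longleftrightarrow> (\<forall>i\<in>{2..l}. b i < q) \<and> (\<forall>i. i \<notin> {1..l} \<longrightarrow> b i = 0)"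

lemma weight_1: "weight 1 = q ^ (l - 1)" by (simp add: weight_def)

lemma weight_Suc: "weight (Suc i) = weight i + q ^ (l - 1 - i)" by (simp add: weight_def)

lemma weight_less: "i < j \<Longrightarrow> weight i < weight j"
proof (induction j)
  case (Suc j)
  have "weight j < weight (Suc j)" using q_gt_1 by (simp add: weight_Suc)
  with Suc show ?case by (cases "i = j") auto
qed simp

lemma weight_0: "weight 0 = 0" by (simp add: weight_def)

text \<open>This makes the weights fit the curve: in the i-th equation Y_i^q and Y_1^q Y_(i-1) have
  equal order.\<close>

lemma weight_q:
  assumes "2 \<le> i" "i \<le> l"
  shows "q * weight i = q * weight 1 + weight (i - 1)"
proof -
  obtain k where k: "i = Suc (Suc k)" by (rule that[of "i - 2"]) (use assms in simp)
  have "q * weight i = (\<Sum>j<Suc (Suc k). q * q ^ (l - 1 - j))"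
    unfolding weight_def k by (rule sum_distrib_left)
  also have "\<dots> = q * q ^ (l - 1) + (\<Sum>j<Suc k. q * q ^ (l - 1 - Suc j))"
    by (subst sum.lessThan_Suc_shift) (simp only: diff_zero)
  also have "(\<Sum>j<Suc k. q * q ^ (l - 1 - Suc j)) = (\<Sum>j<Suc k. q ^ (l - 1 - j))"
  proof (rule sum.cong)
    fix j assume "j \<in> {..<Suc k}"
    then have "l - 1 - j = Suc (l - 1 - Suc j)" using assms k by auto
    then show "q * q ^ (l - 1 - Suc j) = q ^ (l - 1 - j)" by simp
  qed simp
  also have "\<dots> = weight (i - 1)" by (simp add: weight_def k)
  also have "q ^ (l - 1) = weight 1" by (simp add: weight_def)
  finally show ?thesis .
qed

lemma wt_add: "wt (\<lambda>i. b i + b' i) = wt b + wt b'"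
  by (simp add: wt_def algebra_simps sum.distrib)

lemma wt_mult: "wt (\<lambda>i. n * b i) = n * wt b"
  by (simp add: wt_def algebra_simps sum_distrib_left)

lemma mon_add: "mon (\<lambda>i. b i + b' i) Y = mon b Y * mon b' Y"
  by (simp add: mon_def power_add prod.distrib)

lemma mon_mult: "mon (\<lambda>i. n * b i) Y = mon b Y ^ n"
  unfolding mon_def prod_power_distrib
  by (intro prod.cong refl) (metis mult.commute power_mult)

lemma mon_cong: "(\<And>i. i \<in> {1..l} \<Longrightarrow> b i = b' i) \<Longrightarrow> mon b = mon b'"
  by (simp add: mon_def fun_eq_iff)

lemma wt_cong: "(\<And>i. i \<in> {1..l} \<Longrightarrow> b i = b' i) \<Longrightarrow> wt b = wt b'"
  unfolding wt_def by (intro sum.cong) auto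

definition single :: "nat \<Rightarrow> nat \<Rightarrow> nat" where "single i = (\<lambda>j. if j = i then 1 else 0)"

lemma wt_single: "i \<in> {1..l} \<Longrightarrow> wt (single i) = weight i"
  by (simp add: wt_def single_def if_distrib[of "\<lambda>x. x * _"] sum.delta cong: if_cong)

lemma mon_single: "i \<in> {1..l} \<Longrightarrow> mon (single i) Y = Y $ i"
  by (simp add: mon_def single_def if_distrib[of "\<lambda>x. _ ^ x"] prod.delta cong: if_cong)

lemma wt_zero: "wt (\<lambda>_. 0) = 0" by (simp add: wt_def)
lemma mon_zero: "mon (\<lambda>_. 0) Y = 1" by (simp add: mon_def)

lemma semi_add: "m \<in> semi \<Longrightarrow> n \<in> semi \<Longrightarrow> m + n \<in> semi"
  unfolding semi_def by (auto simp flip: wt_add)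

lemma semi_mult: "m \<in> semi \<Longrightarrow> n * m \<in> semi"
  unfolding semi_def by (auto simp flip: wt_mult)

lemma weight_in_semi: "i \<in> {1..l} \<Longrightarrow> weight i \<in> semi"
  unfolding semi_def using wt_single[of i] by (metis rangeI)

lemma weight_dvd:
  assumes "i < j" "j \<le> l"
  shows "q ^ (l - j + 1) dvd weight i"
  unfolding weight_def using assms by (intro dvd_sum le_imp_power_dvd) auto

text \<open>The exact power of q in \<open>weight i\<close>. By \<open>weight_dvd\<close> the
  weights of smaller index contain a higher power, so the exponents can be compared like
  digits.\<close>

lemma weight_factor:
  assumes "1 \<le> i" "i \<le> l"
  shows "\<exists>v. coprime v q \<and> weight i = q ^ (l - i) * v"
proof -
  obtain k where k: "i = Suc k" using assms(1) by (cases i) auto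
  have "q ^ (l - i + 1) dvd weight k" using weight_dvd[of k i] assms k by simp
  then obtain u where u: "weight k = q ^ (l - i + 1) * u" by auto
  have "weight i = q ^ (l - i) * (q * u + 1)"
    using k u weight_Suc[of k] by (simp add: algebra_simps)
  moreover have "coprime (q * u + 1) q"
    proof (rule coprimeI)
      fix c assume "c dvd q * u + 1" "c dvd q"
      then show "is_unit c" using dvd_add_right_iff[of c "q * u" 1] by (metis dvd_mult2)
    qed
  ultimately show ?thesis by blast
qed

text \<open>Compare at the largest index i where the exponents differ. Modulo q^(l-i+1) the smaller
  indices drop out, so the two exponents at i agree modulo q; for i \<ge> 2 both are below q, and
  for i = 1 no other term is left.\<close>

lemma reduced_wt_inj:
  assumes "reduced b" "reduced b'" "wt b = wt b'"
  shows "b = b'"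
proof (rule ccontr)
  assume "b \<noteq> b'"
  define D where "D = {i. b i \<noteq> b' i}"
  have D: "D \<subseteq> {1..l}" using assms unfolding D_def reduced_def by force
  have ne: "D \<noteq> {}" using \<open>b \<noteq> b'\<close> by (auto simp: D_def)
  have fin: "finite D" using D finite_subset by blast
  define i where "i = Max D"
  have iD: "i \<in> D" and iM: "\<And>j. j > i \<Longrightarrow> b j = b' j"
    using Max_in[OF fin ne] Max_ge[OF fin] unfolding i_def by (auto simp: D_def, force)
  have il: "1 \<le> i" "i \<le> l" using D iD by auto
  have split: "wt c = (\<Sum>j=1..<i. c j * weight j) + c i * weight i + (\<Sum>j=Suc i..l. c j * weight j)" for c
  proof -
    have "{1..l} = {1..<i} \<union> {i} \<union> {Suc i..l}" using il by auto
    then have "wt c = (\<Sum>j\<in>{1..<i} \<union> {i} \<union> {Suc i..l}. c j * weight j)" by (simp add: wt_def)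
    also have "\<dots> = (\<Sum>j=1..<i. c j * weight j) + c i * weight i + (\<Sum>j=Suc i..l. c j * weight j)"
      by (subst sum.union_disjoint, force, force, force, subst sum.union_disjoint) auto
    finally show ?thesis .
  qed
  have "(\<Sum>j=Suc i..l. b j * weight j) = (\<Sum>j=Suc i..l. b' j * weight j)"
    using iM by (intro sum.cong) auto
  with assms(3) have eq: "(\<Sum>j=1..<i. b j * weight j) + b i * weight i
     = (\<Sum>j=1..<i. b' j * weight j) + b' i * weight i" using split[of b] split[of b'] by simp
  have w0: "weight i > 0" using weight_less[of 0 i] il by (simp add: weight_0)
  show False
  proof (cases "i = 1")
    case True
    with eq w0 have "b i = b' i" by simp
    then show False using iD by (simp add: D_def)
  next
    case False
    with il assms have bi: "b i < q" "b' i < q" by (auto simp: reduced_def)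
    have dv: "q ^ (l - i + 1) dvd (\<Sum>j=1..<i. c j * weight j)" for c
      using il by (intro dvd_sum dvd_mult weight_dvd) auto
    obtain v where v: "coprime v q" "weight i = q ^ (l - i) * v" using weight_factor il by blast
    have "int (q ^ (l - i + 1)) dvd (int (b i) - int (b' i)) * int (weight i)"
    proof -
      have "(int (b i) - int (b' i)) * int (weight i) =
        int (\<Sum>j=1..<i. b' j * weight j) - int (\<Sum>j=1..<i. b j * weight j)"
        using arg_cong[OF eq, of int] by (simp add: algebra_simps)
      also have "int (q ^ (l - i + 1)) dvd \<dots>"
        using dv[of b] dv[of b'] by (intro dvd_diff) (simp_all only: int_dvd_int_iff)
      finally show ?thesis .
    qed
    then have "int (q ^ (l - i)) * int q dvd int (q ^ (l - i)) * ((int (b i) - int (b' i)) * int v)"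
      by (simp add: v(2) algebra_simps)
    then have "int q dvd (int (b i) - int (b' i)) * int v" using q_gt_1 by simp
    then have "int q dvd (int (b i) - int (b' i))"
      using v(1) by (simp add: coprime_dvd_mult_left_iff coprime_commute)
    moreover have "\<bar>int (b i) - int (b' i)\<bar> < int q" using bi by auto
    ultimately have "int (b i) - int (b' i) = 0"
      using dvd_imp_le_int [of "int (b i) - int (b' i)" "int q"] by linarith
    then show False using iD by (simp add: D_def)
  qed
qed

text \<open>\<open>weight 1\<close> is a power of q and \<open>weight l\<close> is prime to q, so
  these two alone generate all large numbers.\<close>

lemma semi_cofinite: "finite (- semi)"
proof -
  define u v where "u = weight 1" and "v = weight l"
  have S: "u \<in> semi" "v \<in> semi" using weight_in_semi l_ge_1 by (auto simp: u_def v_def)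
  obtain w where "coprime w q" "v = q ^ (l - l) * w"
    using weight_factor[of l] l_ge_1 v_def by blast
  then have cop: "coprime v u" unfolding u_def weight_1 by (simp add: coprime_commute)
  have "n \<in> semi" if n: "n \<ge> u * v" for n
  proof -
    have u0: "u > 0" using q_gt_1 unfolding u_def weight_1 by simp
    obtain y where y: "[v * y = n] (mod u)"
    proof -
      obtain y0 where "[v * y0 = Suc 0] (mod u)" using cong_solve_coprime_nat[OF cop] by blast
      from cong_scalar_right[OF this, of n] have "[v * (y0 * n) = n] (mod u)" by (simp add: mult.assoc)
      then show ?thesis using that by blast
    qed
    define x where "x = y mod u"
    have x: "[v * x = n] (mod u)" "x < u"
      using y u0 by (auto simp: x_def cong_def mod_mult_right_eq)
    have "v * x \<le> u * v" using x(2) by (simp add: mult.commute)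
    with n have "v * x \<le> n" by (rule order_trans[rotated])
    from cong_altdef_nat[OF this, THEN iffD1, OF cong_sym[OF x(1)]] have "u dvd n - v * x" .
    then obtain t where "n - v * x = u * t" by auto
    then have "n = x * v + t * u" using \<open>v * x \<le> n\<close> by (simp add: algebra_simps)
    then show ?thesis using semi_add[OF semi_mult[OF S(2), of x] semi_mult[OF S(1), of t]] by simp
  qed
  then have "- semi \<subseteq> {..<u * v}" by (metis ComplD lessThan_iff not_less subsetI)
  then show ?thesis by (rule finite_subset) simp
qed

end

lemma sum_scaled_product:
  fixes f g :: "_ \<Rightarrow> 'a::comm_semiring_0"
  shows "(\<Sum>i\<in>A. c i * f i) * (\<Sum>j\<in>B. d j * g j) = (\<Sum>i\<in>A. \<Sum>j\<in>B. c i * (d j * (f i * g j)))"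
  by (simp add: sum_product mult_ac)

section \<open>Orders and leading terms of functions on the curve\<close>

context frobenius_curve
begin

text \<open>The normal form of order d. Reduced exponents of given weight are unique by
  \<open>reduced_wt_inj\<close>, and the rewriting in \<open>mon_lead\<close> reaches one for every
  weight in \<open>semi\<close>.\<close>

definition basis :: "nat \<Rightarrow> 'b fps \<Rightarrow> 'b" where
  "basis d = mon (THE b. reduced b \<and> wt b = d)"

text \<open>The functions whose pole at infinity has order less than \<open>m\<close>.\<close>
definition lower :: "nat \<Rightarrow> ('b fps \<Rightarrow> 'b) \<Rightarrow> bool" where
  "lower m f \<longleftrightarrow> (\<exists>c. \<forall>Y\<in>curve. f Y = (\<Sum>d\<in>semi \<inter> {..<m}. c d * basis d Y))"

lemma basis_reduced: "reduced b \<Longrightarrow> basis (wt b) = mon b"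
  unfolding basis_def by (rule arg_cong[of _ _ mon], rule the_equality) (auto intro: reduced_wt_inj)

lemma lower_zero: "lower m (\<lambda>_. 0)"
  unfolding lower_def by (rule exI[of _ "\<lambda>_. 0"]) simp

lemma lower_add: "lower m f \<Longrightarrow> lower m g \<Longrightarrow> lower m (\<lambda>Y. f Y + g Y)"
proof -
  assume "lower m f" "lower m g"
  then obtain c c' where "\<forall>Y\<in>curve. f Y = (\<Sum>d\<in>semi \<inter> {..<m}. c d * basis d Y)"
    "\<forall>Y\<in>curve. g Y = (\<Sum>d\<in>semi \<inter> {..<m}. c' d * basis d Y)" unfolding lower_def by blast
  then show ?thesis unfolding lower_def
    by (intro exI[of _ "\<lambda>d. c d + c' d"]) (auto simp: algebra_simps sum.distrib)
qed

lemma lower_scale: "lower m f \<Longrightarrow> lower m (\<lambda>Y. a * f Y)"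
proof -
  assume "lower m f"
  then obtain c where "\<forall>Y\<in>curve. f Y = (\<Sum>d\<in>semi \<inter> {..<m}. c d * basis d Y)"
    unfolding lower_def by blast
  then show ?thesis unfolding lower_def
    by (intro exI[of _ "\<lambda>d. a * c d"]) (auto simp: algebra_simps sum_distrib_left)
qed

lemma lower_mono: "lower m f \<Longrightarrow> m \<le> n \<Longrightarrow> lower n f"
proof -
  assume "lower m f" and mn: "m \<le> n"
  then obtain c where c: "\<forall>Y\<in>curve. f Y = (\<Sum>d\<in>semi \<inter> {..<m}. c d * basis d Y)"
    unfolding lower_def by blast
  have "(\<Sum>d\<in>semi \<inter> {..<n}. (if d < m then c d else 0) * basis d Y)
      = (\<Sum>d\<in>semi \<inter> {..<m}. c d * basis d Y)" for Y
    using mn by (intro sum.mono_neutral_cong_right) auto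
  with c show ?thesis unfolding lower_def
    by (intro exI[of _ "\<lambda>d. if d < m then c d else 0"]) auto
qed

lemma lower_cong: "(\<And>Y. Y \<in> curve \<Longrightarrow> f Y = g Y) \<Longrightarrow> lower m f \<longleftrightarrow> lower m g"
  unfolding lower_def by simp

lemma lower_basis: "d \<in> semi \<Longrightarrow> d < m \<Longrightarrow> lower m (basis d)"
  unfolding lower_def
  by (rule exI[of _ "\<lambda>i. if i = d then 1 else 0"]) (simp add: if_distrib[of "\<lambda>x. x * _"] sum.delta cong: if_cong)

lemma lower_sum: "(\<And>i. i \<in> A \<Longrightarrow> lower m (f i)) \<Longrightarrow> lower m (\<lambda>Y. \<Sum>i\<in>A. f i Y)"
  by (induction A rule: infinite_finite_induct) (auto intro: lower_zero lower_add)

lemma lower_diff: "lower m f \<Longrightarrow> lower m g \<Longrightarrow> lower m (\<lambda>Y. f Y - g Y)"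
  using lower_add[OF _ lower_scale[of m g "-1"], of f] by simp

lemma curve_relation:
  assumes "Y \<in> curve" "2 \<le> i" "i \<le> l"
  shows "(Y $ i) ^ q = Y $ i + (Y $ 1) ^ q * Y $ (i - 1) - Y $ 1 * Y $ (i - 1)"
  using assms unfolding curve_def by (auto simp: algebra_simps)

text \<open>The relation replaces \<open>y\<^sub>i\<^sup>q\<close> by \<open>y\<^sub>1\<^sup>q y\<^sub>i\<^sub>-\<^sub>1\<close>, of the same weight but with smaller \<open>\<Sum>i * b i\<close>, up to
  terms of smaller weight.\<close>
lemma mon_lead: "lower (wt b) (\<lambda>Y. mon b Y - basis (wt b) Y)"
proof (induction "(wt b, \<Sum>i=1..l. i * b i)" arbitrary: b rule: wf_induct[OF wf_lex_prod[OF wf_less_than wf_less_than]])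
  case (1 b)
  have IH: "lower (wt b') (\<lambda>Y. mon b' Y - basis (wt b') Y)"
    if "wt b' < wt b \<or> wt b' = wt b \<and> (\<Sum>i=1..l. i * b' i) < (\<Sum>i=1..l. i * b i)" for b'
    by (rule 1[rule_format, OF _ refl]) (use that in auto)
  have IHlow: "lower (wt b) (mon b')" if "wt b' < wt b" for b'
  proof -
    have "lower (wt b) (\<lambda>Y. (mon b' Y - basis (wt b') Y) + basis (wt b') Y)"
      using that by (intro lower_add lower_mono[OF IH] lower_basis) (auto simp: semi_def)
    then show ?thesis by simp
  qed
  show ?case
  proof (cases "\<exists>i\<in>{2..l}. b i \<ge> q")
    case True
    then obtain i where i: "2 \<le> i" "i \<le> l" "b i \<ge> q" by auto
    \<comment> \<open>The relation replaces y_i^q, leaving the monomial of \<open>b0\<close> times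
      y_i, y_1^q y_(i-1) or y_1 y_(i-1); these are \<open>b1\<close>, \<open>b2\<close> and
      \<open>b3\<close>, and only \<open>b2\<close> keeps the weight.\<close>
    define b0 where "b0 = b(i := b i - q)"
    define b1 where "b1 = (\<lambda>j. b0 j + single i j)"
    define b2 where "b2 = (\<lambda>j. b0 j + (q * single 1 j + single (i - 1) j))"
    define b3 where "b3 = (\<lambda>j. b0 j + (single 1 j + single (i - 1) j))"
    have in_l: "i \<in> {1..l}" "1 \<in> {1..l}" "i - 1 \<in> {1..l}" using i by auto
    have b: "b = (\<lambda>j. b0 j + q * single i j)" using i by (auto simp: b0_def single_def)
    have wtb: "wt b = wt b0 + q * weight i"
      by (subst b) (simp only: wt_add wt_mult wt_single[OF in_l(1)])
    have wt1: "wt b1 = wt b0 + weight i" by (simp only: b1_def wt_add wt_single[OF in_l(1)])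
    have wt2: "wt b2 = wt b0 + (q * weight 1 + weight (i - 1))"
      by (simp only: b2_def wt_add wt_mult wt_single[OF in_l(2)] wt_single[OF in_l(3)])
    have wt3: "wt b3 = wt b0 + (weight 1 + weight (i - 1))"
      by (simp only: b3_def wt_add wt_single[OF in_l(2)] wt_single[OF in_l(3)])
    have pos: "weight i > 0" "weight 1 > 0" using weight_less[of 0 i] weight_less[of 0 1] i by (auto simp: weight_0)
    have "wt b1 < wt b" unfolding wtb wt1 using pos q_gt_1 by simp
    moreover have eq2: "wt b2 = wt b" unfolding wtb wt2 weight_q[OF i(1,2)] by simp
    moreover have "wt b3 < wt b" unfolding eq2[symmetric] wt2 wt3 using pos q_gt_1 by simp
    moreover have "(\<Sum>j=1..l. j * b2 j) < (\<Sum>j=1..l. j * b j)"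
    proof -
      have s: "(\<Sum>j=1..l. j * single k j) = k" if "k \<in> {1..l}" for k
        using that by (simp add: single_def if_distrib[of "\<lambda>x. _ * x"] sum.delta cong: if_cong)
      have "(\<Sum>j=1..l. j * b2 j) = (\<Sum>j=1..l. j * b0 j) + (q * (\<Sum>j=1..l. j * single 1 j) + (\<Sum>j=1..l. j * single (i-1) j))"
        by (simp only: b2_def distrib_left sum.distrib sum_distrib_left mult.left_commute)
      also have "\<dots> = (\<Sum>j=1..l. j * b0 j) + (q * 1 + (i - 1))" using s in_l by metis
      also have "q * 1 + (i - 1) < q * i"
      proof -
        obtain k where k: "i = Suc (Suc k)" using i(1) by (rule_tac that[of "i - 2"]) simp
        have "Suc k < q * Suc k" using mult_less_mono1[OF q_gt_1, of "Suc k"] by simp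
        then show ?thesis by (simp add: k)
      qed
      also have "(\<Sum>j=1..l. j * b0 j) + q * i = (\<Sum>j=1..l. j * b0 j) + q * (\<Sum>j=1..l. j * single i j)"
        using s in_l by metis
      also have "\<dots> = (\<Sum>j=1..l. j * b j)"
        by (subst b) (simp only: distrib_left sum.distrib sum_distrib_left mult.left_commute)
      finally show ?thesis by simp
    qed
    ultimately have L: "lower (wt b) (mon b1)" "lower (wt b) (mon b3)"
      "lower (wt b) (\<lambda>Y. mon b2 Y - basis (wt b) Y)" using IHlow IH[of b2] by auto
    have "lower (wt b) (\<lambda>Y. mon b1 Y - mon b3 Y + (mon b2 Y - basis (wt b) Y))"
      by (intro lower_add lower_diff L)
    then show ?thesis
    proof (rule lower_cong[THEN iffD1, rotated])
      fix Y assume Y: "Y \<in> curve"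
      have "mon b Y = mon b0 Y * (Y $ i) ^ q"
        by (subst b) (simp only: mon_add mon_mult mon_single[OF in_l(1)])
      also have "\<dots> = mon b1 Y - mon b3 Y + mon b2 Y"
        unfolding curve_relation[OF Y i(1,2)] b1_def b2_def b3_def
        by (simp only: mon_add mon_mult mon_single[OF in_l(1)] mon_single[OF in_l(2)] mon_single[OF in_l(3)])
          (simp add: algebra_simps)
      finally show "mon b1 Y - mon b3 Y + (mon b2 Y - basis (wt b) Y) = mon b Y - basis (wt b) Y" by simp
    qed
  next
    case False
    \<comment> \<open>Entries outside 1..l do not affect the function but must be 0 in a reduced
      exponent.\<close>
    define b' where "b' = (\<lambda>i. if i \<in> {1..l} then b i else 0)"
    have "reduced b'" using False by (auto simp: reduced_def b'_def)
    moreover have "wt b' = wt b" "mon b' = mon b"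
      by (auto intro: wt_cong mon_cong simp: b'_def)
    ultimately have "basis (wt b) = mon b" using basis_reduced by metis
    then show ?thesis using lower_zero by simp
  qed
qed

lemma basis_eq_mon:
  assumes "d \<in> semi"
  shows "\<exists>b. wt b = d \<and> lower d (\<lambda>Y. basis d Y - mon b Y)"
proof -
  obtain b where "wt b = d" using assms by (auto simp: semi_def)
  then show ?thesis using mon_lead[of b] lower_scale[OF mon_lead[of b], of "-1"] by auto
qed

text \<open>For monomials the product is again a monomial and \<open>mon_lead\<close> applies. The
  corrections are products of basis functions of smaller total order, covered by the induction
  hypothesis.\<close>

lemma basis_mult:
  assumes "d \<in> semi" "d' \<in> semi"
  shows "lower (d + d') (\<lambda>Y. basis d Y * basis d' Y - basis (d + d') Y)"
  using assms
proof (induction "d + d'" arbitrary: d d' rule: less_induct)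
  case less
  have low: "lower (d + d') (\<lambda>Y. basis i Y * basis j Y)" if ij: "i \<in> semi" "j \<in> semi" "i + j < d + d'" for i j
  proof -
    have "lower (d + d') (\<lambda>Y. (basis i Y * basis j Y - basis (i + j) Y) + basis (i + j) Y)"
      using ij less(1)[of i j] by (intro lower_add lower_basis) (auto intro: semi_add lower_mono)
    then show ?thesis by simp
  qed
  obtain b where b: "wt b = d" "lower d (\<lambda>Y. basis d Y - mon b Y)" using basis_eq_mon less by blast
  obtain b' where b': "wt b' = d'" "lower d' (\<lambda>Y. basis d' Y - mon b' Y)" using basis_eq_mon less by blast
  from b(2) b'(2) obtain c c' where
    c: "\<And>Y. Y \<in> curve \<Longrightarrow> basis d Y - mon b Y = (\<Sum>i\<in>semi \<inter> {..<d}. c i * basis i Y)" and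
    c': "\<And>Y. Y \<in> curve \<Longrightarrow> basis d' Y - mon b' Y = (\<Sum>i\<in>semi \<inter> {..<d'}. c' i * basis i Y)"
    unfolding lower_def by blast
  have 1: "lower (d + d') (\<lambda>Y. (\<Sum>i\<in>semi \<inter> {..<d}. c i * (basis i Y * basis d' Y)))"
    using less.prems by (intro lower_sum lower_scale low) auto
  have 2: "lower (d + d') (\<lambda>Y. (\<Sum>i\<in>semi \<inter> {..<d'}. c' i * (basis d Y * basis i Y)))"
    using less.prems by (intro lower_sum lower_scale low) auto
  have 3: "lower (d + d') (\<lambda>Y. (\<Sum>i\<in>semi \<inter> {..<d}. \<Sum>j\<in>semi \<inter> {..<d'}. c i * (c' j * (basis i Y * basis j Y))))"
    using less.prems by (intro lower_sum lower_scale low) auto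
  have 4: "lower (d + d') (\<lambda>Y. mon (\<lambda>i. b i + b' i) Y - basis (d + d') Y)"
    using mon_lead[of "\<lambda>i. b i + b' i"] by (simp add: wt_add b b')
  have "lower (d + d') (\<lambda>Y. (mon (\<lambda>i. b i + b' i) Y - basis (d + d') Y)
     + ((\<Sum>i\<in>semi \<inter> {..<d}. c i * (basis i Y * basis d' Y))
     + ((\<Sum>i\<in>semi \<inter> {..<d'}. c' i * (basis d Y * basis i Y))
     - (\<Sum>i\<in>semi \<inter> {..<d}. \<Sum>j\<in>semi \<inter> {..<d'}. c i * (c' j * (basis i Y * basis j Y))))))"
    by (intro lower_add lower_diff 1 2 3 4)
  then show ?case
  proof (rule lower_cong[THEN iffD1, rotated])
    fix Y assume Y: "Y \<in> curve"
    have A1: "(\<Sum>i\<in>semi \<inter> {..<d}. c i * (basis i Y * basis d' Y)) = (basis d Y - mon b Y) * basis d' Y"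
      by (simp add: c[OF Y] sum_distrib_right mult.assoc)
    have A2: "(\<Sum>i\<in>semi \<inter> {..<d'}. c' i * (basis d Y * basis i Y)) = basis d Y * (basis d' Y - mon b' Y)"
      by (simp add: c'[OF Y] sum_distrib_left mult.left_commute)
    have A3: "(\<Sum>i\<in>semi \<inter> {..<d}. \<Sum>j\<in>semi \<inter> {..<d'}. c i * (c' j * (basis i Y * basis j Y)))
       = (basis d Y - mon b Y) * (basis d' Y - mon b' Y)"
      by (simp add: c[OF Y] c'[OF Y] sum_scaled_product)
    show "(mon (\<lambda>i. b i + b' i) Y - basis (d + d') Y)
     + ((\<Sum>i\<in>semi \<inter> {..<d}. c i * (basis i Y * basis d' Y))
     + ((\<Sum>i\<in>semi \<inter> {..<d'}. c' i * (basis d Y * basis i Y))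
     - (\<Sum>i\<in>semi \<inter> {..<d}. \<Sum>j\<in>semi \<inter> {..<d'}. c i * (c' j * (basis i Y * basis j Y)))))
     = basis d Y * basis d' Y - basis (d + d') Y"
      unfolding A1 A2 A3 mon_add by (simp add: algebra_simps)
  qed
qed

text \<open>A pole of order \<open>m\<close> with leading coefficient \<open>a\<close>; note that \<open>a = 0\<close> is not excluded.\<close>
definition leads :: "nat \<Rightarrow> 'b \<Rightarrow> ('b fps \<Rightarrow> 'b) \<Rightarrow> bool" where
  "leads m a f \<longleftrightarrow> m \<in> semi \<and> lower m (\<lambda>Y. f Y - a * basis m Y)"

lemma leads_mon: "leads (wt b) 1 (mon b)"
  using mon_lead[of b] by (simp add: leads_def semi_def)

lemma leads_lower: "leads m a f \<Longrightarrow> m < n \<Longrightarrow> lower n f"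
  using lower_add[OF lower_mono[of m _ n] lower_scale[OF lower_basis[of m n]], of "\<lambda>Y. f Y - a * basis m Y" a]
  by (simp add: leads_def)

lemma leads_add_lower: "leads m a f \<Longrightarrow> lower m g \<Longrightarrow> leads m a (\<lambda>Y. f Y + g Y)"
  using lower_add[of m "\<lambda>Y. f Y - a * basis m Y" g] by (simp add: leads_def algebra_simps)

lemma leads_scale: "leads m a f \<Longrightarrow> leads m (c * a) (\<lambda>Y. c * f Y)"
  using lower_scale[of m "\<lambda>Y. f Y - a * basis m Y" c] by (simp add: leads_def algebra_simps)

lemma leads_basis: "m \<in> semi \<Longrightarrow> leads m 1 (basis m)"
  by (simp add: leads_def lower_zero)

text \<open>Orders below m and below n add up to at most m + n - 2.\<close>

lemma lower_mult:
  assumes "lower m f" "lower n g"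
  shows "lower (m + n - 1) (\<lambda>Y. f Y * g Y)"
proof -
  from assms obtain c c' where
    c: "\<And>Y. Y \<in> curve \<Longrightarrow> f Y = (\<Sum>i\<in>semi \<inter> {..<m}. c i * basis i Y)" and
    c': "\<And>Y. Y \<in> curve \<Longrightarrow> g Y = (\<Sum>i\<in>semi \<inter> {..<n}. c' i * basis i Y)"
    unfolding lower_def by blast
  have low: "lower (m + n - 1) (\<lambda>Y. basis i Y * basis j Y)" if ij: "i \<in> semi" "j \<in> semi" "i < m" "j < n" for i j
  proof -
    have "lower (m + n - 1) (\<lambda>Y. (basis i Y * basis j Y - basis (i + j) Y) + basis (i + j) Y)"
      using ij basis_mult[of i j] by (intro lower_add lower_basis) (auto intro: semi_add lower_mono)
    then show ?thesis by simp
  qed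
  have "lower (m + n - 1) (\<lambda>Y. (\<Sum>i\<in>semi \<inter> {..<m}. \<Sum>j\<in>semi \<inter> {..<n}. c i * (c' j * (basis i Y * basis j Y))))"
    by (intro lower_sum lower_scale low) auto
  then show ?thesis
    by (rule lower_cong[THEN iffD1, rotated]) (simp add: c c' sum_scaled_product)
qed

lemma leads_mult:
  assumes f: "leads m a f" and g: "leads n b g"
  shows "leads (m + n) (a * b) (\<lambda>Y. f Y * g Y)"
proof -
  have S: "m \<in> semi" "n \<in> semi" using f g by (auto simp: leads_def)
  have lf: "lower m (\<lambda>Y. f Y - a * basis m Y)" and lg: "lower n (\<lambda>Y. g Y - b * basis n Y)"
    using f g by (auto simp: leads_def)
  have 1: "lower (m + n) (\<lambda>Y. (f Y - a * basis m Y) * g Y)"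
    using lower_mult[OF lf leads_lower[OF g, of "Suc n"]] by simp
  have 2: "lower (m + n) (\<lambda>Y. (a * basis m Y) * (g Y - b * basis n Y))"
    using lower_mult[OF lower_scale[OF lower_basis[of m "Suc m"], of a] lg] S by simp
  have 3: "lower (m + n) (\<lambda>Y. (a * b) * (basis m Y * basis n Y - basis (m + n) Y))"
    by (intro lower_scale basis_mult S)
  from lower_add[OF 1 lower_add[OF 2 3]] show ?thesis
    using S by (simp add: leads_def semi_add algebra_simps)
qed

lemma leads_one: "leads 0 1 (\<lambda>_. 1)"
  using leads_mon[of "\<lambda>_. 0"] by (simp add: wt_zero mon_zero[abs_def])

lemma leads_power: "leads m a f \<Longrightarrow> leads (n * m) (a ^ n) (\<lambda>Y. f Y ^ n)"
  by (induction n) (auto intro: leads_one leads_mult)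

lemma leads_prod:
  "(\<And>i. i \<in> A \<Longrightarrow> leads (m i) (a i) (f i)) \<Longrightarrow>
    leads (\<Sum>i\<in>A. m i) (\<Prod>i\<in>A. a i) (\<lambda>Y. \<Prod>i\<in>A. f i Y)"
  by (induction A rule: infinite_finite_induct) (auto intro: leads_one leads_mult)

text \<open>Distinct orders exclude cancellation: among the terms with nonzero coefficient the one
  of largest order leads. This shows that the auxiliary function in Stepanov's method is
  nonzero.\<close>

lemma leads_sum:
  assumes "finite A" "inj_on m A" "\<And>i. i \<in> A \<Longrightarrow> leads (m i) 1 (f i)" "i0 \<in> A" "c i0 \<noteq> 0"
  shows "\<exists>i\<in>A. c i \<noteq> 0 \<and> leads (m i) (c i) (\<lambda>Y. \<Sum>i\<in>A. c i * f i Y)"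
proof -
  define B where "B = {i\<in>A. c i \<noteq> 0}"
  have B: "finite B" "B \<noteq> {}" "B \<subseteq> A" using assms by (auto simp: B_def)
  obtain i where i: "i \<in> B" "\<And>j. j \<in> B \<Longrightarrow> m j \<le> m i"
    using obtains_MAX[OF B(1,2), of m] Max_ge[of "m ` B"] B by (metis finite_imageI imageI)
  have lt: "m j < m i" if "j \<in> B - {i}" for j
    using i that assms(2) B(3) by (metis DiffE inj_onD insertI1 le_neq_implies_less subsetD)
  have "leads (m i) (c i) (\<lambda>Y. c i * f i Y + (\<Sum>j\<in>B - {i}. c j * f j Y))"
  proof (rule leads_add_lower)
    show "leads (m i) (c i) (\<lambda>Y. c i * f i Y)" using leads_scale[OF assms(3), of i "c i"] i B by auto
    show "lower (m i) (\<lambda>Y. \<Sum>j\<in>B - {i}. c j * f j Y)"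
      using B lt assms(3) by (intro lower_sum lower_scale leads_lower[where a=1]) auto
  qed
  moreover have "c i * f i Y + (\<Sum>j\<in>B - {i}. c j * f j Y) = (\<Sum>i\<in>A. c i * f i Y)" for Y
  proof -
    have "c i * f i Y + (\<Sum>j\<in>B - {i}. c j * f j Y) = (\<Sum>j\<in>B. c j * f j Y)"
      using B i by (simp add: sum.remove[of B i])
    also have "\<dots> = (\<Sum>i\<in>A. c i * f i Y)"
      using assms(1) by (intro sum.mono_neutral_left) (auto simp: B_def)
    finally show ?thesis .
  qed
  ultimately show ?thesis using i B by (auto simp: B_def)
qed

end

section \<open>Fibres of the curve, iterated Frobenius and zeros of functions\<close>

lemma card_roots_separable:
  fixes p :: "'a::alg_closed_field poly"
  assumes "p \<noteq> 0" and sep: "\<And>x. poly p x = 0 \<Longrightarrow> poly (pderiv p) x \<noteq> 0"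
  shows "card {x. poly p x = 0} = degree p"
proof -
  obtain A where A: "size A = degree p" "p = smult (lead_coeff p) (\<Prod>x\<in>#A. [:-x, 1:])"
    using alg_closed_imp_factorization[OF assms(1)] by blast
  have roots: "{x. poly p x = 0} = set_mset A"
    by (subst A(2)) (use assms(1) in \<open>auto simp: poly_prod_mset prod_mset_zero_iff\<close>)
  have "count A x \<le> 1" for x
  proof (rule ccontr)
    assume "\<not> count A x \<le> 1"
    then have "{#x, x#} \<subseteq># A" by (auto simp: subseteq_mset_def)
    then obtain B where B: "A = {#x, x#} + B" by (auto simp: mset_subset_eq_exists_conv)
    define r where "r = smult (lead_coeff p) (\<Prod>x\<in>#B. [:-x, 1:])"
    have p: "p = [:-x, 1:] * ([:-x, 1:] * r)" by (subst A(2)) (simp add: B r_def)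
    have "poly p x = 0" "poly (pderiv p) x = 0"
      unfolding p by (simp, simp only: pderiv_mult poly_add poly_mult) simp
    with sep show False by blast
  qed
  then have "count A x = 1" if "x \<in># A" for x
    using that by (metis One_nat_def Suc_leI count_greater_zero_iff le_antisym)
  then have "card (set_mset A) = size A"
    unfolding size_multiset_overloaded_eq by simp
  then show ?thesis using A roots by simp
qed

context frobenius
begin

text \<open>The derivative of X^(q^k) - X + c is the constant -1 because q = 0 in the field, so all
  roots are simple.\<close>

lemma card_artin_schreier:
  assumes "k \<ge> 1"
  shows "card {x::'b. x ^ (q ^ k) = x - c} = q ^ k" "finite {x::'b. x ^ (q ^ k) = x - c}"
proof -
  define p where "p = monom (1::'b) (q ^ k) + [:c, -1:]"
  have n: "q ^ k > 1" using assms by (intro one_less_power q_gt_1) simp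
  have deg: "degree p = q ^ k"
    unfolding p_def by (subst degree_add_eq_left) (use n in \<open>auto simp: degree_monom_eq\<close>)
  have "(of_nat (q ^ k) :: 'b) = 0" using assms of_nat_q by simp
  then have der: "pderiv p = [:-1:]"
    by (simp add: p_def pderiv_add pderiv_monom pderiv_pCons)
  have roots: "{x. poly p x = 0} = {x. x ^ (q ^ k) = x - c}"
    by (auto simp: p_def poly_monom algebra_simps)
  have p0: "p \<noteq> 0" using deg n q_gt_1 by (metis degree_0 not_one_less_zero)
  have "card {x. poly p x = 0} = degree p"
    using p0 by (intro card_roots_separable) (simp_all add: der)
  then show "card {x::'b. x ^ (q ^ k) = x - c} = q ^ k" by (simp add: roots deg)
  show "finite {x::'b. x ^ (q ^ k) = x - c}" using poly_roots_finite[OF p0] by (simp add: roots)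
qed

definition fpsfrob :: "nat \<Rightarrow> 'b fps \<Rightarrow> 'b fps" where
  "fpsfrob k Y = Abs_fps (\<lambda>i. (Y $ i) ^ (q ^ k))"

lemma fpsfrob_nth [simp]: "fpsfrob k Y $ i = (Y $ i) ^ (q ^ k)"
  by (simp add: fpsfrob_def)

lemma fpsfrob_mult: "fpsfrob k (A * B) = fpsfrob k A * fpsfrob k B"
  by (rule fps_ext) (simp add: fps_mult_nth power_qk_sum power_mult_distrib)

lemma fpsfrob_prod: "fpsfrob k (\<Prod>i\<in>I. f i) = (\<Prod>i\<in>I. fpsfrob k (f i))"
proof -
  have one: "fpsfrob k 1 = 1" using q_gt_1 by (intro fps_ext) simp
  show ?thesis by (induction I rule: infinite_finite_induct) (simp_all add: one fpsfrob_mult)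
qed

lemma fpsfrob_linear: "fpsfrob k (1 - fps_const x * fps_X) = 1 - fps_const (x ^ (q ^ k)) * fps_X"
  using q_gt_1 by (intro fps_ext) (auto simp: power_qk_diff fps_X_def)

lemma fpsfrob_fixed: "(\<And>i. (g $ i) ^ q = g $ i) \<Longrightarrow> fpsfrob k g = g"
proof -
  assume g: "\<And>i. (g $ i) ^ q = g $ i"
  have "(g $ i) ^ (q ^ k) = g $ i" for i by (induction k) (simp_all add: power_mult g)
  then show ?thesis by (intro fps_ext) simp
qed

text \<open>For x in the field of q^k elements this is the norm of 1 - x z down to the field of q
  elements.\<close>

definition norm_series :: "nat \<Rightarrow> 'b \<Rightarrow> 'b fps" where
  "norm_series k x = (\<Prod>i<k. 1 - fps_const (x ^ (q ^ i)) * fps_X)"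

lemma norm_series_Suc: "norm_series (Suc k) x = fpsfrob 1 (norm_series k x) * (1 - fps_const x * fps_X)"
  unfolding norm_series_def fpsfrob_prod fpsfrob_linear
  by (subst prod.lessThan_Suc_shift) (simp add: mult.commute flip: power_mult)

end

context frobenius_curve
begin

definition base_pt :: "'b fps \<Rightarrow> 'b" where "base_pt Y = Y $ 1 - (Y $ 1) ^ q"

definition tower :: "'b \<Rightarrow> nat \<Rightarrow> 'b fps set" where
  "tower x j = {Y. Y $ 0 = 1 \<and> (\<forall>i>j. Y $ i = 0) \<and>
     (\<forall>i\<in>{1..j}. (Y $ i) ^ q = Y $ i - x * Y $ (i - 1))}"

text \<open>Given the earlier coefficients, each further one solves an Artin-Schreier equation and
  has q choices. For j = l this is the fibre of the curve over x.\<close>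

lemma card_tower: "finite (tower x j) \<and> card (tower x j) = q ^ j"
proof (induction j)
  case 0
  have "tower x 0 = {1}"
  proof (intro equalityI subsetI)
    fix Y assume "Y \<in> tower x 0"
    then have "Y $ i = (1 :: 'b fps) $ i" for i by (cases i) (auto simp: tower_def)
    then show "Y \<in> {1}" by (simp add: fps_eq_iff)
  qed (auto simp: tower_def)
  then show ?case by simp
next
  case (Suc j)
  define S where "S = (\<lambda>Y::'b fps. {c. c ^ q = c - x * Y $ j})"
  have S: "finite (S Y)" "card (S Y) = q" for Y
    using card_artin_schreier[of 1 "x * Y $ j"] by (auto simp: S_def)
  have "bij_betw (\<lambda>(Y, c). Y + fps_const c * fps_X ^ Suc j) (Sigma (tower x j) S) (tower x (Suc j))"
  proof (rule bij_betwI[where g = "\<lambda>Y. (fps_cutoff (Suc j) Y, Y $ Suc j)"])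
    show "(\<lambda>(Y, c). Y + fps_const c * fps_X ^ Suc j) \<in> Sigma (tower x j) S \<rightarrow> tower x (Suc j)"
    proof (intro funcsetI, clarify)
      fix Y c assume Y: "Y \<in> tower x j" and c: "c \<in> S Y"
      have co: "(Y + fps_const c * fps_X ^ Suc j) $ i = (if i = Suc j then c else Y $ i)" for i
        using Y by (auto simp: tower_def fps_mult_left_const_nth simp del: power_Suc)
      show "Y + fps_const c * fps_X ^ Suc j \<in> tower x (Suc j)"
        unfolding tower_def mem_Collect_eq co using Y c by (auto simp: tower_def S_def le_Suc_eq)
    qed
    show "(\<lambda>Y. (fps_cutoff (Suc j) Y, Y $ Suc j)) \<in> tower x (Suc j) \<rightarrow> Sigma (tower x j) S"
      by (auto simp: tower_def S_def)
    show "(\<lambda>Y. (fps_cutoff (Suc j) Y, Y $ Suc j)) ((\<lambda>(Y, c). Y + fps_const c * fps_X ^ Suc j) p) = p"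
      if "p \<in> Sigma (tower x j) S" for p
      using that by (auto simp: tower_def fps_eq_iff fps_mult_left_const_nth simp del: power_Suc)
    show "(\<lambda>(Y, c). Y + fps_const c * fps_X ^ Suc j) ((\<lambda>Y. (fps_cutoff (Suc j) Y, Y $ Suc j)) Y) = Y"
      if "Y \<in> tower x (Suc j)" for Y
      using that by (auto simp: tower_def fps_eq_iff fps_mult_left_const_nth simp del: power_Suc)
  qed
  note bij = this
  have fin: "finite (Sigma (tower x j) S)" using Suc S by auto
  have "card (tower x (Suc j)) = card (Sigma (tower x j) S)"
    using bij_betw_same_card[OF bij] by simp
  also have "\<dots> = q ^ Suc j" using Suc S by (simp add: card_SigmaI)
  finally have "card (tower x (Suc j)) = q ^ Suc j" .
  with fin show ?case unfolding bij_betw_finite[OF bij] by (rule conjI)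
qed

lemma curve_base: "Y \<in> curve \<and> base_pt Y = x \<longleftrightarrow> Y \<in> tower x l"
  using l_ge_1 by (auto simp: curve_def base_pt_def tower_def)

lemma card_curve_over:
  assumes "finite A"
  shows "finite {Y\<in>curve. base_pt Y \<in> A}" "card {Y\<in>curve. base_pt Y \<in> A} = q ^ l * card A"
proof -
  have eq: "{Y\<in>curve. base_pt Y \<in> A} = (\<Union>x\<in>A. tower x l)"
    by (auto simp: curve_base[symmetric])
  show "finite {Y\<in>curve. base_pt Y \<in> A}" unfolding eq using assms card_tower by blast
  have "card (\<Union>x\<in>A. tower x l) = (\<Sum>x\<in>A. card (tower x l))"
    using assms by (intro card_UN_disjoint) (simp_all add: card_tower, auto simp: curve_base[symmetric])
  then show "card {Y\<in>curve. base_pt Y \<in> A} = q ^ l * card A"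
    unfolding eq using card_tower by simp
qed

text \<open>Iterating the curve equation multiplies Y by the conjugates of 1 - x z. Hence over a
  point x of \<open>norm_class k g\<close> the q^k-Frobenius acts on Y as multiplication by g, up to
  degree l.\<close>

lemma curve_frobenius:
  assumes "Y \<in> curve" "i \<le> l"
  shows "(Y $ i) ^ (q ^ k) = (norm_series k (base_pt Y) * Y) $ i"
  using assms(2)
proof (induction k arbitrary: i)
  case 0
  then show ?case by (simp add: norm_series_def)
next
  case (Suc k)
  define x where "x = base_pt Y"
  have lin: "((1 - fps_const x * fps_X) * Y) $ j = (Y $ j) ^ q" if "j \<le> l" for j
  proof -
    have "((1 - fps_const x * fps_X) * Y) $ j = Y $ j - x * (fps_X * Y) $ j"
      by (simp add: left_diff_distrib mult.assoc)
    also have "\<dots> = (Y $ j) ^ q"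
    proof (cases j)
      case 0
      moreover have "Y $ 0 = 1" using assms(1) unfolding curve_def by blast
      ultimately show ?thesis by simp
    next
      case (Suc m)
      then have "(Y $ j) ^ q = Y $ j - x * Y $ (j - 1)"
        using assms(1) that unfolding curve_def x_def base_pt_def mem_Collect_eq by (metis atLeastAtMost_iff le_add1 plus_1_eq_Suc)
      then show ?thesis using Suc by (simp only: fps_X_mult_nth) simp
    qed
    finally show ?thesis .
  qed
  have "(Y $ i) ^ (q ^ Suc k) = ((Y $ i) ^ (q ^ k)) ^ q" by (simp add: power_mult [symmetric] mult.commute)
  also have "\<dots> = fpsfrob 1 (norm_series k x * Y) $ i" using Suc by (simp add: x_def)
  also have "\<dots> = (\<Sum>j=0..i. fpsfrob 1 (norm_series k x) $ j * (Y $ (i - j)) ^ q)"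
    by (simp add: fpsfrob_mult fps_mult_nth)
  also have "\<dots> = (\<Sum>j=0..i. fpsfrob 1 (norm_series k x) $ j * ((1 - fps_const x * fps_X) * Y) $ (i - j))"
    using Suc.prems by (intro sum.cong refl) (simp add: lin)
  also have "\<dots> = (norm_series (Suc k) x * Y) $ i"
    unfolding norm_series_Suc by (simp add: fps_mult_nth mult.assoc)
  finally show ?case by (simp add: x_def)
qed

lemma leads_coord: "i \<in> {1..l} \<Longrightarrow> leads (weight i) 1 (\<lambda>Y. Y $ i)"
proof -
  assume i: "i \<in> {1..l}"
  have "mon (single i) = (\<lambda>Y. Y $ i)" by (rule ext) (rule mon_single[OF i])
  with leads_mon[of "single i"] show ?thesis by (simp add: wt_single[OF i])
qed

lemma curve_eqI:
  assumes "Y \<in> curve" "Y' \<in> curve" "\<And>i. i \<in> {1..l} \<Longrightarrow> Y $ i = Y' $ i"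
  shows "Y = Y'"
proof (rule fps_ext)
  fix i
  have Y: "Y $ 0 = 1" "Y' $ 0 = 1" "i > l \<Longrightarrow> Y $ i = 0" "i > l \<Longrightarrow> Y' $ i = 0"
    using assms unfolding curve_def by blast+
  consider "i = 0" | "i \<in> {1..l}" | "i > l" by fastforce
  then show "Y $ i = Y' $ i"
    by cases (use Y assms in auto)
qed

text \<open>Modulo multiples of \<open>K\<close>, every function is a combination of the basis functions whose order is
  not in \<open>N + semi\<close>. There are at most \<open>N\<close> of these, as they are incongruent modulo \<open>N\<close>, whereas
  the functions separate the points of \<open>P\<close>.\<close>
lemma zeros_bound:
  assumes K: "leads N a K" "a \<noteq> 0" and P: "finite P" "P \<subseteq> curve" "\<And>Y. Y \<in> P \<Longrightarrow> K Y = 0"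
  shows "card P \<le> N"
proof (rule ccontr)
  assume less: "\<not> card P \<le> N"
  have N: "N \<in> semi" using K by (simp add: leads_def)
  define T where "T = {s\<in>semi. \<forall>s'\<in>semi. s \<noteq> N + s'}"
  have T: "finite T \<and> card T \<le> N"
  proof (cases "N = 0")
    case True
    then have "T = {}" by (auto simp: T_def)
    then show ?thesis by simp
  next
    case False
    \<comment> \<open>A larger element in the same residue class would be N plus an element of
      \<open>semi\<close>, so each class meets \<open>T\<close> at most once.\<close>
    have aux: False if "s \<in> T" "s' \<in> T" "s mod N = s' mod N" "s < s'" for s s'
    proof -
      have "N dvd s' - s" using that mod_eq_dvd_iff_nat[of s s' N] by simp
      then obtain t where t: "s' - s = N * t" by auto
      then have "t \<noteq> 0" using that by (intro notI) simp
      then obtain u where u: "t = Suc u" by (cases t) auto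
      have "s' = N + (u * N + s)" using t that by (simp add: u algebra_simps)
      moreover have "u * N + s \<in> semi" using that N by (auto simp: T_def intro: semi_add semi_mult)
      ultimately show False using that by (auto simp: T_def)
    qed
    have inj: "inj_on (\<lambda>s. s mod N) T"
      by (rule inj_onI) (metis aux linorder_neqE_nat)
    have sub: "(\<lambda>s. s mod N) ` T \<subseteq> {..<N}" using False by auto
    show ?thesis using inj_on_finite[OF inj sub] card_inj_on_le[OF inj sub] by simp
  qed
  \<comment> \<open>There are more points than conditions, so some nonzero linear functional on
    functions on \<open>P\<close> kills the basis functions indexed by \<open>T\<close>.\<close>
  then obtain t where t: "\<exists>Y\<in>P. t Y \<noteq> 0" "\<And>s. s \<in> T \<Longrightarrow> (\<Sum>Y\<in>P. basis s Y * t Y) = 0"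
    using homogeneous_system_nontrivial[of P T "\<lambda>Y s. basis s Y"] P less by auto
  define E where "E f = (\<Sum>Y\<in>P. f Y * t Y)" for f
  have lin: "E f = (\<Sum>d\<in>D. c d * E (g d))" if "\<And>Y. Y \<in> curve \<Longrightarrow> f Y = (\<Sum>d\<in>D. c d * g d Y)" for f c D and g :: "nat \<Rightarrow> _"
  proof -
    have "E f = (\<Sum>Y\<in>P. \<Sum>d\<in>D. c d * (g d Y * t Y))" unfolding E_def using P(2) that
      by (intro sum.cong refl) (auto simp: sum_distrib_right mult.assoc)
    also have "\<dots> = (\<Sum>d\<in>D. \<Sum>Y\<in>P. c d * (g d Y * t Y))" by (rule sum.swap)
    finally show ?thesis by (simp add: E_def sum_distrib_left)
  qed
  \<comment> \<open>For d outside \<open>T\<close>, the product of \<open>K\<close> and a basis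
    function vanishes on \<open>P\<close> and has leading term a * basis d, so smaller orders
    decide.\<close>
  have Ebasis: "E (basis d) = 0" if "d \<in> semi" for d
    using that
  proof (induction d rule: less_induct)
    case (less d)
    show ?case
    proof (cases "d \<in> T")
      case True
      then show ?thesis using t by (simp add: E_def)
    next
      case False
      then obtain d' where d': "d' \<in> semi" "d = N + d'" using less.prems by (auto simp: T_def)
      have "leads d (a * 1) (\<lambda>Y. K Y * basis d' Y)"
        unfolding d'(2) by (intro leads_mult K leads_basis d')
      then obtain c where c: "\<And>Y. Y \<in> curve \<Longrightarrow> K Y * basis d' Y - a * basis d Y = (\<Sum>i\<in>semi \<inter> {..<d}. c i * basis i Y)"
        unfolding leads_def lower_def by auto
      have "E (\<lambda>Y. K Y * basis d' Y - a * basis d Y) = (\<Sum>i\<in>semi \<inter> {..<d}. c i * E (basis i))"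
        by (rule lin) (rule c)
      also have "\<dots> = 0" using less.IH by (intro sum.neutral) auto
      finally have "0 = (\<Sum>Y\<in>P. K Y * basis d' Y * t Y) - a * E (basis d)"
        by (simp add: E_def sum_distrib_left algebra_simps sum_subtractf)
      also have "(\<Sum>Y\<in>P. K Y * basis d' Y * t Y) = 0" using P by (intro sum.neutral) auto
      finally show ?thesis using K by simp
    qed
  qed
  have Elow: "E f = 0" if "lower n f" for f n
  proof -
    obtain c where c: "\<And>Y. Y \<in> curve \<Longrightarrow> f Y = (\<Sum>i\<in>semi \<inter> {..<n}. c i * basis i Y)"
      using \<open>lower n f\<close> unfolding lower_def by auto
    have "E f = (\<Sum>i\<in>semi \<inter> {..<n}. c i * E (basis i))" by (rule lin) (rule c)
    also have "\<dots> = 0" using Ebasis by (intro sum.neutral) auto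
    finally show ?thesis .
  qed
  obtain Y0 where Y0: "Y0 \<in> P" "t Y0 \<noteq> 0" using t by auto
  have "\<exists>i\<in>{1..l}. Y $ i \<noteq> Y0 $ i" if "Y \<in> P - {Y0}" for Y
    using curve_eqI[of Y Y0] that Y0 P by blast
  then obtain \<kappa> where \<kappa>: "\<And>Y. Y \<in> P - {Y0} \<Longrightarrow> \<kappa> Y \<in> {1..l} \<and> Y $ \<kappa> Y \<noteq> Y0 $ \<kappa> Y" by metis
  \<comment> \<open>This product of coordinate differences vanishes on \<open>P\<close> except at
    \<open>Y0\<close>, so \<open>E f = f Y0 * t Y0\<close> is nonzero, although \<open>f\<close> is
    a combination of basis functions.\<close>
  define f where "f = (\<lambda>Z::'b fps. \<Prod>Y\<in>P - {Y0}. Z $ \<kappa> Y - Y $ \<kappa> Y)"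
  have "leads (\<Sum>Y\<in>P - {Y0}. weight (\<kappa> Y)) (\<Prod>Y\<in>P - {Y0}. 1) f"
    unfolding f_def
  proof (rule leads_prod)
    fix Y assume "Y \<in> P - {Y0}"
    then have k: "\<kappa> Y \<in> {1..l}" using \<kappa> by blast
    then have "0 < weight (\<kappa> Y)" using weight_less[of 0 "\<kappa> Y"] by (simp add: weight_0)
    then have "lower (weight (\<kappa> Y)) (\<lambda>Z. - (Y $ \<kappa> Y) * 1)" by (intro lower_scale leads_lower[OF leads_one])
    then show "leads (weight (\<kappa> Y)) 1 (\<lambda>Z. Z $ \<kappa> Y - Y $ \<kappa> Y)"
      using leads_add_lower[OF leads_coord[OF k], of "\<lambda>Z. - (Y $ \<kappa> Y) * 1"] by simp
  qed
  then have "E f = 0" using Elow leads_lower by blast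
  moreover have "E f = f Y0 * t Y0"
  proof -
    have "E f = f Y0 * t Y0 + (\<Sum>Y\<in>P - {Y0}. f Y * t Y)" unfolding E_def using P Y0 by (simp add: sum.remove)
    also have "(\<Sum>Y\<in>P - {Y0}. f Y * t Y) = 0"
      using P by (intro sum.neutral) (auto simp: f_def prod_zero_iff)
    finally show ?thesis by simp
  qed
  moreover have "f Y0 \<noteq> 0" unfolding f_def using \<kappa> P by (subst prod_zero_iff) (auto, metis)
  ultimately show False using Y0 by simp
qed

end

section \<open>The twisted Frobenius and Stepanov's method\<close>

context frobenius_curve
begin

lemma leads_cong_curve:
  "(\<And>Y. Y \<in> curve \<Longrightarrow> f Y = g Y) \<Longrightarrow> leads m a f \<Longrightarrow> leads m a g"
  using lower_cong[of "\<lambda>Y. f Y - a * basis m Y" "\<lambda>Y. g Y - a * basis m Y" m]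
  by (simp add: leads_def)

definition twist :: "'b fps \<Rightarrow> nat \<Rightarrow> 'b fps \<Rightarrow> 'b fps" where
  "twist g k Y = g * fpsfrob k Y"

text \<open>In the product with \<open>g\<close> only the term with \<open>g $ 0 = 1\<close> reaches
  this order; the coordinates of smaller index have smaller weight.\<close>

lemma leads_twist_coord:
  assumes g: "g $ 0 = 1" and i: "i \<in> {1..l}"
  shows "leads (q ^ k * weight i) 1 (\<lambda>Y. twist g k Y $ i)"
proof -
  have pos: "q ^ k > 0" using q_gt_1 by simp
  have wpos: "weight j > 0" if "j > 0" for j using weight_less[OF that] by (simp add: weight_0)
  have main: "leads (q ^ k * weight i) (1 ^ q ^ k) (\<lambda>Y. (Y $ i) ^ (q ^ k))"
    by (rule leads_power[OF leads_coord[OF i]])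
  have low: "lower (q ^ k * weight i) (\<lambda>Y. g $ (i - j) * (if j = 0 then 1 else (Y $ j) ^ (q ^ k)))" if "j < i" for j
  proof (cases "j = 0")
    case True
    have "lower (q ^ k * weight i) (\<lambda>_. g $ (i - j) * 1)"
      using pos wpos[of i] i by (intro lower_scale leads_lower[OF leads_one]) simp
    then show ?thesis using True by simp

  next
    case False
    then have "leads (q ^ k * weight j) (1 ^ q ^ k) (\<lambda>Y. (Y $ j) ^ (q ^ k))"
      using i that by (intro leads_power leads_coord) auto
    from leads_lower[OF this, of "q ^ k * weight i"] show ?thesis
      using weight_less[OF that] pos False by (simp add: lower_scale)
  qed
  have "leads (q ^ k * weight i) (1 ^ q ^ k) (\<lambda>Y. (Y $ i) ^ (q ^ k) +
     (\<Sum>j<i. g $ (i - j) * (if j = 0 then 1 else (Y $ j) ^ (q ^ k))))"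
    by (intro leads_add_lower main lower_sum low) simp
  then have "leads (q ^ k * weight i) (1 ^ q ^ k) (\<lambda>Y. twist g k Y $ i)"
  proof (rule leads_cong_curve[rotated])
    fix Y assume Y: "Y \<in> curve"
    then have "Y $ 0 = 1" unfolding curve_def by blast
    have "twist g k Y $ i = (\<Sum>j=0..i. (Y $ j) ^ (q ^ k) * g $ (i - j))"
      by (simp add: twist_def mult.commute[of g] fps_mult_nth)
    also have "\<dots> = (\<Sum>j<i. (Y $ j) ^ (q ^ k) * g $ (i - j)) + (Y $ i) ^ (q ^ k)"
      using g by (simp add: atLeast0AtMost lessThan_Suc_atMost[symmetric])
    also have "(\<Sum>j<i. (Y $ j) ^ (q ^ k) * g $ (i - j)) = (\<Sum>j<i. g $ (i - j) * (if j = 0 then 1 else (Y $ j) ^ (q ^ k)))"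
      using \<open>Y $ 0 = 1\<close> by (intro sum.cong) auto
    finally show "(Y $ i) ^ (q ^ k) + (\<Sum>j<i. g $ (i - j) * (if j = 0 then 1 else (Y $ j) ^ (q ^ k)))
      = twist g k Y $ i" by simp
  qed
  then show ?thesis by simp
qed

lemma leads_twist_mon:
  assumes g: "g $ 0 = 1"
  shows "leads (q ^ k * wt b) 1 (\<lambda>Y. mon b (twist g k Y))"
proof -
  have "leads (\<Sum>i=1..l. b i * (q ^ k * weight i)) (\<Prod>i=1..l. 1 ^ b i) (\<lambda>Y. \<Prod>i=1..l. (twist g k Y $ i) ^ b i)"
    by (intro leads_prod leads_power leads_twist_coord g)
  then show ?thesis by (simp add: mon_def wt_def sum_distrib_left mult.left_commute)
qed

lemma card_semi_ge: "n - card (- semi) \<le> card (semi \<inter> {..<n})"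
proof -
  have "card {..<n} \<le> card ((semi \<inter> {..<n}) \<union> (- semi))"
    using semi_cofinite by (intro card_mono) auto
  also have "\<dots> \<le> card (semi \<inter> {..<n}) + card (- semi)" by (rule card_Un_le)
  finally show ?thesis by simp
qed

lemma mon_frob: "mon b (fpsfrob k Y) = mon b Y ^ (q ^ k)"
  by (simp add: mon_def prod_power_distrib power_mult[symmetric] mult.commute)

lemma mon_cong_pt: "(\<And>i. i \<in> {1..l} \<Longrightarrow> Y $ i = Z $ i) \<Longrightarrow> mon b Y = mon b Z"
  unfolding mon_def by (intro prod.cong) auto

text \<open>Bombieri's form of Stepanov's method. With \<open>r = q\<^sup>k\<close>, a combination \<open>K\<close> of products of a basis
  function of small order and a basis function composed with the twisted Frobenius cannot vanish
  identically, since its terms have distinct orders. On the points in question, however, \<open>K\<^sup>r\<close>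
  lies in a space of small dimension, so that the coefficients can be chosen to make it vanish there.\<close>
lemma fixed_points_bound:
  assumes large: "q ^ k > card (- semi) ^ 2 + 3 * card (- semi) + 1"
    and g: "g $ 0 = 1" "\<And>i. (g $ i) ^ q = g $ i"
    and P: "finite P" "P \<subseteq> curve" "\<And>Y i. Y \<in> P \<Longrightarrow> i \<le> l \<Longrightarrow> (Y $ i) ^ (q ^ (2 * k)) = (g * Y) $ i"
  shows "card P \<le> q ^ (2 * k) + (2 * card (- semi) + 1) * q ^ k"
proof -
  define c where "c = card (- semi)"
  define r where "r = q ^ k"
  have r: "r > c ^ 2 + 3 * c + 1" using large by (simp add: r_def c_def)
  \<comment> \<open>There are at least (r - c)(r + c + 1) = r^2 + r - c^2 - c unknowns, and this
    exceeds M exactly when r > c^2 + 3c + 1. Keeping \<open>J\<close> below r makes the orders j + r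
    i distinct, and M exceeds every order r j + i.\<close>
  define I where "I = semi \<inter> {..<r + 2 * c + 1}"
  define J where "J = semi \<inter> {..<r}"
  define M where "M = r ^ 2 + 2 * c + 1"
  have fin: "finite I" "finite J" by (auto simp: I_def J_def)
  have cards: "card I \<ge> r + c + 1" "card J \<ge> r - c"
    using card_semi_ge[of "r + 2 * c + 1"] card_semi_ge[of r] by (auto simp: I_def J_def c_def)
  have "M < (r - c) * (r + c + 1)"
  proof -
    obtain s where s: "r = c + s" using r by (metis add.commute add_leE le_Suc_ex less_imp_le mult.commute mult_Suc_right numeral_3_eq_3)
    show ?thesis using r unfolding M_def s by (simp add: algebra_simps power2_eq_square)
  qed
  also have "\<dots> \<le> card J * card I" by (intro mult_mono cards) auto
  also have "\<dots> = card (J \<times> I)" by (simp only: card_cartesian_product)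
  finally have MJI: "M < card (J \<times> I)" .
  have "card (semi \<inter> {..<M}) \<le> card {..<M}" by (intro card_mono) auto
  then have "card (semi \<inter> {..<M}) \<le> M" by (simp only: card_lessThan)
  then have card: "card (semi \<inter> {..<M}) < card (J \<times> I)" using MJI by (rule le_less_trans)
  obtain bs where bs: "\<And>d. d \<in> semi \<Longrightarrow> wt (bs d) = d"
    using bchoice[of semi "\<lambda>d b. wt b = d"] unfolding semi_def by blast
  have low: "lower M (\<lambda>Y. mon (bs j) Y ^ r * mon (bs i) Y)" if "j \<in> J" "i \<in> I" for i j
  proof -
    have S: "j \<in> semi" "i \<in> semi" "j < r" "i < r + 2 * c + 1" using that by (auto simp: I_def J_def)
    have "leads (r * j + i) (1 ^ r * 1) (\<lambda>Y. mon (bs j) Y ^ r * mon (bs i) Y)"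
      using leads_mult[OF leads_power[OF leads_mon[of "bs j"], of r] leads_mon[of "bs i"]] bs S by simp
    moreover have "r * j + i < M"
    proof -
      have "r * j + r \<le> r * r" using S(3) by (metis Suc_leI mult_Suc_right mult_le_mono2 add.commute)
      then show ?thesis using S(4) by (simp add: M_def power2_eq_square)
    qed
    ultimately show ?thesis by (rule leads_lower)
  qed
  then have "\<exists>\<tau>. \<forall>p\<in>J \<times> I. \<forall>Y\<in>curve. mon (bs (fst p)) Y ^ r * mon (bs (snd p)) Y = (\<Sum>d\<in>semi \<inter> {..<M}. \<tau> p d * basis d Y)"
    unfolding lower_def by (intro bchoice) auto
  then obtain \<tau> where \<tau>: "\<And>p Y. p \<in> J \<times> I \<Longrightarrow> Y \<in> curve \<Longrightarrow>
     mon (bs (fst p)) Y ^ r * mon (bs (snd p)) Y = (\<Sum>d\<in>semi \<inter> {..<M}. \<tau> p d * basis d Y)" by blast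
  obtain t where t: "\<exists>p\<in>J \<times> I. t p \<noteq> 0" "\<And>d. d \<in> semi \<inter> {..<M} \<Longrightarrow> (\<Sum>p\<in>J \<times> I. \<tau> p d * t p) = 0"
    using homogeneous_system_nontrivial[of "J \<times> I" "semi \<inter> {..<M}" \<tau>] card fin by auto
  have "r > 0" using r by simp
  have "\<exists>s. s ^ r = t p" for p using nth_root_exists[OF \<open>r > 0\<close>] .
  \<comment> \<open>Raising to the power r is additive, so the linear system concerns the
    coefficients of K^r; those of \<open>K\<close> are their r-th roots.\<close>
  then obtain s where s: "\<And>p. s p ^ r = t p" by metis
  \<comment> \<open>As the coefficients of h are fixed by q-th powers, the r-Frobenius of h Y^(r) is
    h Y^(r^2), which agrees with h g Y = Y up to degree l at the points of \<open>P\<close>.\<close>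
  define h where "h = inverse g"
  have hg: "h * g = 1" using g unfolding h_def by (intro inverse_mult_eq_1) simp
  have h0: "h $ 0 = 1" using g by (simp add: h_def)
  have "fpsfrob k h * g = fpsfrob k (h * g)" using fpsfrob_fixed[of g k] g by (simp add: fpsfrob_mult)
  also have "\<dots> = h * g" using q_gt_1 by (auto simp: hg fps_eq_iff)
  finally have hk: "fpsfrob k h = h" using g by (metis mult_right_cancel fps_nonzero_nth zero_neq_one)
  define F where "F = (\<lambda>p Y. mon (bs (fst p)) Y * mon (bs (snd p)) (twist h k Y))"
  define K where "K = (\<lambda>Y. \<Sum>p\<in>J \<times> I. s p * F p Y)"
  have lead: "leads (fst p + r * snd p) 1 (F p)" if "p \<in> J \<times> I" for p
    using leads_mult[OF leads_mon[of "bs (fst p)"] leads_twist_mon[OF h0, of k "bs (snd p)"]] that bs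
    by (auto simp: F_def I_def J_def r_def)
  have inj: "inj_on (\<lambda>p. fst p + r * snd p) (J \<times> I)"
  proof (rule inj_onI)
    fix p p' assume p: "p \<in> J \<times> I" "p' \<in> J \<times> I" and eq: "fst p + r * snd p = fst p' + r * snd p'"
    have "fst p < r" "fst p' < r" using p by (auto simp: J_def)
    then have "fst p = fst p'" using arg_cong[OF eq, of "\<lambda>x. x mod r"] by simp
    then show "p = p'" using eq \<open>r > 0\<close> by (simp add: prod_eq_iff)
  qed
  obtain p0 where p0: "p0 \<in> J \<times> I" "s p0 \<noteq> 0" using t s \<open>r > 0\<close> by (metis zero_power)
  obtain p where p: "p \<in> J \<times> I" "s p \<noteq> 0" "leads (fst p + r * snd p) (s p) K"
    using leads_sum[of "J \<times> I" "\<lambda>p. fst p + r * snd p" F p0 s, OF _ inj lead p0] fin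
    unfolding K_def by auto
  have "K Y = 0" if "Y \<in> P" for Y
  proof -
    have Y: "Y \<in> curve" using that P by auto
    have "mon b (twist h k Y) ^ r = mon b Y" for b
    proof -
      have "mon b (twist h k Y) ^ r = mon b (fpsfrob k (twist h k Y))" by (simp add: mon_frob r_def)
      also have "\<dots> = mon b Y"
      proof (rule mon_cong_pt)
        fix i assume "i \<in> {1..l}"
        have "fpsfrob k (twist h k Y) $ i = (h * fpsfrob k (fpsfrob k Y)) $ i"
          by (simp add: twist_def fpsfrob_mult hk del: fpsfrob_nth)
        also have "fpsfrob k (fpsfrob k Y) = fpsfrob (2 * k) Y"
          by (rule fps_ext) (simp add: mult_2 power_add power_mult)
        also have "(h * fpsfrob (2 * k) Y) $ i = (h * (g * Y)) $ i"
          unfolding fps_mult_nth[of h] fpsfrob_nth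
        proof (intro sum.cong refl)
          fix j
          have "i - j \<le> l" using \<open>i \<in> {1..l}\<close> by auto
          from P(3)[OF that this] show "h $ j * (Y $ (i - j)) ^ (q ^ (2 * k)) = h $ j * (g * Y) $ (i - j)"
            by (rule arg_cong)
        qed
        also have "h * (g * Y) = Y" by (simp add: hg flip: mult.assoc)
        finally show "fpsfrob k (twist h k Y) $ i = Y $ i" .
      qed
      finally show ?thesis .
    qed
    then have "K Y ^ r = (\<Sum>p\<in>J \<times> I. t p * (mon (bs (fst p)) Y ^ r * mon (bs (snd p)) Y))"
      unfolding K_def F_def r_def power_qk_sum by (simp add: power_mult_distrib s[unfolded r_def])
    also have "\<dots> = (\<Sum>p\<in>J \<times> I. \<Sum>d\<in>semi \<inter> {..<M}. t p * (\<tau> p d * basis d Y))"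
      using \<tau> Y by (intro sum.cong refl) (simp add: sum_distrib_left)
    also have "\<dots> = (\<Sum>d\<in>semi \<inter> {..<M}. (\<Sum>p\<in>J \<times> I. \<tau> p d * t p) * basis d Y)"
      by (subst sum.swap) (simp add: sum_distrib_left mult_ac)
    also have "\<dots> = 0" using t by (intro sum.neutral) auto
    finally show ?thesis using \<open>r > 0\<close> by simp
  qed
  then have "card P \<le> fst p + r * snd p" using zeros_bound[OF p(3,2) P(1,2)] by blast
  also have "\<dots> \<le> r + r * (r + 2 * c)"
    using p(1) by (intro add_mono mult_mono) (auto simp: I_def J_def)
  also have "\<dots> = q ^ (2 * k) + (2 * c + 1) * q ^ k"
    unfolding r_def mult_2 power_add by (simp add: algebra_simps)
  finally show ?thesis by (simp add: c_def)
qed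

text \<open>Representatives of 1 + z F[z]/(z^(l+1)), where F is cut out of the algebraically closed
  field as the fixed field of the q-th power map.\<close>

definition residues :: "'b fps set" where
  "residues = {g. g $ 0 = 1 \<and> (\<forall>i. (g $ i) ^ q = g $ i) \<and> (\<forall>i>l. g $ i = 0)}"

definition norm_class :: "nat \<Rightarrow> 'b fps \<Rightarrow> 'b set" where
  "norm_class k g = {x. x ^ (q ^ k) = x \<and> (\<forall>i\<le>l. norm_series k x $ i = g $ i)}"

lemma finite_frob_fixed: "k \<ge> 1 \<Longrightarrow> finite {x::'b. x ^ (q ^ k) = x}"
  using card_artin_schreier[of k 0] by simp

lemma card_frob_fixed: "k \<ge> 1 \<Longrightarrow> card {x::'b. x ^ (q ^ k) = x} = q ^ k"
  using card_artin_schreier[of k 0] by simp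

text \<open>Above every x in the norm class lie q^l points of the curve, and by
  \<open>curve_frobenius\<close> all of them qualify for \<open>fixed_points_bound\<close>.\<close>

lemma card_norm_class_le:
  assumes "q ^ k > card (- semi) ^ 2 + 3 * card (- semi) + 1" "g \<in> residues"
  shows "q ^ l * card (norm_class (2 * k) g) \<le> q ^ (2 * k) + (2 * card (- semi) + 1) * q ^ k"
proof -
  have "k \<noteq> 0" using assms(1) by (intro notI) simp
  then have fin: "finite (norm_class (2 * k) g)"
    using finite_subset[OF _ finite_frob_fixed[of "2 * k"]] by (auto simp: norm_class_def)
  define P where "P = {Y \<in> curve. base_pt Y \<in> norm_class (2 * k) g}"
  have "card P \<le> q ^ (2 * k) + (2 * card (- semi) + 1) * q ^ k"
  proof (rule fixed_points_bound[OF assms(1), of g])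
    show "g $ 0 = 1" "\<And>i. (g $ i) ^ q = g $ i" using assms(2) by (auto simp: residues_def)
    show "finite P" "P \<subseteq> curve" using card_curve_over(1)[OF fin] by (auto simp: P_def)
    fix Y i assume Y: "Y \<in> P" and i: "i \<le> l"
    have "(Y $ i) ^ (q ^ (2 * k)) = (norm_series (2 * k) (base_pt Y) * Y) $ i"
      using Y i by (intro curve_frobenius) (auto simp: P_def)
    also have "\<dots> = (g * Y) $ i"
      unfolding fps_mult_nth using Y i by (intro sum.cong) (auto simp: P_def norm_class_def)
    finally show "(Y $ i) ^ (q ^ (2 * k)) = (g * Y) $ i" .
  qed
  then show ?thesis using card_curve_over(2)[OF fin] by (simp add: P_def)
qed

end

section \<open>Character sums and the L-polynomial\<close>

context frobenius_curve
begin

definition rcls :: "'b fps \<Rightarrow> 'b fps" where "rcls = fps_cutoff (Suc l)"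

lemma rcls_nth: "rcls A $ i = (if i \<le> l then A $ i else 0)"
  by (auto simp: rcls_def)

lemma rcls_mult: "rcls (rcls A * rcls B) = rcls (A * B)"
  by (rule fps_ext) (auto simp: rcls_nth fps_mult_nth intro!: sum.cong)

lemma rcls_residue: "A \<in> residues \<Longrightarrow> rcls A = A"
  by (rule fps_ext) (auto simp: rcls_nth residues_def)

lemma fpsfrob_one: "fpsfrob k 1 = 1"
  using fpsfrob_prod[of k "\<lambda>_. 1" "{}"] by simp

lemma power_q_sum: "(\<Sum>i\<in>A. f i :: 'b) ^ q = (\<Sum>i\<in>A. f i ^ q)"
  using power_qk_sum[of f A 1] by simp

lemma residues_rcls: "A $ 0 = 1 \<Longrightarrow> (\<And>i. i \<le> l \<Longrightarrow> (A $ i) ^ q = A $ i) \<Longrightarrow> rcls A \<in> residues"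
  using q_gt_1 by (auto simp: residues_def rcls_nth)

lemma residues_mult: "A \<in> residues \<Longrightarrow> B \<in> residues \<Longrightarrow> rcls (A * B) \<in> residues"
  by (rule residues_rcls)
    (auto simp: residues_def fps_mult_nth power_q_sum power_mult_distrib intro!: sum.cong)

lemma residues_inverse: "A \<in> residues \<Longrightarrow> \<exists>B\<in>residues. rcls (B * A) = 1"
proof -
  assume A: "A \<in> residues"
  then have A0: "A $ 0 = 1" by (simp add: residues_def)
  define h where "h = inverse A"
  have hA: "h * A = 1" unfolding h_def using A0 by (intro inverse_mult_eq_1) simp

  \<comment> \<open>Both h and its Frobenius image invert A, so they coincide.\<close>
  have "fpsfrob 1 h * A = fpsfrob 1 (h * A)"
    using fpsfrob_fixed[of A 1] A by (simp add: fpsfrob_mult residues_def)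
  also have "\<dots> = h * A" unfolding hA by (rule fpsfrob_one)
  finally have "fpsfrob 1 h = h" using A0 by (metis mult_right_cancel fps_nonzero_nth zero_neq_one)
  then have "(h $ i) ^ q = h $ i" for i by (metis fpsfrob_nth power_one_right)
  then have "rcls h \<in> residues" using A0 by (intro residues_rcls) (auto simp: h_def)
  moreover have "rcls (rcls h * A) = rcls (h * A)" using rcls_mult[of h A] rcls_residue[OF A] by simp
  then have "rcls (rcls h * A) = 1" unfolding hA by (auto simp: fps_eq_iff rcls_nth)
  ultimately show ?thesis by blast
qed

lemma one_residue: "1 \<in> residues" using q_gt_1 by (auto simp: residues_def)

lemma residues_finite_card: "finite residues \<and> card residues = q ^ l"
proof -
  define S where "S = {x::'b. x ^ q = x}"
  have S: "finite S" "card S = q" using finite_frob_fixed[of 1] card_frob_fixed[of 1] by (auto simp: S_def)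
  have bij: "bij_betw (\<lambda>f. Abs_fps (\<lambda>i. if i = 0 then 1 else if i \<le> l then f i else 0)) ({1..l} \<rightarrow>\<^sub>E S) residues"
  proof (rule bij_betwI[where g = "\<lambda>A. restrict (fps_nth A) {1..l}"])
    show "(\<lambda>f. Abs_fps (\<lambda>i. if i = 0 then 1 else if i \<le> l then f i else 0)) \<in> ({1..l} \<rightarrow>\<^sub>E S) \<rightarrow> residues"
    proof (rule funcsetI)
      fix f assume "f \<in> {1..l} \<rightarrow>\<^sub>E S"
      then have "f i ^ q = f i" if "i \<in> {1..l}" for i
        using that unfolding S_def PiE_iff by blast
      then show "Abs_fps (\<lambda>i. if i = 0 then 1 else if i \<le> l then f i else 0) \<in> residues"
        unfolding residues_def mem_Collect_eq fps_nth_Abs_fps using q_gt_1 by simp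
    qed
    show "(\<lambda>A. restrict (fps_nth A) {1..l}) \<in> residues \<rightarrow> ({1..l} \<rightarrow>\<^sub>E S)"
    proof (rule funcsetI)
      fix A assume "A \<in> residues"
      then have "(A $ i) ^ q = A $ i" for i unfolding residues_def by blast
      then show "restrict (fps_nth A) {1..l} \<in> {1..l} \<rightarrow>\<^sub>E S"
        unfolding restrict_PiE_iff S_def by blast
    qed
    show "restrict (fps_nth (Abs_fps (\<lambda>i. if i = 0 then 1 else if i \<le> l then f i else 0))) {1..l} = f"
      if "f \<in> {1..l} \<rightarrow>\<^sub>E S" for f
    proof (rule ext)
      fix i
      show "restrict (fps_nth (Abs_fps (\<lambda>i. if i = 0 then 1 else if i \<le> l then f i else 0))) {1..l} i = f i"
        by (cases "i \<in> {1..l}") (auto simp: PiE_arb[OF that])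
    qed
    show "Abs_fps (\<lambda>i. if i = 0 then 1 else if i \<le> l then restrict (fps_nth A) {1..l} i else 0) = A"
      if "A \<in> residues" for A
    proof (rule fps_ext)
      fix i
      have "A $ 0 = 1" "\<forall>i>l. A $ i = 0" using that unfolding residues_def by blast+
      then show "Abs_fps (\<lambda>i. if i = 0 then 1 else if i \<le> l then restrict (fps_nth A) {1..l} i else 0) $ i = A $ i"
        by (cases "i = 0") auto
    qed
  qed
  have "finite ({1..l} \<rightarrow>\<^sub>E S)" "card ({1..l} \<rightarrow>\<^sub>E S) = q ^ l"
    using S by (auto simp: finite_PiE card_PiE)
  then show ?thesis using bij_betw_finite[OF bij] bij_betw_same_card[OF bij] by simp
qed

text \<open>Frobenius permutes the k conjugate factors cyclically.\<close>

lemma norm_series_fixed: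
  assumes "x ^ (q ^ k) = x"
  shows "fpsfrob 1 (norm_series k x) = norm_series k x"
proof (cases k)
  case 0
  then show ?thesis using q_gt_1 by (auto simp: norm_series_def fps_eq_iff)
next
  case (Suc m)
  have "fpsfrob 1 (norm_series k x) = (\<Prod>i<k. 1 - fps_const (x ^ (q ^ Suc i)) * fps_X)"
    unfolding norm_series_def fpsfrob_prod fpsfrob_linear by (simp add: power_mult[symmetric] mult.commute)
  also have "\<dots> = (\<Prod>i<m. 1 - fps_const (x ^ (q ^ Suc i)) * fps_X) * (1 - fps_const (x ^ (q ^ Suc m)) * fps_X)"
    unfolding Suc by (rule prod.lessThan_Suc)
  also have "x ^ (q ^ Suc m) = x ^ (q ^ 0)" using assms Suc by simp
  also have "(\<Prod>i<m. 1 - fps_const (x ^ (q ^ Suc i)) * fps_X) * (1 - fps_const (x ^ (q ^ 0)) * fps_X) = norm_series k x"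
    unfolding norm_series_def Suc prod.lessThan_Suc_shift by (rule mult.commute)
  finally show ?thesis .
qed

lemma norm_series_0: "norm_series k x $ 0 = 1"
  unfolding norm_series_def by (induction k) simp_all

lemma norm_series_residue: "x ^ (q ^ k) = x \<Longrightarrow> rcls (norm_series k x) \<in> residues"
  using norm_series_fixed[of x k] fpsfrob_nth[of 1 "norm_series k x"]
  by (intro residues_rcls) (simp_all add: norm_series_0)

lemma norm_class_eq:
  "g \<in> residues \<Longrightarrow> norm_class k g = {x. x ^ (q ^ k) = x \<and> rcls (norm_series k x) = g}"
  unfolding norm_class_def by (auto simp: fps_eq_iff rcls_nth residues_def)

lemma sum_norm_classes:
  fixes \<chi> :: "'b fps \<Rightarrow> 'c::comm_semiring_1"
  assumes "k \<ge> 1"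
  shows "(\<Sum>x | x ^ (q ^ k) = x. \<chi> (rcls (norm_series k x))) = (\<Sum>g\<in>residues. of_nat (card (norm_class k g)) * \<chi> g)"
proof -
  have "(\<Sum>g\<in>residues. \<Sum>x | x \<in> {x. x ^ (q ^ k) = x} \<and> rcls (norm_series k x) = g. \<chi> (rcls (norm_series k x)))
     = (\<Sum>x | x ^ (q ^ k) = x. \<chi> (rcls (norm_series k x)))"
    using finite_frob_fixed[OF assms] residues_finite_card norm_series_residue by (intro sum.group) auto
  moreover have "(\<Sum>x | x \<in> {x. x ^ (q ^ k) = x} \<and> rcls (norm_series k x) = g. \<chi> (rcls (norm_series k x)))
     = of_nat (card (norm_class k g)) * \<chi> g" if "g \<in> residues" for g
    unfolding norm_class_eq[OF that] by (simp add: sum.cong)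
  ultimately show ?thesis by simp
qed

text \<open>Only upper bounds for the class sizes are available. The deviations t from the average
  add up to 0 and satisfy t \<le> U with U = B / W, so summing |t| \<le> 2U - t over the W classes
  gives 2B. The average itself drops out because \<open>\<chi>\<close> sums to 0.\<close>

lemma character_sum_bound:
  fixes \<chi> :: "'b fps \<Rightarrow> complex"
  assumes large: "q ^ k > card (- semi) ^ 2 + 3 * card (- semi) + 1"
    and zero: "(\<Sum>g\<in>residues. \<chi> g) = 0" and norm: "\<And>g. g \<in> residues \<Longrightarrow> norm (\<chi> g) \<le> 1"
  shows "norm (\<Sum>x | x ^ (q ^ (2 * k)) = x. \<chi> (rcls (norm_series (2 * k) x)))
    \<le> 2 * (2 * card (- semi) + 1) * q ^ k"
proof -
  have "k \<noteq> 0" using large by (intro notI) simp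
  then have k: "2 * k \<ge> 1" by simp
  define N where "N g = real (card (norm_class (2 * k) g))" for g
  define B where "B = real ((2 * card (- semi) + 1) * q ^ k)"
  define Q where "Q = real (q ^ (2 * k))"
  define W where "W = real (q ^ l)"
  have W: "W > 0" using q_gt_1 by (simp add: W_def)
  have cW: "real (card residues) = W" using residues_finite_card by (simp add: W_def)
  have upper: "N g - Q / W \<le> B / W" if "g \<in> residues" for g
  proof -
    have "real (q ^ l * card (norm_class (2 * k) g)) \<le> real (q ^ (2 * k) + (2 * card (- semi) + 1) * q ^ k)"
      using card_norm_class_le[OF large that] by (rule of_nat_mono)
    then have "W * N g \<le> Q + B" by (simp only: of_nat_mult of_nat_add W_def N_def Q_def B_def)
    then have "N g \<le> (Q + B) / W" using W by (simp add: pos_le_divide_eq mult.commute)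
    then show ?thesis by (simp add: add_divide_distrib)
  qed
  have total: "(\<Sum>g\<in>residues. N g) = Q"
    using sum_norm_classes[OF k, of "\<lambda>_. 1::real"] card_frob_fixed[OF k] by (simp add: N_def Q_def)
  have "(\<Sum>x | x ^ (q ^ (2 * k)) = x. \<chi> (rcls (norm_series (2 * k) x))) = (\<Sum>g\<in>residues. of_real (N g) * \<chi> g)"
    using sum_norm_classes[OF k, of \<chi>] by (simp add: N_def)
  also have "\<dots> = (\<Sum>g\<in>residues. of_real (N g - Q / W) * \<chi> g) + of_real (Q / W) * (\<Sum>g\<in>residues. \<chi> g)"
    by (simp add: algebra_simps sum_subtractf sum_distrib_left sum_divide_distrib)
  also have "norm \<dots> \<le> (\<Sum>g\<in>residues. norm (of_real (N g - Q / W) * \<chi> g))"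
    unfolding zero by (simp del: of_real_diff add: norm_sum)
  also have "\<dots> \<le> (\<Sum>g\<in>residues. 2 * (B / W) - (N g - Q / W))"
  proof (rule sum_mono)
    fix g assume g: "g \<in> residues"
    have "norm (of_real (N g - Q / W) * \<chi> g) \<le> \<bar>N g - Q / W\<bar> * 1"
      unfolding norm_mult norm_of_real using norm[OF g] by (intro mult_left_mono) auto
    also have "\<dots> \<le> 2 * (B / W) - (N g - Q / W)"
    proof -
      have "B / W \<ge> 0" using W by (simp add: B_def)
      then show ?thesis using upper[OF g] by (simp add: abs_if)
    qed
    finally show "norm (of_real (N g - Q / W) * \<chi> g) \<le> 2 * (B / W) - (N g - Q / W)" .
  qed
  also have "\<dots> = 2 * B"
    using W by (simp add: sum_subtractf sum.distrib total cW)
  finally show ?thesis by (simp add: B_def)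
qed

end

text \<open>\<open>chi_sum\<close> expresses that the character is nontrivial.\<close>

locale frobenius_character = frobenius_curve q fr l
  for q :: nat and fr :: "'b::alg_closed_field \<Rightarrow> 'b" and l :: nat +
  fixes \<chi> :: "'b fps \<Rightarrow> complex"
  assumes chi_mult: "A \<in> residues \<Longrightarrow> B \<in> residues \<Longrightarrow> \<chi> (rcls (A * B)) = \<chi> A * \<chi> B"
    and chi_norm: "A \<in> residues \<Longrightarrow> norm (\<chi> A) = 1"
    and chi_sum: "(\<Sum>A\<in>residues. \<chi> A) = 0"

section \<open>Monic polynomials over the finite field and their classes\<close>

context frobenius_curve
begin

definition monics :: "nat \<Rightarrow> 'b poly set" where
  "monics d = {f. degree f = d \<and> lead_coeff f = 1 \<and> coeff f 0 \<noteq> 0 \<and> (\<forall>i. coeff f i ^ q = coeff f i)}"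

text \<open>Reversal is multiplicative and turns the leading coefficient into the constant term, so
  the class remembers the top l + 1 coefficients.\<close>

definition cls :: "'b poly \<Rightarrow> 'b fps" where
  "cls f = rcls (fps_of_poly (reflect_poly f))"

lemma finite_monics: "finite (monics d)"
proof -
  define S where "S = {x::'b. x ^ q = x}"
  have S: "finite S" using finite_frob_fixed[of 1] by (simp add: S_def)
  have "monics d \<subseteq> Poly ` {xs. set xs \<subseteq> S \<and> length xs = Suc d}"
  proof
    fix f assume f: "f \<in> monics d"
    then have "f \<noteq> 0" by (auto simp: monics_def)
    then have "length (coeffs f) = Suc d" using f by (simp add: length_coeffs_degree monics_def)
    moreover have "set (coeffs f) \<subseteq> S" using f by (auto simp: monics_def S_def coeffs_def)
    moreover have "f = Poly (coeffs f)" by simp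
    ultimately show "f \<in> Poly ` {xs. set xs \<subseteq> S \<and> length xs = Suc d}" by blast
  qed
  then show ?thesis using finite_lists_length_eq[OF S] finite_surj by blast
qed

lemma monicsD:
  assumes "f \<in> monics d"
  shows "degree f = d" "lead_coeff f = 1" "coeff f d = 1" "coeff f 0 \<noteq> 0" "coeff f i ^ q = coeff f i" "f \<noteq> 0"
  using assms by (auto simp: monics_def)

lemma cls_nth:
  assumes "f \<in> monics d"
  shows "cls f $ i = (if i \<le> l \<and> i \<le> d then coeff f (d - i) else 0)"
  using monicsD[OF assms] by (auto simp: cls_def rcls_nth coeff_reflect_poly)

lemma cls_residue: "f \<in> monics d \<Longrightarrow> cls f \<in> residues"
  unfolding cls_def using monicsD[of f d] q_gt_1
  by (intro residues_rcls) (auto simp: coeff_reflect_poly)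

lemma cls_mult: "cls (f * g) = rcls (cls f * cls g)"
  by (simp add: cls_def rcls_mult reflect_poly_mult fps_of_poly_mult)

lemma monics_mult:
  assumes "f \<in> monics m" "g \<in> monics n"
  shows "f * g \<in> monics (m + n)"
proof -
  note f = monicsD[OF assms(1)] and g = monicsD[OF assms(2)]
  have "degree (f * g) = m + n" using f g by (simp add: degree_mult_eq)
  moreover have "lead_coeff (f * g) = 1" unfolding lead_coeff_mult f(2) g(2) by simp
  moreover have "coeff (f * g) 0 \<noteq> 0" using f(4) g(4) by (simp add: coeff_mult)
  moreover have "coeff (f * g) i ^ q = coeff (f * g) i" for i
    unfolding coeff_mult power_q_sum power_mult_distrib f(5) g(5) ..
  ultimately show ?thesis by (simp add: monics_def)
qed

lemma coeff_monom_sum: "coeff (\<Sum>j\<le>d. monom (c j) j) i = (if i \<le> d then c i else 0)"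
  by (simp add: coeff_sum coeff_monom)

text \<open>The l + 1 coefficients seen by the class and the d - l others vary independently. As d >
  l, the constant coefficient, which must be nonzero, is among the others.\<close>

lemma cls_fibres:
  assumes "d > l"
  shows "\<exists>L. bij_betw (\<lambda>f. (cls f, poly_cutoff (d - l) f)) (monics d) (residues \<times> L)"
proof -
  define L where "L = {r::'b poly. (\<forall>i\<ge>d - l. coeff r i = 0) \<and> coeff r 0 \<noteq> 0 \<and> (\<forall>i. coeff r i ^ q = coeff r i)}"
  define G where "G = (\<lambda>(h :: 'b fps, r :: 'b poly). \<Sum>j\<le>d. monom (if j < d - l then coeff r j else h $ (d - j)) j)"
  have coG: "coeff (G (h, r)) i = (if i \<le> d then if i < d - l then coeff r i else h $ (d - i) else 0)" for h r i
    by (simp add: G_def coeff_monom_sum)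
  have res: "h $ 0 = 1" "(h $ i) ^ q = h $ i" "i > l \<Longrightarrow> h $ i = 0" if "h \<in> residues" for h i
    using that unfolding residues_def by blast+
  have GM: "G p \<in> monics d" if p: "p \<in> residues \<times> L" for p
  proof -
    obtain h r where hr: "p = (h, r)" "h \<in> residues" "r \<in> L" using p by auto
    have d: "coeff (G p) d = 1" using assms res[OF hr(2)] l_ge_1 by (simp add: hr coG)
    have "degree (G p) \<le> d" by (rule degree_le) (simp add: hr coG)
    with d have "degree (G p) = d" by (metis le_degree le_antisym zero_neq_one)
    moreover have "coeff (G p) i ^ q = coeff (G p) i" for i
    proof -
      have "coeff r i ^ q = coeff r i" using hr(3) unfolding L_def by blast
      then show ?thesis using res[OF hr(2)] q_gt_1 by (simp add: hr coG)
    qed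
    moreover have "coeff (G p) 0 \<noteq> 0" using hr assms by (simp add: coG L_def)
    ultimately show ?thesis using d by (simp add: monics_def)
  qed
  have "bij_betw (\<lambda>f. (cls f, poly_cutoff (d - l) f)) (monics d) (residues \<times> L)"
  proof (rule bij_betwI[where g = G])
    show "(\<lambda>f. (cls f, poly_cutoff (d - l) f)) \<in> monics d \<rightarrow> residues \<times> L"
    proof (rule funcsetI)
      fix f assume f: "f \<in> monics d"
      have "poly_cutoff (d - l) f \<in> L"
        unfolding L_def mem_Collect_eq coeff_poly_cutoff using monicsD[OF f] assms q_gt_1 by simp
      then show "(cls f, poly_cutoff (d - l) f) \<in> residues \<times> L" using cls_residue[OF f] by simp
    qed
    show "G \<in> residues \<times> L \<rightarrow> monics d" using GM by blast
    show "G (cls f, poly_cutoff (d - l) f) = f" if f: "f \<in> monics d" for f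
      using monicsD(1)[OF f] by (intro poly_eqI) (auto simp: coG cls_nth[OF f] coeff_poly_cutoff coeff_eq_0)
    show "(cls (G p), poly_cutoff (d - l) (G p)) = p" if p: "p \<in> residues \<times> L" for p
    proof -
      obtain h r where hr: "p = (h, r)" "h \<in> residues" "r \<in> L" using p by auto
      have "cls (G p) = h"
        using assms res[OF hr(2)] by (intro fps_ext) (auto simp: cls_nth[OF GM[OF p]], auto simp: hr coG)
      moreover have "poly_cutoff (d - l) (G p) = r"
        using hr(3) by (intro poly_eqI) (auto simp: hr coG coeff_poly_cutoff L_def)
      ultimately show ?thesis by (simp add: hr)
    qed
  qed
  then show ?thesis by blast
qed

definition pfrob :: "'b poly \<Rightarrow> 'b poly" where "pfrob = map_poly (\<lambda>x. x ^ q)"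

lemma coeff_pfrob: "coeff (pfrob f) i = coeff f i ^ q"
  using q_gt_1 by (simp add: pfrob_def coeff_map_poly)

lemma pfrob_mult: "pfrob (f * g) = pfrob f * pfrob g"
  by (rule poly_eqI) (simp add: coeff_pfrob coeff_mult power_q_sum power_mult_distrib)

lemma pfrob_linear: "pfrob [:- x, 1:] = [:- (x ^ q), 1:]"
  using power_qk_minus[of x 1] q_gt_1 by (intro poly_eqI) (auto simp: coeff_pfrob coeff_pCons split: nat.splits)

lemma pfrob_prod_mset: "pfrob (\<Prod>x\<in>#A. [:- x, 1:]) = (\<Prod>x\<in>#image_mset (\<lambda>x. x ^ q) A. [:- x, 1:])"
proof (induction A)
  case empty
  have "pfrob 1 = 1" using q_gt_1 by (intro poly_eqI) (auto simp: coeff_pfrob)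
  then show ?case by simp
qed (simp_all add: pfrob_mult pfrob_linear del: mult_pCons_left mult_pCons_right)

lemma proots_linear_prod: "proots (\<Prod>x\<in>#A. [:- x, 1 :: 'b:]) = A"
proof (induction A)
  case (add x A)
  have "(\<Prod>x\<in>#A. [:- x, 1 :: 'b:]) \<noteq> 0" by (auto simp: prod_mset_zero_iff)
  then show ?case using add by (simp add: proots_mult del: mult_pCons_left mult_pCons_right)
qed simp

lemma monic_factorization:
  assumes "lead_coeff (f::'b poly) = 1"
  shows "f = (\<Prod>x\<in>#proots f. [:- x, 1:])" "size (proots f) = degree f"
proof -
  have "f \<noteq> 0" using assms by auto
  then obtain A where A: "size A = degree f" "f = smult (lead_coeff f) (\<Prod>x\<in>#A. [:- x, 1:])"
    using alg_closed_imp_factorization by blast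
  then have f: "f = (\<Prod>x\<in>#A. [:- x, 1:])" using assms by simp
  then have "proots f = A" using proots_linear_prod by metis
  then show "f = (\<Prod>x\<in>#proots f. [:- x, 1:])" "size (proots f) = degree f" using f A by auto
qed

lemma count_image_power: "count (image_mset (\<lambda>x::'b. x ^ q) A) (y ^ q) = count A y"
  using power_qk_inj[of _ 1] by (induction A) auto

text \<open>A polynomial over the finite field is fixed by \<open>pfrob\<close>, so the injective
  map x \<mapsto> x^q carries its multiset of roots to itself.\<close>

lemma order_frob:
  assumes "f \<in> monics d"
  shows "order (x ^ q ^ i) f = order x f"
proof (induction i)
  case (Suc i)
  have "pfrob f = f" using monicsD[OF assms] by (intro poly_eqI) (simp add: coeff_pfrob)
  then have "f = (\<Prod>x\<in>#image_mset (\<lambda>x. x ^ q) (proots f). [:- x, 1:])"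
    using monic_factorization(1)[OF monicsD(2)[OF assms]] pfrob_prod_mset[of "proots f"] by simp
  then have "proots f = image_mset (\<lambda>x. x ^ q) (proots f)" using proots_linear_prod by metis
  then have "count (proots f) ((x ^ q ^ i) ^ q) = count (image_mset (\<lambda>x. x ^ q) (proots f)) ((x ^ q ^ i) ^ q)" by simp
  also have "\<dots> = count (proots f) (x ^ q ^ i)"
    by (rule count_image_power)
  finally show ?case using Suc monicsD(6)[OF assms] by (simp add: power_mult[symmetric] mult.commute)
qed simp

text \<open>For x in the field of q^k elements, the characteristic polynomial of x over the field of
  q elements.\<close>

definition norm_poly :: "nat \<Rightarrow> 'b \<Rightarrow> 'b poly" where
  "norm_poly k x = (\<Prod>i<k. [:- (x ^ (q ^ i)), 1:])"

lemma fps_reflect_norm_poly: "fps_of_poly (reflect_poly (norm_poly k x)) = norm_series k x"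
  unfolding norm_poly_def norm_series_def reflect_poly_prod fps_of_poly_prod fps_reflect_linear ..

lemma cls_norm_poly: "cls (norm_poly k x) = rcls (norm_series k x)"
  unfolding cls_def fps_reflect_norm_poly ..

lemma norm_poly_monic: "degree (norm_poly k x) = k" "lead_coeff (norm_poly k x) = 1"
proof -
  show "degree (norm_poly k x) = k" unfolding norm_poly_def
    by (subst degree_prod_eq_sum_degree) auto
  show "lead_coeff (norm_poly k x) = 1" unfolding norm_poly_def
    by (simp add: lead_coeff_prod)
qed

lemma norm_poly_in_monics:
  assumes "x \<noteq> 0" "x ^ (q ^ k) = x"
  shows "norm_poly k x \<in> monics k"
proof -
  have "coeff (norm_poly k x) 0 \<noteq> 0"
    using assms(1) by (simp add: norm_poly_def poly_0_coeff_0[symmetric] poly_prod prod_zero_iff)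
  \<comment> \<open>With nonzero constant coefficient reversal is an involution, so the coefficient
    condition carries over from \<open>norm_series\<close>.\<close>
  then have re: "reflect_poly (reflect_poly (norm_poly k x)) = norm_poly k x" by simp
  have "coeff (reflect_poly (norm_poly k x)) i ^ q = coeff (reflect_poly (norm_poly k x)) i" for i
    using norm_series_fixed[OF assms(2)] fpsfrob_nth[of 1 "norm_series k x" i] fps_reflect_norm_poly[of k x]
    by (metis fps_of_poly_nth power_one_right)
  then have "coeff (norm_poly k x) i ^ q = coeff (norm_poly k x) i" for i
    by (subst (1 2) re[symmetric], subst (1 2) coeff_reflect_poly) (use q_gt_1 in auto)
  then show ?thesis using \<open>coeff (norm_poly k x) 0 \<noteq> 0\<close> norm_poly_monic by (auto simp: monics_def)
qed

end

section \<open>Newton's identity for the character sums\<close>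

lemma prod_lessThan_add:
  fixes f :: "nat \<Rightarrow> 'a::comm_monoid_mult"
  shows "(\<Prod>i<m + d. f i) = (\<Prod>i<m. f i) * (\<Prod>i<d. f (m + i))"
  by (induction d) (simp_all add: mult.assoc)

text \<open>Powers of distinct linear factors are coprime and can be divided out one at a
  time.\<close>

lemma prod_linear_powers_dvd:
  fixes f :: "'a::field poly"
  assumes "finite C" "f \<noteq> 0" "\<And>y. y \<in> C \<Longrightarrow> j \<le> order y f"
  shows "(\<Prod>y\<in>C. [:- y, 1:] ^ j) dvd f"
  using assms
proof (induction C arbitrary: f rule: finite_induct)
  case (insert y C)
  have "[:- y, 1:] ^ j dvd f" using insert.prems by (simp add: order_divides)
  then obtain g where g: "f = [:- y, 1:] ^ j * g" by auto
  have g0: "g \<noteq> 0" using g insert.prems by auto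
  have "(\<Prod>y\<in>C. [:- y, 1:] ^ j) dvd g"
  proof (rule insert.IH[OF g0])
    fix z assume z: "z \<in> C"
    then have "z \<noteq> y" using insert by auto
    then have "order z ([:- y, 1:] ^ j) = 0" by (intro order_0I) (simp add: poly_power)
    then have "order z f = order z g" using g insert.prems(1) by (simp add: order_mult)
    then show "j \<le> order z g" using insert.prems(2)[of z] z by simp
  qed
  then show ?case using insert.hyps g by (simp add: mult_dvd_mono del: mult_pCons_left)
qed simp

context frobenius_curve
begin

lemma frob_cancel:
  assumes "(x::'b) ^ q ^ i = x ^ q ^ j" "i \<le> j"
  shows "x ^ q ^ (j - i) = x"
proof -
  have "(x ^ q ^ (j - i)) ^ q ^ i = x ^ q ^ j"
    using assms(2) by (simp add: power_mult[symmetric] power_add[symmetric])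
  also have "\<dots> = x ^ q ^ i" using assms(1) by simp
  finally show ?thesis by (simp only: power_qk_inj)
qed

lemma frob_period_multiple: "(x::'b) ^ q ^ d = x \<Longrightarrow> x ^ q ^ (j * d + i) = x ^ q ^ i"
proof (induction j)
  case (Suc j)
  have "x ^ q ^ (Suc j * d + i) = (x ^ q ^ d) ^ q ^ (j * d + i)"
    by (simp add: power_mult[symmetric] power_add[symmetric] add.assoc)
  then show ?case using Suc by simp
qed simp

text \<open>The polynomials \<open>norm_poly k x\<close> with \<open>x\<close> in the field of \<open>q\<^sup>k\<close> elements are the powers of the
  minimal polynomial of \<open>x\<close>.\<close>
lemma order_eq_card_norms:
  assumes f: "f \<in> monics n"
  shows "card {k\<in>{1..n}. x ^ q ^ k = x \<and> norm_poly k x dvd f} = order x f"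
proof (cases "order x f = 0")
  case True
  have "\<not> norm_poly k x dvd f" if "k \<in> {1..n}" for k
  proof
    assume "norm_poly k x dvd f"
    moreover have "poly (norm_poly k x) x = 0"
      unfolding norm_poly_def poly_prod using that by (intro prod_zero) (auto intro!: bexI[of _ 0])
    ultimately have "poly f x = 0" by (metis dvdE mult_zero_left poly_mult)
    then show False using True monicsD(6)[OF f] by (simp add: order_root)
  qed
  then show ?thesis using True by simp
next
  case False
  have f0: "f \<noteq> 0" using monicsD(6)[OF f] .
  define R where "R = {y. poly f y = 0}"
  have R: "finite R" "card R \<le> n"
    using poly_roots_finite[OF f0] card_poly_roots_bound[OF f0] monicsD(1)[OF f] by (auto simp: R_def)
  have orb: "x ^ q ^ i \<in> R" for i
    using order_frob[OF f, of x i] False f0 by (simp add: R_def order_root)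
  \<comment> \<open>The Frobenius orbit stays among the at most n roots of \<open>f\<close>, so n +
    1 iterates repeat.\<close>
  have "\<not> inj_on (\<lambda>i. x ^ q ^ i) {..n}"
  proof
    assume "inj_on (\<lambda>i. x ^ q ^ i) {..n}"
    then have "card {..n} \<le> card R" using orb R by (intro card_inj_on_le) auto
    then show False using R by simp
  qed
  then obtain i j where ij: "i < j" "x ^ q ^ i = x ^ q ^ j"
    unfolding inj_on_def by (metis linorder_neqE_nat)
  \<comment> \<open>The degree of x over the field of q elements.\<close>
  define d where "d = (LEAST d. d \<ge> 1 \<and> x ^ q ^ d = x)"
  have "j - i \<ge> 1 \<and> x ^ q ^ (j - i) = x" using ij frob_cancel[of x i j] by auto
  then have d: "d \<ge> 1 \<and> x ^ q ^ d = x" unfolding d_def by (rule LeastI)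
  have least: "d \<le> k" if "k \<ge> 1" "x ^ q ^ k = x" for k
    unfolding d_def using that by (intro Least_le) auto
  have period: "d dvd k" if "x ^ q ^ k = x" for k
  proof -
    have "x ^ q ^ (k mod d) = x" using frob_period_multiple[of x d "k div d" "k mod d"] d that by simp
    then have "k mod d = 0" using least[of "k mod d"] d mod_less_divisor[of d k] by linarith
    then show ?thesis by auto
  qed
  have inj: "inj_on (\<lambda>i. x ^ q ^ i) {..<d}"
  proof (rule linorder_inj_onI')
    fix i j assume ij: "i \<in> {..<d}" "j \<in> {..<d}" "i < j"
    show "x ^ q ^ i \<noteq> x ^ q ^ j"
    proof
      assume "x ^ q ^ i = x ^ q ^ j"
      then have "d \<le> j - i" using frob_cancel[of x i j] least[of "j - i"] ij(3) by simp
      then show False using ij by auto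
    qed
  qed
  have pow: "norm_poly (j * d) x = norm_poly d x ^ j" for j
  proof (induction j)
    case (Suc j)
    have "norm_poly (Suc j * d) x = norm_poly (j * d + d) x" by (simp add: add.commute)
    also have "\<dots> = norm_poly (j * d) x * norm_poly d x"
      unfolding norm_poly_def prod_lessThan_add using frob_period_multiple[of x d j] d by simp
    finally show ?case using Suc by (simp add: mult.commute)
  qed (simp add: norm_poly_def)
  have conj: "norm_poly d x ^ j = (\<Prod>y\<in>(\<lambda>i. x ^ q ^ i) ` {..<d}. [:- y, 1:] ^ j)" for j
    using inj by (simp add: norm_poly_def prod.reindex prod_power_distrib)
  have dvd: "norm_poly d x ^ j dvd f \<longleftrightarrow> j \<le> order x f" for j
  proof
    assume "norm_poly d x ^ j dvd f"
    moreover have "[:- (x ^ q ^ 0), 1:] dvd norm_poly d x"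
      unfolding norm_poly_def using d by (intro dvd_prodI) auto
    then have "[:- x, 1:] ^ j dvd norm_poly d x ^ j" by (intro dvd_power_same) simp
    ultimately have "[:- x, 1:] ^ j dvd f" by (rule dvd_trans[rotated])
    then show "j \<le> order x f" using f0 by (simp add: order_divides)
  next
    assume "j \<le> order x f"
    then show "norm_poly d x ^ j dvd f"
      unfolding conj using f0 order_frob[OF f] by (intro prod_linear_powers_dvd) auto
  qed
  \<comment> \<open>By \<open>period\<close> only k = j * d can occur, and by \<open>pow\<close> and
    \<open>dvd\<close> divisibility then means j \<le> \<open>order x f\<close>; the bound k \<le> n
    follows from the degrees.\<close>
  have "{k\<in>{1..n}. x ^ q ^ k = x \<and> norm_poly k x dvd f} = (\<lambda>j. j * d) ` {1..order x f}"
  proof (intro equalityI subsetI)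
    fix k assume k: "k \<in> {k\<in>{1..n}. x ^ q ^ k = x \<and> norm_poly k x dvd f}"
    then have "d dvd k" using period by simp
    then obtain j where "k = d * j" by (elim dvdE)
    then have j: "k = j * d" by (simp only: mult.commute)
    then have "j \<le> order x f" using k pow dvd by auto
    moreover have "j \<noteq> 0" using k j by (intro notI) simp
    ultimately show "k \<in> (\<lambda>j. j * d) ` {1..order x f}" using j by auto
  next
    fix k assume "k \<in> (\<lambda>j. j * d) ` {1..order x f}"
    then obtain j where j: "k = j * d" "j \<in> {1..order x f}" by (elim imageE)
    then have "1 \<le> j" "j \<le> order x f" by simp_all
    note j = j(1) this
    have dv: "norm_poly k x dvd f" using j pow dvd by simp
    have "k \<le> n" using dvd_imp_degree_le[OF dv f0] monicsD(1)[OF f] norm_poly_monic(1)[of k x] by simp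
    moreover have "1 \<le> k" using j d by simp
    moreover have "x ^ q ^ k = x" using frob_period_multiple[of x d j 0] d j by simp
    ultimately show "k \<in> {k\<in>{1..n}. x ^ q ^ k = x \<and> norm_poly k x dvd f}" using dv by simp
  qed
  moreover have "inj_on (\<lambda>j. j * d) {1..order x f}" using d by (intro inj_onI) simp
  ultimately show ?thesis by (simp add: card_image)
qed

end

context frobenius_character
begin

definition lam :: "nat \<Rightarrow> complex" where
  "lam d = (\<Sum>f\<in>monics d. \<chi> (cls f))"

text \<open>The element 0 is left out because its norm polynomials are powers of T, which
  \<open>monics\<close> excludes.\<close>

definition csum :: "nat \<Rightarrow> complex" where
  "csum k = (\<Sum>x | x ^ q ^ k = x \<and> x \<noteq> 0. \<chi> (rcls (norm_series k x)))"

lemma chi_one: "\<chi> 1 = 1"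
proof -
  have "\<chi> 1 = \<chi> 1 * \<chi> 1"
    using chi_mult[OF one_residue one_residue] rcls_residue[OF one_residue] by simp
  then show ?thesis using chi_norm[OF one_residue] by (metis mult_cancel_right1 norm_zero zero_neq_one)
qed

lemma lam_0: "lam 0 = 1"
proof -
  have "monics 0 = {1}"
  proof (intro equalityI subsetI)
    fix f assume f: "f \<in> monics 0"
    obtain a where "f = [:a:]" using monicsD(1)[OF f] by (rule degree_eq_zeroE)
    then show "f \<in> {1}" using monicsD(3)[OF f] by (simp add: one_pCons)
  qed (use q_gt_1 in \<open>auto simp: monics_def coeff_1\<close>)
  moreover have "cls 1 = 1" by (auto simp: cls_def fps_eq_iff rcls_nth)
  ultimately show ?thesis by (simp add: lam_def chi_one)
qed

text \<open>By \<open>cls_fibres\<close> every class occurs equally often, so the character values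
  cancel.\<close>

lemma lam_eq_0:
  assumes "d > l"
  shows "lam d = 0"
proof -
  obtain L where L: "bij_betw (\<lambda>f. (cls f, poly_cutoff (d - l) f)) (monics d) (residues \<times> L)"
    using cls_fibres[OF assms] by blast
  have "lam d = (\<Sum>f\<in>monics d. (\<lambda>p. \<chi> (fst p)) (cls f, poly_cutoff (d - l) f))"
    by (simp add: lam_def)
  also have "\<dots> = (\<Sum>p\<in>residues \<times> L. \<chi> (fst p))" by (rule sum.reindex_bij_betw[OF L])
  also have "\<dots> = (\<Sum>A\<in>residues. \<Sum>r\<in>L. \<chi> A)" by (subst sum.cartesian_product) (simp add: case_prod_unfold)
  also have "\<dots> = of_nat (card L) * (\<Sum>A\<in>residues. \<chi> A)" by (simp add: sum_distrib_left)
  also have "\<dots> = 0" by (simp add: chi_sum)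
  finally show ?thesis .
qed

lemma chi_cls_mult:
  "f \<in> monics m \<Longrightarrow> g \<in> monics n \<Longrightarrow> \<chi> (cls (f * g)) = \<chi> (cls f) * \<chi> (cls g)"
  unfolding cls_mult by (intro chi_mult cls_residue)

lemma sum_multiples:
  assumes "g \<in> monics k" "k \<le> n"
  shows "(\<Sum>f | f \<in> monics n \<and> g dvd f. \<chi> (cls f)) = \<chi> (cls g) * lam (n - k)"
proof -
  have "bij_betw (\<lambda>a. g * a) (monics (n - k)) {f\<in>monics n. g dvd f}"
  proof (rule bij_betwI')
    fix a b show "g * a = g * b \<longleftrightarrow> a = b" using monicsD(6)[OF assms(1)] by simp
  next
    fix a assume "a \<in> monics (n - k)"
    then show "g * a \<in> {f\<in>monics n. g dvd f}" using monics_mult[OF assms(1), of a "n - k"] assms(2) by simp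
  next
    fix f assume "f \<in> {f\<in>monics n. g dvd f}"
    then obtain h where f: "f \<in> monics n" and h: "f = g * h" by auto
    have nz: "g \<noteq> 0" "h \<noteq> 0" using monicsD(6)[OF f] h by auto
    have "degree h = n - k" using monicsD(1)[OF f] monicsD(1)[OF assms(1)] nz by (simp add: h degree_mult_eq)
    moreover have "lead_coeff h = 1" using monicsD(2)[OF f] monicsD(2)[OF assms(1)] by (simp add: h lead_coeff_mult)
    moreover have "coeff h 0 \<noteq> 0" using monicsD(4)[OF f] by (simp add: h coeff_mult)
    \<comment> \<open>\<open>pfrob h\<close> is also a quotient of \<open>f\<close> by
      \<open>g\<close>, and the quotient is unique.\<close>
    moreover have "coeff h i ^ q = coeff h i" for i
    proof -
      have fixed: "pfrob f = f" "pfrob g = g" using monicsD(5)[OF f] monicsD(5)[OF assms(1)]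
        by (auto intro!: poly_eqI simp: coeff_pfrob)
      then have "g * pfrob h = g * h" using pfrob_mult[of g h] h fixed by simp
      then have "pfrob h = h" using nz by simp
      then show ?thesis using coeff_pfrob[of h i] by simp
    qed
    ultimately have "h \<in> monics (n - k)" by (simp add: monics_def)
    then show "\<exists>a\<in>monics (n - k). f = g * a" using h by blast
  qed
  from sum.reindex_bij_betw[OF this, of "\<lambda>f. \<chi> (cls f)"]
  have "(\<Sum>f | f \<in> monics n \<and> g dvd f. \<chi> (cls f)) = (\<Sum>a\<in>monics (n - k). \<chi> (cls (g * a)))" by simp
  also have "\<dots> = \<chi> (cls g) * lam (n - k)"
    unfolding lam_def sum_distrib_left using chi_cls_mult[OF assms(1)] by (intro sum.cong) auto
  finally show ?thesis .
qed

text \<open>Count the pairs (x, k) by x instead: by \<open>order_eq_card_norms\<close> each root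
  occurs with its multiplicity, and these add up to n. Roots are nonzero because \<open>f\<close>
  does not vanish at 0.\<close>

lemma degree_eq_card_norms:
  assumes f: "f \<in> monics n"
  shows "n = (\<Sum>k=1..n. card {x. (x ^ q ^ k = x \<and> x \<noteq> 0) \<and> norm_poly k x dvd f})"
proof -
  have f0: "f \<noteq> 0" using monicsD(6)[OF f] .
  define roots where "roots = {x. poly f x = 0}"
  define A where "A = (\<lambda>x. {k\<in>{1..n}. x ^ q ^ k = x \<and> norm_poly k x dvd f})"
  define B where "B = (\<lambda>k. {x. (x ^ q ^ k = x \<and> x \<noteq> 0) \<and> norm_poly k x dvd f})"
  have card_A: "card (A x) = order x f" for x using order_eq_card_norms[OF f] by (simp add: A_def)
  have finX: "finite roots" using poly_roots_finite[OF f0] by (simp add: roots_def)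
  have finA: "finite (A x)" for x by (simp add: A_def)
  have finB: "finite (B k)" if "k \<in> {1..n}" for k
    using finite_subset[OF _ finite_frob_fixed[of k], of "B k"] that by (auto simp: B_def)
  have n: "n = (\<Sum>x\<in>roots. card (A x))"
  proof -
    have "n = size (proots f)" using monic_factorization(2)[OF monicsD(2)[OF f]] monicsD(1)[OF f] by simp
    also have "\<dots> = (\<Sum>x\<in>roots. order x f)"
      using f0 by (simp add: size_multiset_overloaded_eq roots_def)
    finally show ?thesis by (simp add: card_A)
  qed
  also have "\<dots> = card (Sigma roots A)" using finX finA by simp
  also have "\<dots> = card (Sigma {1..n} B)"
  proof (rule bij_betw_same_card[of prod.swap])
    have swap: "x \<in> roots \<and> k \<in> A x \<longleftrightarrow> k \<in> {1..n} \<and> x \<in> B k" for x k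
    proof
      assume xk: "x \<in> roots \<and> k \<in> A x"
      have "x \<noteq> 0" using xk monicsD(4)[OF f] by (auto simp: roots_def poly_0_coeff_0)
      then show "k \<in> {1..n} \<and> x \<in> B k" using xk by (auto simp: A_def B_def)
    next
      assume xk: "k \<in> {1..n} \<and> x \<in> B k"
      then have k: "k \<in> A x" by (auto simp: A_def B_def)
      then have "card (A x) \<noteq> 0" using finA[of x] by (auto simp: card_eq_0_iff)
      then have "order x f \<noteq> 0" by (metis card_A)
      then have "x \<in> roots" using f0 by (simp add: roots_def order_root)
      then show "x \<in> roots \<and> k \<in> A x" using k by simp
    qed
    have "p \<in> Sigma roots A \<longleftrightarrow> prod.swap p \<in> Sigma {1..n} B" for p
      using swap by (cases p) (simp only: mem_Sigma_iff swap_simp)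
    then show "bij_betw prod.swap (Sigma roots A) (Sigma {1..n} B)"
      by (intro bij_betwI[where g = prod.swap]) (auto simp del: mem_Sigma_iff)
  qed
  also have "\<dots> = (\<Sum>k=1..n. card (B k))" using finB by (intro card_SigmaI) auto
  finally show ?thesis by (simp add: B_def)
qed

text \<open>Writing the factor n as the count in \<open>degree_eq_card_norms\<close> and exchanging
  the sums leaves, for each x, a sum over the multiples of \<open>norm_poly k x\<close>. For
  generating functions this is u L'(u) = C(u) L(u).\<close>

lemma newton: "of_nat n * lam n = (\<Sum>k=1..n. csum k * lam (n - k))"
proof -
  define F where "F = (\<lambda>k. {x::'b. x ^ q ^ k = x \<and> x \<noteq> 0})"
  have finF: "finite (F k)" if "k \<ge> 1" for k
    using finite_subset[OF _ finite_frob_fixed[OF that], of "F k"] by (auto simp: F_def)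
  have "of_nat n * lam n = (\<Sum>f\<in>monics n. of_nat n * \<chi> (cls f))" by (simp add: lam_def sum_distrib_left)
  also have "\<dots> = (\<Sum>f\<in>monics n. \<Sum>k=1..n. \<Sum>x | x \<in> F k \<and> norm_poly k x dvd f. \<chi> (cls f))"
  proof (rule sum.cong[OF refl])
    fix f assume f: "f \<in> monics n"
    have "of_nat n * \<chi> (cls f) = (\<Sum>k=1..n. of_nat (card {x. x \<in> F k \<and> norm_poly k x dvd f}) * \<chi> (cls f))"
      by (subst degree_eq_card_norms[OF f]) (simp add: F_def sum_distrib_right)
    then show "of_nat n * \<chi> (cls f) = (\<Sum>k=1..n. \<Sum>x | x \<in> F k \<and> norm_poly k x dvd f. \<chi> (cls f))" by simp
  qed
  also have "\<dots> = (\<Sum>k=1..n. \<Sum>f\<in>monics n. \<Sum>x | x \<in> F k \<and> norm_poly k x dvd f. \<chi> (cls f))"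
    by (rule sum.swap)
  also have "\<dots> = (\<Sum>k=1..n. \<Sum>x\<in>F k. \<Sum>f | f \<in> monics n \<and> norm_poly k x dvd f. \<chi> (cls f))"
    by (intro sum.cong refl sum.swap_restrict finite_monics finF) auto
  also have "\<dots> = (\<Sum>k=1..n. \<Sum>x\<in>F k. \<chi> (cls (norm_poly k x)) * lam (n - k))"
    by (intro sum.cong refl sum_multiples norm_poly_in_monics) (auto simp: F_def)
  also have "\<dots> = (\<Sum>k=1..n. csum k * lam (n - k))"
    by (simp add: csum_def F_def sum_distrib_right cls_norm_poly)
  finally show ?thesis .
qed

text \<open>The full sum also contains x = 0 with value 1. This 1 is absorbed by q^k and raises the
  constant from 4c + 2 to 4c + 3, where c is the number of gaps.\<close>

lemma csum_bound:
  assumes "q ^ k > card (- semi) ^ 2 + 3 * card (- semi) + 1"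
  shows "norm (csum (2 * k)) \<le> (4 * real (card (- semi)) + 3) * real q ^ k"
proof -
  have "k \<noteq> 0" using assms by (intro notI) simp
  then have fin: "finite {x::'b. x ^ q ^ (2 * k) = x}" by (intro finite_frob_fixed) simp
  have z: "0 \<in> {x::'b. x ^ q ^ (2 * k) = x}" using q_gt_1 by simp
  have "(0::'b) ^ q ^ i = 0" for i using q_gt_1 by simp
  then have ns: "rcls (norm_series (2 * k) 0) = 1"
    unfolding norm_series_def by (simp only: rcls_residue[OF one_residue] fps_const_0_eq_0 mult_zero_left diff_zero prod.neutral_const)
  have "{x::'b. x ^ q ^ (2 * k) = x \<and> x \<noteq> 0} = {x. x ^ q ^ (2 * k) = x} - {0}" by auto
  then have "csum (2 * k) = (\<Sum>x | x ^ q ^ (2 * k) = x. \<chi> (rcls (norm_series (2 * k) x))) - 1"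
    unfolding csum_def using sum.remove[OF fin z, of "\<lambda>x. \<chi> (rcls (norm_series (2 * k) x))"]
    by (simp add: ns chi_one)
  also have "norm \<dots> \<le> norm (\<Sum>x | x ^ q ^ (2 * k) = x. \<chi> (rcls (norm_series (2 * k) x))) + 1"
    by (rule order_trans[OF norm_triangle_ineq4]) simp
  also have "\<dots> \<le> 2 * (2 * card (- semi) + 1) * q ^ k + 1"
    using character_sum_bound[OF assms chi_sum] chi_norm by (simp add: order_eq_refl)
  finally have "norm (csum (2 * k)) \<le> 2 * (2 * real (card (- semi)) + 1) * real q ^ k + 1" by (simp add: algebra_simps)
  moreover have "1 \<le> real q ^ k" using q_gt_1 by simp
  ultimately show ?thesis by (simp add: algebra_simps)
qed

end

section \<open>Characteristic polynomials in short intervals\<close>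

context frobenius_character
begin

lemma recursion_estimate:
  assumes E_0: "E 0 = 1" and rec: "\<And>n. of_real (real q ^ n) * E n = (\<Sum>d\<le>n. lam d * E (n - d))"
  shows "norm (E n) \<le> real q powr (- (real n ^ 2 / (2 * real l))) * (1 + 1 / (real q - 1)) ^ n * real ((n + l - 1) choose n)"
proof -
  obtain gs where gs: "length gs = l" "Abs_fps lam = (\<Prod>g\<leftarrow>gs. 1 - fps_const g * fps_X)"
    using factor_lambda[of lam l, OF lam_0 lam_eq_0] by blast
  have csum: "csum k = - (\<Sum>g\<leftarrow>gs. g ^ k)" if "k \<ge> 1" for k
    by (rule newton_power_sums[OF gs(2) newton that lam_0])
  \<comment> \<open>Since k < q^k, all k beyond this threshold meet the size condition of
    \<open>csum_bound\<close>.\<close>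
  define k0 where "k0 = card (- semi) ^ 2 + 3 * card (- semi) + 1"
  have root: "norm g \<le> sqrt (real q)" if "g \<in> set gs" for g
  proof (rule even_power_sums_bound[OF _ _ that])
    show "real q > 0" using q_gt_1 by simp
    fix k assume k: "k \<ge> Suc k0"
    have "k < q ^ k" using q_gt_1 by (intro power_gt_expt) simp
    then have "q ^ k > card (- semi) ^ 2 + 3 * card (- semi) + 1" using k by (simp add: k0_def)
    from csum_bound[OF this] csum[of "2 * k"] k
    show "norm (\<Sum>g\<leftarrow>gs. g ^ (2 * k)) \<le> (4 * real (card (- semi)) + 3) * real q ^ k" by simp
  qed
  have "gs \<noteq> []" using gs(1) l_ge_1 by auto
  moreover have "real q > 1" using q_gt_1 by simp
  ultimately show ?thesis
    using recursion_bound[OF _ gs(2) lam_0 _ root E_0 rec] gs(1) by simp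
qed

end

context frobenius_curve
begin

definition residue_group :: "'b fps monoid" where
  "residue_group = \<lparr>carrier = residues, monoid.mult = (\<lambda>A B. rcls (A * B)), one = 1\<rparr>"

lemma residue_group_simps [simp]:
  "carrier residue_group = residues" "A \<otimes>\<^bsub>residue_group\<^esub> B = rcls (A * B)" "\<one>\<^bsub>residue_group\<^esub> = 1"
  by (simp_all add: residue_group_def)

lemma residue_group: "finite_comm_group residue_group"
proof (intro finite_comm_group.intro comm_groupI finite_comm_group_axioms.intro, unfold residue_group_simps)
  show "rcls (rcls (x * y) * z) = rcls (x * rcls (y * z))"
    if "x \<in> residues" "y \<in> residues" "z \<in> residues" for x y z
    using rcls_mult[of "x * y" z] rcls_mult[of x "y * z"] that by (simp add: rcls_residue mult.assoc)
  show "\<exists>y\<in>residues. rcls (y * x) = 1" if "x \<in> residues" for x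
    using that by (rule residues_inverse)
qed (simp_all add: residues_mult one_residue residues_finite_card rcls_residue mult.commute)

lemma nontrivial_character:
  assumes "\<chi> \<in> dual residue_group" "\<chi> \<noteq> finite_comm_group.triv residue_group"
  shows "frobenius_character q fr l \<chi>"
proof -
  interpret R: finite_comm_group residue_group by (rule residue_group)
  show ?thesis
    using R.dualD(1)[OF assms(1)] R.dual_norm[OF assms(1)] R.sum_character[OF assms]
    by unfold_locales simp_all
qed

end

section \<open>Finite fields and their algebraic closures\<close>

lemma finite_field_power_card:
  fixes x :: "'a::{field,finite}"
  shows "x ^ card (UNIV :: 'a set) = x"
proof (cases "x = 0")
  case False
  have "(\<Prod>y\<in>UNIV-{0}. x * y) = (\<Prod>y\<in>UNIV-{0}. y)"
    by (rule prod.reindex_bij_witness[of _ "\<lambda>y. y / x" "\<lambda>y. x * y"]) (use False in auto)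
  then have "x ^ (card (UNIV :: 'a set) - 1) = 1"
    by (simp add: prod.distrib card_Diff_singleton)
  moreover have "card (UNIV :: 'a set) = Suc (card (UNIV :: 'a set) - 1)"
    using card_field_ge_2[where 'a='a] by simp
  ultimately show ?thesis by (metis mult.right_neutral power_Suc)
next
  case True
  then show ?thesis using card_field_ge_2[where 'a='a] by simp
qed

text \<open>(1 + X)^q - X^q - 1 has degree below q but vanishes at all q elements of the field,
  hence is 0; its coefficients are the middle binomial coefficients.\<close>

lemma binomial_card_field:
  assumes "0 < i" "i < card (UNIV :: 'a::{field,finite} set)"
  shows "(of_nat (card (UNIV :: 'a set) choose i) :: 'a) = 0"
proof -
  define q where "q = card (UNIV :: 'a set)"
  have q: "q > 1" using card_field_ge_2[where 'a='a] by (simp add: q_def)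
  define P where "P = [:1, 1 :: 'a:] ^ q - [:0, 1:] ^ q - 1"
  have co: "coeff P j = (if j = 0 \<or> j \<ge> q then 0 else of_nat (q choose j))" for j
  proof (cases "j \<le> q")
    case True
    have c1: "coeff ([:1, 1 :: 'a:] ^ q) j = of_nat (q choose j)"
      using True by (simp add: coeff_linear_poly_power)
    have c2: "coeff ([:0, 1 :: 'a:] ^ q) j = (if j = q then 1 else 0)"
      by (simp add: monom_altdef[of 1, simplified, symmetric])
    show ?thesis using True q by (auto simp: P_def c1 c2 coeff_1)
  next
    case False
    have "degree ([:a, 1 :: 'a:] ^ q) \<le> q" for a
      using degree_power_le[of "[:a, 1 :: 'a:]" q] by simp
    then have "coeff ([:a, 1 :: 'a:] ^ q) j = 0" for a using False by (intro coeff_eq_0) (meson le_less_trans not_le)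
    then show ?thesis using False q by (simp add: P_def coeff_1)
  qed
  have "P = 0"
  proof (rule ccontr)
    assume P0: "P \<noteq> 0"
    have "degree P < q" using q by (intro degree_lessI) (auto simp: co)
    moreover have "poly P x = 0" for x
      by (simp add: P_def poly_power q_def finite_field_power_card)
    then have "card {x. poly P x = 0} = q" by (simp add: q_def)
    ultimately show False using card_poly_roots_bound[OF P0] by simp
  qed
  then show ?thesis using co[of i] assms by (simp add: q_def)
qed

lemma frobenius_alg_closure:
  "frobenius (card (UNIV :: 'a::{field,finite} set)) (\<lambda>x :: 'a alg_closure. x ^ card (UNIV :: 'a set))"
proof
  define q where "q = card (UNIV :: 'a set)"
  have q: "q > 1" using card_field_ge_2[where 'a='a] by (simp add: q_def)
  then show "1 < card (UNIV :: 'a set)" by (simp add: q_def)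
  have "CHAR('a) dvd q" unfolding q_def by (rule CHAR_dvd_CARD)
  then have "(of_nat q :: 'a alg_closure) = 0" by (simp add: of_nat_eq_0_iff_char_dvd)
  then show "(of_nat (card (UNIV :: 'a set)) :: 'a alg_closure) = 0" by (simp add: q_def)
  have bin: "(of_nat (q choose i) :: 'a alg_closure) = 0" if "0 < i" "i < q" for i
    using binomial_card_field[of i, where 'a='a] that by (metis q_def to_ac_0 to_ac_of_nat)
  fix x y :: "'a alg_closure"
  have "(x + y) ^ q = (\<Sum>i\<le>q. of_nat (q choose i) * x ^ i * y ^ (q - i))" by (rule binomial_ring)
  also have "\<dots> = (\<Sum>i\<in>{0, q}. of_nat (q choose i) * x ^ i * y ^ (q - i))"
    by (rule sum.mono_neutral_right) (auto simp: bin)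
  also have "\<dots> = x ^ q + y ^ q" using q by simp
  finally show "(x + y) ^ card (UNIV :: 'a set) = x ^ card (UNIV :: 'a set) + y ^ card (UNIV :: 'a set)"
    by (simp add: q_def)
qed simp

definition ac_poly :: "'a::field poly \<Rightarrow> 'a alg_closure poly" where
  "ac_poly = map_poly to_ac"

lemma coeff_ac_poly [simp]: "coeff (ac_poly g) i = to_ac (coeff g i)"
  by (simp add: ac_poly_def coeff_map_poly)

lemma degree_ac_poly [simp]: "degree (ac_poly g) = degree g"
  by (simp add: ac_poly_def degree_map_poly)

lemma ac_poly_mult: "ac_poly (g * h) = ac_poly g * ac_poly h"
  by (rule poly_eqI) (simp add: coeff_mult to_ac_sum)

section \<open>Short intervals and the final estimate\<close>

lemma short_interval_iff:
  assumes "monic g" "monic f" "degree g = n" "degree f = n" "h < n"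
  shows "g \<in> short_interval f h \<longleftrightarrow> (\<forall>i\<le>n - h - 1. coeff g (n - i) = coeff f (n - i))"
proof
  assume g: "g \<in> short_interval f h"
  have "coeff (f - g) i = 0" if "i > h" for i
    using g that coeff_eq_0[of "f - g" i] by (auto simp: short_interval_def)
  then show "\<forall>i\<le>n - h - 1. coeff g (n - i) = coeff f (n - i)" using assms(5) by auto
next
  assume eq: "\<forall>i\<le>n - h - 1. coeff g (n - i) = coeff f (n - i)"
  have "coeff (f - g) i = 0" if "i > h" for i
  proof (cases "i \<le> n")
    case True
    then have "coeff g (n - (n - i)) = coeff f (n - (n - i))" using eq that by (intro eq[rule_format]) simp
    then show ?thesis using True by simp
  next
    case False
    then show ?thesis using assms by (simp add: coeff_eq_0)
  qed
  then have "degree (f - g) \<le> h" by (intro degree_le) auto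
  then show "g \<in> short_interval f h" using assms by (simp add: short_interval_def)
qed

theorem theorem1p6:
  fixes f :: "'a::{field,finite} poly" and n h :: nat
  assumes "n \<ge> 1" and "h + 1 < n"
    and "monic f" and "degree f = n"
  shows "abs (real (card {M \<in> GL_mat n. char_poly M \<in> short_interval f h})
                / real (card (GL_mat n :: 'a mat set))
              - real (card (UNIV :: 'a set)) ^ (h + 1) / real (card (UNIV :: 'a set)) ^ n)
         \<le> real (card (UNIV :: 'a set)) powr (- (real n ^ 2 / (2 * real (n - h - 1))))
            * (1 + 1 / (real (card (UNIV :: 'a set)) - 1)) ^ n * real ((2 * n - h - 2) choose n)"
proof -
  define q where "q = card (UNIV :: 'a set)"
  define l where "l = n - h - 1"
  have l: "l \<ge> 1" "l \<le> n" using assms(2) by (auto simp: l_def)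
  have q: "q \<ge> 2" using card_field_ge_2[where 'a='a] by (simp add: q_def)
  define fr where "fr = (\<lambda>x :: 'a alg_closure. x ^ q)"
  interpret frobenius_curve q fr l
    unfolding q_def fr_def using l by (intro frobenius_curve.intro frobenius_alg_closure frobenius_curve_axioms.intro)
  interpret R: finite_comm_group residue_group by (rule residue_group)
  have ac_fixed: "to_ac a ^ q = to_ac a" for a :: 'a
    by (simp add: q_def finite_field_power_card flip: to_ac_power)
  \<comment> \<open>Both sets have q elements, so the fixed field inside the closure is the original
    field.\<close>
  have range: "{x :: 'a alg_closure. x ^ q = x} = range (to_ac :: 'a \<Rightarrow> _)"
  proof (rule card_subset_eq[symmetric])
    show "finite {x :: 'a alg_closure. x ^ q = x}" using finite_frob_fixed[of 1] by simp
    show "range (to_ac :: 'a \<Rightarrow> _) \<subseteq> {x :: 'a alg_closure. x ^ q = x}" using ac_fixed by auto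
    show "card (range (to_ac :: 'a \<Rightarrow> _)) = card {x :: 'a alg_closure. x ^ q = x}"
      using card_frob_fixed[of 1] card_image[OF inj_to_ac[where 'a='a]] by (simp add: q_def)
  qed
  \<comment> \<open>Translates the polynomials in \<open>GL_mean_recursion\<close> into
    \<open>monics d\<close>, so that its coefficients become \<open>lam d\<close>.\<close>
  have bij: "bij_betw ac_poly {g :: 'a poly. monic g \<and> degree g = d \<and> coeff g 0 \<noteq> 0} (monics d)" for d
  proof (rule bij_betwI')
    fix g g' :: "'a poly"
    show "ac_poly g = ac_poly g' \<longleftrightarrow> g = g'" by (metis coeff_ac_poly poly_eqI to_ac_eq_iff)
  next
    fix g :: "'a poly" assume "g \<in> {g. monic g \<and> degree g = d \<and> coeff g 0 \<noteq> 0}"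
    then show "ac_poly g \<in> monics d" using ac_fixed by (auto simp: monics_def)
  next
    fix p assume p: "p \<in> monics d"
    define g where "g = map_poly of_ac p"
    have "coeff p i \<in> range to_ac" for i using monicsD(5)[OF p] range by blast
    then have eq: "p = ac_poly g" by (intro poly_eqI) (simp add: g_def coeff_map_poly to_ac_of_ac)
    have "to_ac (coeff g d) = to_ac 1" "to_ac (coeff g 0) \<noteq> 0" "degree g = d"
      using monicsD[OF p] unfolding eq by simp_all
    then have "g \<in> {g. monic g \<and> degree g = d \<and> coeff g 0 \<noteq> 0}" by (simp only: to_ac_eq_iff) simp
    then show "\<exists>g\<in>{g. monic g \<and> degree g = d \<and> coeff g 0 \<noteq> 0}. p = ac_poly g" using eq by blast
  qed
  define Bd where "Bd = real q powr (- (real n ^ 2 / (2 * real l))) * (1 + 1 / (real q - 1)) ^ n * real ((n + l - 1) choose n)"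
  have char_poly_monics: "ac_poly (char_poly M) \<in> monics k" if "M \<in> GL_mat k" for M :: "'a mat" and k
  proof -
    have "M \<in> carrier_mat k k" using that by (simp add: GL_mat_def)
    from monic_char_poly[OF this]
    have "char_poly M \<in> {g. monic g \<and> degree g = k \<and> coeff g 0 \<noteq> 0}" using coeff_char_poly_0[OF that] by blast
    then show ?thesis using bij_betwE[OF bij[of k]] by blast
  qed
  have mean_bound: "norm (GL_mean (\<lambda>g :: 'a poly. \<chi> (cls (ac_poly g))) n) \<le> Bd"
    if \<chi>: "\<chi> \<in> dual residue_group" "\<chi> \<noteq> R.triv" for \<chi>
  proof -
    interpret Chi: frobenius_character q fr l \<chi> by (rule nontrivial_character[OF \<chi>])
    define \<phi> where "\<phi> = (\<lambda>g :: 'a poly. \<chi> (cls (ac_poly g)))"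
    have lam: "(\<Sum>g | monic g \<and> degree g = d \<and> coeff g 0 \<noteq> 0. \<phi> g) = Chi.lam d" for d
      unfolding Chi.lam_def \<phi>_def by (rule sum.reindex_bij_betw[OF bij])
    have mult: "\<phi> (g * k) = \<phi> g * \<phi> k"
      if "monic g" "coeff g 0 \<noteq> 0" "monic k" "coeff k 0 \<noteq> 0" for g k
      unfolding \<phi>_def ac_poly_mult
      by (rule Chi.chi_cls_mult[of _ "degree g" _ "degree k"]) (use that ac_fixed in \<open>simp_all add: monics_def\<close>)
    have one: "\<phi> 1 = 1"
    proof -
      have "\<phi> (1 * 1) = \<phi> 1 * \<phi> 1" by (rule mult) simp_all
      moreover have "norm (\<phi> 1) = 1" unfolding \<phi>_def
        by (intro Chi.chi_norm cls_residue[of _ 0]) (use ac_fixed[of 1] ac_fixed[of 0] in \<open>simp add: monics_def coeff_1\<close>)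
      ultimately show ?thesis by auto
    qed
    \<comment> \<open>The only matrix of size 0 has characteristic polynomial 1.\<close>
    have "GL_mean \<phi> 0 = 1"
    proof -
      have "\<phi> (char_poly M) = 1" if "M \<in> GL_mat 0" for M
        using that monic_char_poly[of M 0] one by (auto simp: GL_mat_def elim!: degree_eq_zeroE simp flip: one_pCons)
      then show ?thesis using card_GL_mat_pos[where 'a='a, of 0] by (simp add: GL_mean_def)
    qed
    moreover have "of_real (real q ^ k) * GL_mean \<phi> k = (\<Sum>d\<le>k. Chi.lam d * GL_mean \<phi> (k - d))" for k
    proof -
      have "of_real (real q ^ k) = (of_nat (card (UNIV :: 'a set) ^ k) :: complex)" by (simp add: q_def)
      moreover have "of_nat (card (UNIV :: 'a set) ^ k) * GL_mean \<phi> k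
          = (\<Sum>d\<le>k. (\<Sum>g | monic g \<and> degree g = d \<and> coeff g 0 \<noteq> 0. \<phi> g) * GL_mean \<phi> (k - d))"
        by (rule GL_mean_recursion) (rule mult)
      ultimately show ?thesis by (simp only: lam)
    qed
    ultimately show ?thesis
      unfolding Bd_def \<phi>_def[symmetric] by (rule Chi.recursion_estimate)
  qed
  define A where "A = (\<lambda>M :: 'a mat. cls (ac_poly (char_poly M)))"
  define t where "t = cls (ac_poly f)"
  have A: "A M \<in> residues" if "M \<in> GL_mat n" for M
    unfolding A_def using char_poly_monics[OF that] by (rule cls_residue)
  have t: "t \<in> residues"
    unfolding t_def cls_def using assms(3,4) ac_fixed q
    by (intro residues_rcls) (auto simp: coeff_reflect_poly)
  have member: "char_poly M \<in> short_interval f h \<longleftrightarrow> A M = t" if M: "M \<in> GL_mat n" for M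
  proof -
    have g: "monic (char_poly M)" "degree (char_poly M) = n"
      using M monic_char_poly[of M n] by (auto simp: GL_mat_def)
    have "h < n" using assms(2) by simp
    from short_interval_iff[OF g(1) assms(3) g(2) assms(4) this]
    have "char_poly M \<in> short_interval f h \<longleftrightarrow> (\<forall>i\<le>l. coeff (char_poly M) (n - i) = coeff f (n - i))"
      by (simp only: l_def)
    also have "\<dots> \<longleftrightarrow> A M = t"
      using g(2) assms(4) l(2) by (auto simp: A_def t_def cls_def fps_eq_iff rcls_nth coeff_reflect_poly)
    finally show ?thesis .
  qed
  \<comment> \<open>The inverse of \<open>t\<close>, so that summing
    \<open>\<chi> (A M) * \<chi> b\<close> over all characters detects
    \<open>A M = t\<close>.\<close>
  define b where "b = inv\<^bsub>residue_group\<^esub> t"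
  have b: "b \<in> residues" "rcls (t * b) = 1" using R.inv_closed[of t] R.r_inv[of t] t by (simp_all add: b_def)
  have detect: "(\<Sum>\<chi>\<in>dual residue_group. \<chi> (A M) * \<chi> b) = (if A M = t then of_nat (q ^ l) else 0)"
    if M: "M \<in> GL_mat n" for M
  proof -
    have "(\<Sum>\<chi>\<in>dual residue_group. \<chi> (A M) * \<chi> b) = (\<Sum>\<chi>\<in>dual residue_group. \<chi> (rcls (A M * b)))"
      using R.dualD(1)[of _ "A M" b] A[OF M] b(1) by (intro sum.cong) auto
    also have "\<dots> = (if A M = t then of_nat (q ^ l) else 0)"
    proof (cases "A M = t")
      case True
      have "(\<Sum>\<chi>\<in>dual residue_group. \<chi> 1) = (\<Sum>\<chi>\<in>dual residue_group. 1 :: complex)"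
        using R.dualD(4) by (intro sum.cong) auto
      then show ?thesis using True b(2) R.card_dual residues_finite_card by simp
    next
      case False
      have "rcls (A M * b) \<noteq> 1"
      proof
        assume "rcls (A M * b) = 1"
        then have "A M \<otimes>\<^bsub>residue_group\<^esub> b = t \<otimes>\<^bsub>residue_group\<^esub> b" using b(2) by simp
        then show False using R.right_cancel[of b "A M" t] False A[OF M] b(1) t by simp
      qed
      then show ?thesis using R.sum_dual[of "rcls (A M * b)"] residues_mult[OF A[OF M] b(1)] False by simp
    qed
    finally show ?thesis .
  qed
  define S where "S = {M \<in> GL_mat n. char_poly M \<in> short_interval f h}"
  define N where "N = (of_nat (card (GL_mat n :: 'a mat set)) :: complex)"
  have N: "N \<noteq> 0" using card_GL_mat_pos[where 'a='a, of n] by (simp add: N_def)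
  define m where "m \<chi> = GL_mean (\<lambda>g :: 'a poly. \<chi> (cls (ac_poly g))) n" for \<chi>
  have "of_nat (q ^ l) * of_nat (card S) = (\<Sum>M\<in>GL_mat n. if A M = t then of_nat (q ^ l) else (0 :: complex))"
  proof -
    have "S = {M \<in> GL_mat n. A M = t}" using member by (auto simp: S_def)
    then show ?thesis using finite_GL_mat[where 'a='a, of n] by (simp add: sum.If_cases Int_def mult.commute)
  qed
  also have "\<dots> = (\<Sum>M\<in>GL_mat n. \<Sum>\<chi>\<in>dual residue_group. \<chi> (A M) * \<chi> b)"
    using detect by (intro sum.cong) auto
  also have "\<dots> = (\<Sum>\<chi>\<in>dual residue_group. \<chi> b * (\<Sum>M\<in>GL_mat n. \<chi> (A M)))"
    by (subst sum.swap) (simp add: sum_distrib_left mult.commute)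
  also have "\<dots> = N * (\<Sum>\<chi>\<in>dual residue_group. \<chi> b * m \<chi>)"
  proof -
    have "(\<Sum>M\<in>GL_mat n. \<chi> (A M)) = N * m \<chi>" for \<chi>
      using N by (simp add: m_def GL_mean_def A_def N_def)
    then show ?thesis by (simp add: sum_distrib_left mult.left_commute)
  qed
  also have "(\<Sum>\<chi>\<in>dual residue_group. \<chi> b * m \<chi>) = R.triv b * m R.triv + (\<Sum>\<chi>\<in>dual residue_group - {R.triv}. \<chi> b * m \<chi>)"
    by (rule sum.remove[OF R.finite_dual R.triv_dual])
  \<comment> \<open>The trivial character gives the main term; all others go into the error.\<close>
  also have "R.triv b * m R.triv = 1"
  proof -
    have "(\<Sum>M\<in>GL_mat n. R.triv (A M)) = N"
      using A by (simp add: R.triv_def N_def)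
    then show ?thesis using b(1) N by (simp add: R.triv_def[of b] m_def GL_mean_def A_def N_def[symmetric])
  qed
  finally have main: "of_nat (q ^ l) * (of_nat (card S) / N) - 1 = (\<Sum>\<chi>\<in>dual residue_group - {R.triv}. \<chi> b * m \<chi>)"
    using N by (simp add: field_simps)
  have "norm (of_nat (q ^ l) * (of_nat (card S) / N) - 1) \<le> (\<Sum>\<chi>\<in>dual residue_group - {R.triv}. Bd)"
    unfolding main
  proof (rule order_trans[OF norm_sum sum_mono])
    fix \<chi> assume \<chi>: "\<chi> \<in> dual residue_group - {R.triv}"
    then show "norm (\<chi> b * m \<chi>) \<le> Bd"
      using R.dual_norm[of \<chi> b] b(1) mean_bound[of \<chi>] by (simp add: norm_mult m_def)
  qed
  \<comment> \<open>At most q^l characters contribute, and this factor cancels against the q^l on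
    the left.\<close>
  also have "\<dots> \<le> real (q ^ l) * Bd"
  proof -
    have "card (dual residue_group - {R.triv}) \<le> q ^ l"
      using R.card_dual residues_finite_card R.finite_dual by (metis card_Diff1_le residue_group_simps(1))
    moreover have "Bd \<ge> 0" using q by (simp add: Bd_def)
    ultimately show ?thesis by (simp add: mult_right_mono del: of_nat_power)
  qed
  also have "of_nat (q ^ l) * (of_nat (card S) / N) - 1
      = complex_of_real (real (q ^ l) * (real (card S) / real (card (GL_mat n :: 'a mat set))) - 1)"
    by (simp add: N_def)
  finally have dev: "\<bar>real (q ^ l) * (real (card S) / real (card (GL_mat n :: 'a mat set))) - 1\<bar> \<le> real (q ^ l) * Bd"
    by (simp only: norm_of_real)
  have pos: "real (q ^ l) > 0" using q by simp
  have "\<bar>w * p - 1\<bar> = w * \<bar>p - 1 / w\<bar>" if "w > 0" for w p :: real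
  proof -
    have "w * p - 1 = w * (p - 1 / w)" using that by (simp add: right_diff_distrib)
    then show ?thesis using that by (simp add: abs_mult)
  qed
  from dev[unfolded this[OF pos]] have "real (q ^ l) * \<bar>real (card S) / real (card (GL_mat n :: 'a mat set)) - 1 / real (q ^ l)\<bar> \<le> real (q ^ l) * Bd"
    .
  then have "\<bar>real (card S) / real (card (GL_mat n :: 'a mat set)) - 1 / real (q ^ l)\<bar> \<le> Bd"
    using pos by (simp only: mult_le_cancel_left_pos)
  moreover have "1 / real (q ^ l) = real q ^ (h + 1) / real q ^ n"
  proof -
    have "n = (h + 1) + l" using assms(2) by (simp add: l_def)
    then have "real q ^ n = real q ^ (h + 1) * real (q ^ l)" by (simp add: power_add)
    then show ?thesis using q by simp
  qed
  moreover have "n + l - 1 = 2 * n - h - 2" using assms(2) by (simp add: l_def)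
  ultimately show ?thesis by (simp only: S_def Bd_def l_def q_def)
qed

end
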